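(* Let $n\ge 1$, $Q=2n+2$, $0<\lambda<Q$, and $1<p,q<\infty$ with $$\frac1q=\frac1p-\frac{Q-\lambda}{Q}.$$ Let $C_{p,\lambda,n}=\sup\{\|I_\lambda(f)\|_q : f\in L^p(\mathbb H^n),\ \|f\|_p=1\}<\infty$, and let $\{f_j\}$ be a maximizing sequence for this supremum, i.e. $f_j\in L^p(\mathbb H^n)$, $\|f_j\|_p=1$ and $\|I_\lambda(f_j)\|_q\to C_{p,\lambda,n}$ as $j\to\infty$. Then there exist $\{u_j\}\subseteq\mathbb H^n$ and $\{d_j\}\subseteq(0,\infty)$ such that the new maximizing sequence $\{h_j\}$ defined by $$h_j(u)=\frac{1}{d_j^{Q/p}}\,f_j\big(\delta_{1/d_j}(u_ju)\big),\qquad u\in\mathbb H^n,$$ is relatively compact in $L^p(\mathbb H^n)$. In particular, the supremum is attained: there exists $f\in L^p(\mathbb H^n)$ with $\|f\|_p=1$ and $\|I_\lambda(f)\|_q=C_{p,\lambda,n}$.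
   Context: The Heisenberg group is $\mathbb H^n=\mathbb C^n\times\mathbb R$ with group law $(z,t)(z',t')=(z+z',\,t+t'+2\,\mathrm{Im}(z\cdot\overline{z'}))$, where $z\cdot\overline{z'}=\sum_{j=1}^n z_j\overline{z_j'}$; the inverse is $(z,t)^{-1}=(-z,-t)$. Haar measure is Lebesgue measure $du=dz\,dt$ (on $\mathbb R^{2n+1}$), and $\|\cdot\|_p$ is the norm of $L^p(\mathbb H^n)$ (complex-valued functions). Dilations are $\delta_d(z,t)=(dz,d^2t)$, the homogeneous norm is $|(z,t)|=(|z|^4+t^2)^{1/4}$, and $Q=2n+2$ is the homogeneous dimension. The fractional integral operator is $$I_\lambda(f)(u)=\int_{\mathbb H^n}\frac{f(v)}{|u^{-1}v|^\lambda}\,dv,\qquad u\in\mathbb H^n.$$ The finiteness of $C_{p,\lambda,n}$ is the (known) Hardy-Littlewood-Sobolev inequality of Folland and Stein on $\mathbb H^n$. *)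

theory Defs
  imports "HOL-Analysis.Analysis"
begin

section \<open>The Heisenberg group\<close>

text \<open>
  The dimension \<open>n\<close> is the cardinality of the finite index type \<open>'n\<close> (so \<open>n \<ge> 1\<close>).
  Since \<open>'n heis\<close> is a Euclidean space, \<open>lborel\<close> is Lebesgue measure on
  \<open>\<real>\<^sup>2\<^sup>n\<^sup>+\<^sup>1\<close>, i.e. Haar measure. The instances \<open>+\<close>, \<open>0\<close>, \<open>norm\<close> of this type are the
  Euclidean ones; group law, dilations and homogeneous norm are the constants below.
\<close>

type_synonym 'n heis = "(complex ^ 'n) \<times> real"

definition heis_mult :: "'n::finite heis \<Rightarrow> 'n heis \<Rightarrow> 'n heis" (infixl \<open>\<cdot>\<^sub>H\<close> 70) where
  "u \<cdot>\<^sub>H v = (fst u + fst v,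
             snd u + snd v + 2 * Im (\<Sum>j\<in>UNIV. fst u $ j * cnj (fst v $ j)))"

definition heis_inv :: "'n::finite heis \<Rightarrow> 'n heis" where
  "heis_inv u = (- fst u, - snd u)"

definition heis_dil :: "real \<Rightarrow> 'n::finite heis \<Rightarrow> 'n heis" where
  "heis_dil d u = (d *\<^sub>R fst u, d ^ 2 * snd u)"

definition heis_norm :: "'n::finite heis \<Rightarrow> real" where
  "heis_norm u = root 4 (norm (fst u) ^ 4 + snd u ^ 2)"

definition hom_dim :: "'n::finite itself \<Rightarrow> real" where
  "hom_dim _ = 2 * real CARD('n) + 2"

section \<open>Lebesgue spaces of complex-valued functions\<close>

text \<open>
  Elements of \<open>L\<^sup>p\<close> are represented by Borel functions; functions equal almost everywhere
  are not identified, so the norm is only a seminorm on representatives and the topology of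
  \<open>Lp_topology\<close> is that of a pseudometric. Closure and compactness are unaffected by this: the
  open sets are exactly the preimages of the open sets of the quotient by almost everywhere
  equality.
\<close>

definition Lp_norm :: "real \<Rightarrow> ('a::euclidean_space \<Rightarrow> complex) \<Rightarrow> ennreal" where
  "Lp_norm p f =
     (let N = (\<integral>\<^sup>+ u. ennreal (norm (f u) powr p) \<partial>lborel)
      in if N = \<infinity> then \<infinity> else ennreal (enn2real N powr (1 / p)))"

definition Lp_space :: "real \<Rightarrow> ('a::euclidean_space \<Rightarrow> complex) set" where
  "Lp_space p = {f \<in> borel_measurable lborel. Lp_norm p f < \<infinity>}"

definition Lp_open :: "real \<Rightarrow> ('a::euclidean_space \<Rightarrow> complex) set \<Rightarrow> bool" where
  "Lp_open p U \<longleftrightarrow> U \<subseteq> Lp_space p \<and>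
     (\<forall>f\<in>U. \<exists>e>0. \<forall>g\<in>Lp_space p. Lp_norm p (\<lambda>u. g u - f u) < ennreal e \<longrightarrow> g \<in> U)"

definition Lp_topology :: "real \<Rightarrow> ('a::euclidean_space \<Rightarrow> complex) topology" where
  "Lp_topology p = topology (Lp_open p)"

lemma istopology_Lp_open: "istopology (Lp_open p)"
  unfolding istopology_def
proof (intro conjI allI impI)
  fix S T :: "('a \<Rightarrow> complex) set"
  assume S: "Lp_open p S" and T: "Lp_open p T"
  show "Lp_open p (S \<inter> T)"
    unfolding Lp_open_def
  proof (intro conjI ballI)
    show "S \<inter> T \<subseteq> Lp_space p" using S by (auto simp: Lp_open_def)
  next
    fix f assume f: "f \<in> S \<inter> T"
    obtain a where a: "a > 0"
      "\<forall>g\<in>Lp_space p. Lp_norm p (\<lambda>u. g u - f u) < ennreal a \<longrightarrow> g \<in> S"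
      using S f by (auto simp: Lp_open_def)
    obtain b where b: "b > 0"
      "\<forall>g\<in>Lp_space p. Lp_norm p (\<lambda>u. g u - f u) < ennreal b \<longrightarrow> g \<in> T"
      using T f by (auto simp: Lp_open_def)
    have "g \<in> S \<inter> T"
      if "g \<in> Lp_space p" "Lp_norm p (\<lambda>u. g u - f u) < ennreal (min a b)" for g
    proof
      show "g \<in> S" by (rule a(2)[rule_format, OF that(1) less_le_trans[OF that(2)]]) (rule ennreal_leI, simp)
      show "g \<in> T" by (rule b(2)[rule_format, OF that(1) less_le_trans[OF that(2)]]) (rule ennreal_leI, simp)
    qed
    then show "\<exists>e>0. \<forall>g\<in>Lp_space p. Lp_norm p (\<lambda>u. g u - f u) < ennreal e \<longrightarrow> g \<in> S \<inter> T"
      using a(1) b(1) by (intro exI[of _ "min a b"]) simp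
  qed
next
  fix K :: "('a \<Rightarrow> complex) set set"
  assume K: "\<forall>S\<in>K. Lp_open p S"
  show "Lp_open p (\<Union>K)"
    unfolding Lp_open_def
  proof (intro conjI ballI)
    show "\<Union>K \<subseteq> Lp_space p" using K by (auto simp: Lp_open_def)
  next
    fix f assume "f \<in> \<Union>K"
    then obtain S where S: "S \<in> K" "f \<in> S" by (rule UnionE)
    from K S(1) have "Lp_open p S" by (rule bspec)
    then have "\<exists>e>0. \<forall>g\<in>Lp_space p. Lp_norm p (\<lambda>u. g u - f u) < ennreal e \<longrightarrow> g \<in> S"
      using S(2) by (simp add: Lp_open_def)
    then obtain e where e: "e > 0"
      "\<forall>g\<in>Lp_space p. Lp_norm p (\<lambda>u. g u - f u) < ennreal e \<longrightarrow> g \<in> S"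
      by (elim exE conjE)
    then show "\<exists>e>0. \<forall>g\<in>Lp_space p. Lp_norm p (\<lambda>u. g u - f u) < ennreal e \<longrightarrow> g \<in> \<Union>K"
      using S(1) by (intro exI[of _ e]) auto
  qed
qed

lemma openin_Lp_topology: "openin (Lp_topology p) = Lp_open p"
  by (simp add: Lp_topology_def topology_inverse' istopology_Lp_open)

lemma topspace_Lp_topology:
  "topspace (Lp_topology p) = (Lp_space p :: ('a::euclidean_space \<Rightarrow> complex) set)"
proof (rule subset_antisym)
  have "Lp_open p (topspace (Lp_topology p :: ('a \<Rightarrow> complex) topology))"
    unfolding openin_Lp_topology[symmetric] by (rule openin_topspace)
  then show "topspace (Lp_topology p) \<subseteq> (Lp_space p :: ('a \<Rightarrow> complex) set)"
    by (simp add: Lp_open_def)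
  have "openin (Lp_topology p) (Lp_space p :: ('a \<Rightarrow> complex) set)"
    unfolding openin_Lp_topology Lp_open_def by (simp add: gt_ex)
  then show "(Lp_space p :: ('a \<Rightarrow> complex) set) \<subseteq> topspace (Lp_topology p)"
    by (rule openin_subset)
qed

definition relatively_compactin :: "'a topology \<Rightarrow> 'a set \<Rightarrow> bool" where
  "relatively_compactin X S \<longleftrightarrow> S \<subseteq> topspace X \<and> compactin X (X closure_of S)"

section \<open>The fractional integral operator\<close>

text \<open>
  The Bochner integral is \<open>0\<close> where the integrand is not absolutely integrable; for the
  functions and exponents considered here this happens only on a null set of \<open>u\<close>.
\<close>

definition frac_int :: "real \<Rightarrow> ('n::finite heis \<Rightarrow> complex) \<Rightarrow> 'n heis \<Rightarrow> complex" where
  "frac_int lam f u =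
     (\<integral>v. f v / complex_of_real (heis_norm (heis_inv u \<cdot>\<^sub>H v) powr lam) \<partial>lborel)"

text \<open>
  The type argument fixes \<open>n\<close>. The exponent \<open>q\<close> is an explicit argument although it is
  determined by the other parameters where the constant is used.
\<close>

definition HLS_const :: "'n::finite itself \<Rightarrow> real \<Rightarrow> real \<Rightarrow> real \<Rightarrow> ennreal" where
  "HLS_const _ p q lam =
     Sup {Lp_norm q (frac_int lam f) | f :: 'n heis \<Rightarrow> complex. f \<in> Lp_space p \<and> Lp_norm p f = 1}"

definition maximizing_seq ::
  "real \<Rightarrow> real \<Rightarrow> real \<Rightarrow> (nat \<Rightarrow> 'n::finite heis \<Rightarrow> complex) \<Rightarrow> bool" where
  "maximizing_seq p q lam f \<longleftrightarrow>
     (\<forall>j. f j \<in> Lp_space p \<and> Lp_norm p (f j) = 1) \<and>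
     (\<lambda>j. Lp_norm q (frac_int lam (f j))) \<longlonglongrightarrow> HLS_const TYPE('n) p q lam"

end

theory Submission
  imports Defs "HOL-Library.Diagonal_Subsequence"
begin

text \<open>
  Compactness of maximizing sequences without rearrangements. Splitting the kernel at a radius
  depending on the level gives a Hedberg type inequality: the \<open>L\<^sup>q\<close> mass of \<open>I\<^sub>\<lambda> f\<close> is bounded by
  \<open>A powr (q - p)\<close> times the \<open>L\<^sup>p\<close> mass of \<open>f\<close>, where \<open>A\<close> is a Morrey norm of \<open>f\<close>. It contains the
  Hardy-Littlewood-Sobolev inequality, and it shows that a maximizing sequence cannot vanish: after
  translations and dilations the unit ball carries a fixed amount of every \<open>h j\<close>.

  Normalized dual functions \<open>g j\<close> of \<open>I\<^sub>\<lambda> (h j)\<close> satisfy \<open>\<integral> h j * I\<^sub>\<lambda> (g j) \<rightarrow> C\<close>, so there is almost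
  equality in Young's inequality for \<open>h j\<close> and \<open>I\<^sub>\<lambda> (g j) / C\<close>. By local compactness of \<open>I\<^sub>\<lambda>\<close> the latter
  converges almost everywhere along a subsequence, hence so does \<open>h j\<close>. The Brezis-Lieb lemma on both sides of
  the inequality and the strict convexity of \<open>t powr (q / p)\<close> leave no mass outside the limit.
\<close>

section \<open>Geometry and measure of the Heisenberg group\<close>

text \<open>The obstacle is the noncompact group of translations and dilations: it preserves
  \<open>Lp_mass p\<close> of a function and \<open>Lp_mass q\<close> of its potential, so a
  maximizing sequence may spread out, concentrate or run away. The Morrey exponent
  \<open>Q * (1 - 1 / p)\<close> is the one that the group leaves invariant; a ball on which the
  Morrey bound fails can therefore be carried to the unit ball at no loss. What is then left to
  exclude is a splitting of the mass. The Brezis-Lieb lemma needs convergence almost everywhere of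
  \<open>h j\<close> itself, but the smoothing of the potential gives this only for images under
  \<open>frac_int\<close>. The dual functions are introduced because they express
  \<open>h j\<close>, up to a small defect, through such an image. Here it matters that the
  conjugate pair \<open>(q', p')\<close> satisfies the same relation as \<open>(p, q)\<close>, and
  that the sharp constant is positive, since it is divided by. The estimates use p-th powers
  (\<open>Lp_mass\<close>) instead of norms, because these are what splits additively; the triangle
  inequality of the norm enters only when compactness is stated in
  \<open>Lp_topology\<close>.\<close>

definition heis_dist :: "'n::finite heis \<Rightarrow> 'n heis \<Rightarrow> real" where
  "heis_dist u v = heis_norm (heis_inv u \<cdot>\<^sub>H v)"

section \<open>Group laws, Cygan's inequality and the left-invariant distance\<close>

definition cform :: "complex ^ 'n \<Rightarrow> complex ^ 'n \<Rightarrow> complex" where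
  "cform z w = (\<Sum>j\<in>UNIV. z $ j * cnj (w $ j))"

lemma heis_mult_eq: "u \<cdot>\<^sub>H v = (fst u + fst v, snd u + snd v + 2 * Im (cform (fst u) (fst v)))"
  by (simp add: heis_mult_def cform_def)

lemma cform_add: "cform (a + b) c = cform a c + cform b c" "cform a (b + c) = cform a b + cform a c"
  by (simp_all add: cform_def algebra_simps sum.distrib)

lemma cform_neg: "cform (- a) c = - cform a c" "cform a (- c) = - cform a c"
  by (simp_all add: cform_def sum_negf)

lemma cform_scaleR: "cform (r *\<^sub>R a) c = r *\<^sub>R cform a c" "cform a (r *\<^sub>R c) = r *\<^sub>R cform a c"
  by (simp_all add: cform_def scaleR_sum_right)

lemma cform_commute: "cform a b = cnj (cform b a)"
  by (simp add: cform_def mult.commute)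

lemma Im_cform_commute: "Im (cform a b) = - Im (cform b a)"
  by (subst cform_commute) simp

lemma Im_cform_self: "Im (cform a a) = 0"
  using Im_cform_commute[of a a] by simp

lemma cform_self: "cform a a = complex_of_real (norm a ^ 2)"
proof -
  have "Re (cform a a) = norm a ^ 2"
    by (simp add: cform_def norm_vec_def L2_set_def sum_nonneg power2_eq_square[symmetric] cmod_power2)
  then show ?thesis using Im_cform_self[of a] by (simp add: complex_eq_iff)
qed

lemma norm_cform_le: "norm (cform a b) \<le> norm a * norm b"
proof -
  have "norm (cform a b) \<le> (\<Sum>j\<in>UNIV. \<bar>norm (a $ j)\<bar> * \<bar>norm (b $ j)\<bar>)"
    unfolding cform_def by (rule order_trans[OF norm_sum]) (simp add: norm_mult)
  also have "\<dots> \<le> norm a * norm b"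
    unfolding norm_vec_def by (rule L2_set_mult_ineq)
  finally show ?thesis .
qed

lemma heis_mult_assoc: "(u \<cdot>\<^sub>H v) \<cdot>\<^sub>H w = u \<cdot>\<^sub>H (v \<cdot>\<^sub>H w)"
  unfolding heis_mult_eq by (simp add: cform_add algebra_simps)

lemma cform_0 [simp]: "cform 0 a = 0" "cform a 0 = 0"
  by (simp_all add: cform_def)

lemma heis_mult_0 [simp]: "0 \<cdot>\<^sub>H v = v" "v \<cdot>\<^sub>H 0 = v"
  unfolding heis_mult_eq by (simp_all add: prod_eq_iff)

lemma heis_inv_left [simp]: "heis_inv u \<cdot>\<^sub>H u = 0"
  unfolding heis_mult_eq heis_inv_def by (simp add: cform_neg Im_cform_self prod_eq_iff)

lemma heis_inv_right [simp]: "u \<cdot>\<^sub>H heis_inv u = 0"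
  unfolding heis_mult_eq heis_inv_def by (simp add: cform_neg Im_cform_self prod_eq_iff)

lemma heis_inv_cancel [simp]: "heis_inv u \<cdot>\<^sub>H (u \<cdot>\<^sub>H v) = v" "u \<cdot>\<^sub>H (heis_inv u \<cdot>\<^sub>H v) = v"
  by (simp_all flip: heis_mult_assoc)

lemma heis_inv_inv [simp]: "heis_inv (heis_inv u) = u"
  by (simp add: heis_inv_def)

lemma heis_inv_0 [simp]: "heis_inv 0 = 0"
  by (simp add: heis_inv_def prod_eq_iff)

lemma heis_inv_mult: "heis_inv (u \<cdot>\<^sub>H v) = heis_inv v \<cdot>\<^sub>H heis_inv u"
  by (simp add: heis_mult_eq heis_inv_def cform_neg Im_cform_commute[of "fst v" "fst u"])

lemma heis_dil_mult: "heis_dil d (u \<cdot>\<^sub>H v) = heis_dil d u \<cdot>\<^sub>H heis_dil d v"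
  unfolding heis_mult_eq heis_dil_def
  by (simp add: cform_scaleR algebra_simps power2_eq_square)

lemma heis_dil_inv: "heis_dil d (heis_inv u) = heis_inv (heis_dil d u)"
  by (simp add: heis_inv_def heis_dil_def)

lemma heis_dil_dil: "heis_dil c (heis_dil d u) = heis_dil (c * d) u"
  by (simp add: heis_dil_def power_mult_distrib)

lemma heis_dil_1 [simp]: "heis_dil 1 u = u"
  by (simp add: heis_dil_def)

text \<open>Homogeneity and the triangle inequality of the gauge are both read off from this complex
  number: dilation by \<open>d\<close> multiplies it by \<open>d ^ 2\<close>, and products add such
  numbers up to a mixed term.\<close>

lemma heis_norm_eq_cmod: "heis_norm u = sqrt (cmod (Complex (norm (fst u) ^ 2) (snd u)))"
proof -
  have "sqrt (sqrt x) = root 4 x" for x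
    by (simp add: sqrt_def real_root_mult_exp[symmetric])
  then show ?thesis unfolding heis_norm_def by (simp add: cmod_def)
qed

lemma heis_norm_nonneg [simp]: "heis_norm u \<ge> 0"
  by (simp add: heis_norm_eq_cmod)

lemma heis_norm_power2: "heis_norm u ^ 2 = cmod (Complex (norm (fst u) ^ 2) (snd u))"
  by (simp add: heis_norm_eq_cmod)

lemma norm_fst_le_heis_norm: "norm (fst u) \<le> heis_norm u"
proof -
  have "norm (fst u) ^ 2 \<le> heis_norm u ^ 2"
    unfolding heis_norm_power2 using abs_Re_le_cmod[of "Complex (norm (fst u) ^ 2) (snd u)"] by simp
  then show ?thesis by (rule power2_le_imp_le) simp
qed

lemma abs_snd_le_heis_norm: "\<bar>snd u\<bar> \<le> heis_norm u ^ 2"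
  unfolding heis_norm_power2 using abs_Im_le_cmod[of "Complex (norm (fst u) ^ 2) (snd u)"] by simp

lemma heis_norm_eq_0 [simp]: "heis_norm u = 0 \<longleftrightarrow> u = 0"
  by (simp add: heis_norm_eq_cmod complex_eq_iff prod_eq_iff)

lemma heis_norm_inv [simp]: "heis_norm (heis_inv u) = heis_norm u"
  by (simp add: heis_norm_def heis_inv_def)

lemma heis_norm_dil: "d \<ge> 0 \<Longrightarrow> heis_norm (heis_dil d u) = d * heis_norm u"
proof -
  assume d: "d \<ge> 0"
  have "Complex (norm (fst (heis_dil d u)) ^ 2) (snd (heis_dil d u)) =
      of_real (d^2) * Complex (norm (fst u) ^ 2) (snd u)"
    by (simp add: heis_dil_def complex_eq_iff power_mult_distrib)
  then show ?thesis unfolding heis_norm_eq_cmod using d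
    by (simp add: norm_mult real_sqrt_mult norm_power)
qed

text \<open>Cygan's inequality: the squared norm is the modulus of \<open>\<bar>z\<bar>\<^sup>2 + \<i> t\<close>, and the product
  contributes the mixed term \<open>2 z \<sqdot> cnj z'\<close>, whose modulus is at most \<open>2 \<bar>z\<bar> \<bar>z'\<bar>\<close>.\<close>

lemma heis_norm_mult_le: "heis_norm (u \<cdot>\<^sub>H v) \<le> heis_norm u + heis_norm v"
proof -
  let ?C = "\<lambda>u::'a heis. Complex (norm (fst u) ^ 2) (snd u)"
  have "complex_of_real (norm (fst (u \<cdot>\<^sub>H v)) ^ 2) = cform (fst u + fst v) (fst u + fst v)"
    by (simp only: cform_self heis_mult_eq fst_conv)
  also have "\<dots> = cform (fst u) (fst u) + cform (fst v) (fst v) + (cform (fst u) (fst v) + cnj (cform (fst u) (fst v)))"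
    by (simp only: cform_add cform_commute[of "fst v" "fst u"] ac_simps)
  also have "\<dots> = complex_of_real (norm (fst u) ^ 2 + norm (fst v) ^ 2 + 2 * Re (cform (fst u) (fst v)))"
    unfolding complex_add_cnj by (simp add: cform_self)
  finally have "norm (fst (u \<cdot>\<^sub>H v)) ^ 2 = norm (fst u) ^ 2 + norm (fst v) ^ 2 + 2 * Re (cform (fst u) (fst v))"
    by (simp only: of_real_eq_iff)
  then have eq: "?C (u \<cdot>\<^sub>H v) = ?C u + ?C v + 2 * cform (fst u) (fst v)"
    by (simp add: complex_eq_iff heis_mult_eq)
  have "heis_norm (u \<cdot>\<^sub>H v) ^ 2 \<le> cmod (?C u) + cmod (?C v) + cmod (2 * cform (fst u) (fst v))"
    unfolding heis_norm_power2 eq by (intro order_trans[OF norm_triangle_ineq] add_mono) auto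
  also have "cmod (2 * cform (fst u) (fst v)) \<le> 2 * (heis_norm u * heis_norm v)"
    unfolding norm_mult
    by (simp, rule order_trans[OF norm_cform_le mult_mono]) (simp_all add: norm_fst_le_heis_norm)
  finally have "heis_norm (u \<cdot>\<^sub>H v) ^ 2 \<le> (heis_norm u + heis_norm v) ^ 2"
    by (simp add: heis_norm_power2[symmetric] power2_sum)
  then show ?thesis by (rule power2_le_imp_le) simp
qed

lemma heis_dist_nonneg [simp]: "heis_dist u v \<ge> 0"
  by (simp add: heis_dist_def)

lemma heis_dist_self [simp]: "heis_dist u u = 0"
  by (simp add: heis_dist_def)

lemma heis_dist_eq_0 [simp]: "heis_dist u v = 0 \<longleftrightarrow> u = v"
proof
  assume "heis_dist u v = 0"
  then have "heis_inv u \<cdot>\<^sub>H v = 0" by (simp add: heis_dist_def)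
  then have "u \<cdot>\<^sub>H (heis_inv u \<cdot>\<^sub>H v) = u" by simp
  then show "u = v" by simp
qed simp

lemma heis_dist_commute: "heis_dist u v = heis_dist v u"
  using heis_norm_inv[of "heis_inv u \<cdot>\<^sub>H v"] by (simp add: heis_dist_def heis_inv_mult del: heis_norm_inv)

lemma heis_dist_triangle: "heis_dist u w \<le> heis_dist u v + heis_dist v w"
  using heis_norm_mult_le[of "heis_inv u \<cdot>\<^sub>H v" "heis_inv v \<cdot>\<^sub>H w"]
  by (simp add: heis_dist_def heis_mult_assoc)

lemma heis_dist_left [simp]: "heis_dist (w \<cdot>\<^sub>H u) (w \<cdot>\<^sub>H v) = heis_dist u v"
  by (simp add: heis_dist_def heis_inv_mult heis_mult_assoc)

lemma heis_dist_dil: "d \<ge> 0 \<Longrightarrow> heis_dist (heis_dil d u) (heis_dil d v) = d * heis_dist u v"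
  by (simp add: heis_dist_def heis_norm_dil flip: heis_dil_inv heis_dil_mult)

lemma continuous_on_heis_dist [continuous_intros]:
  assumes "continuous_on S f" "continuous_on S g"
  shows "continuous_on S (\<lambda>x. heis_dist (f x) (g x))"
  unfolding heis_dist_def heis_norm_def heis_mult_def heis_inv_def
  using assms by (auto intro!: continuous_intros)

lemma borel_measurable_heis_dist [measurable (raw)]:
  fixes f g :: "_ \<Rightarrow> 'n::finite heis"
  assumes "f \<in> borel_measurable M" "g \<in> borel_measurable M"
  shows "(\<lambda>x. heis_dist (f x) (g x)) \<in> borel_measurable M"
proof -
  have "(\<lambda>x::'n heis \<times> 'n heis. heis_dist (fst x) (snd x)) \<in> borel_measurable borel"
    by (intro borel_measurable_continuous_onI continuous_intros)
  from measurable_compose[OF borel_measurable_Pair[OF assms] this] show ?thesis by simp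
qed

lemma borel_measurable_heis_mult [measurable (raw)]:
  fixes f g :: "_ \<Rightarrow> 'n::finite heis"
  assumes "f \<in> borel_measurable M" "g \<in> borel_measurable M"
  shows "(\<lambda>x. f x \<cdot>\<^sub>H g x) \<in> borel_measurable M"
proof -
  have "(\<lambda>x::'n heis \<times> 'n heis. fst x \<cdot>\<^sub>H snd x) \<in> borel_measurable borel"
    unfolding heis_mult_def by (intro borel_measurable_continuous_onI continuous_intros)
  from measurable_compose[OF borel_measurable_Pair[OF assms] this] show ?thesis by simp
qed

lemma borel_measurable_heis_dil [measurable (raw)]:
  fixes f :: "_ \<Rightarrow> 'n::finite heis"
  assumes "f \<in> borel_measurable M"
  shows "(\<lambda>x. heis_dil d (f x)) \<in> borel_measurable M"
proof -
  have "(heis_dil d :: 'n heis \<Rightarrow> _) \<in> borel_measurable borel"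
    unfolding heis_dil_def by (intro borel_measurable_continuous_onI continuous_intros)
  from measurable_compose[OF assms this] show ?thesis .
qed

section \<open>Haar measure under translations and dilations\<close>

lemma nn_integral_lborel_translate:
  fixes f :: "'a::euclidean_space \<Rightarrow> ennreal"
  assumes [measurable]: "f \<in> borel_measurable borel"
  shows "(\<integral>\<^sup>+x. f (c + x) \<partial>lborel) = (\<integral>\<^sup>+x. f x \<partial>lborel)"
  by (subst (2) lborel_distr_plus[symmetric, of c]) (simp add: nn_integral_distr)

lemma nn_integral_lborel_scaleR:
  fixes f :: "'a::euclidean_space \<Rightarrow> ennreal"
  assumes [measurable]: "f \<in> borel_measurable borel" and "c > 0"
  shows "(\<integral>\<^sup>+x. f (c *\<^sub>R x) \<partial>lborel) = ennreal (c powr - real DIM('a)) * (\<integral>\<^sup>+x. f x \<partial>lborel)"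
proof -
  have "(\<integral>\<^sup>+x. f x \<partial>lborel) = ennreal (c ^ DIM('a)) * (\<integral>\<^sup>+x. f (c *\<^sub>R x) \<partial>lborel)"
    using \<open>c > 0\<close>
    by (subst lborel_affine[of c 0]) (simp_all add: nn_integral_density nn_integral_distr nn_integral_cmult)
  moreover have "ennreal (c powr - real DIM('a)) * ennreal (c ^ DIM('a)) = 1"
    using \<open>c > 0\<close> by (subst ennreal_mult[symmetric]) (simp_all add: powr_minus powr_realpow)
  ultimately show ?thesis by (simp add: mult.assoc[symmetric])
qed

lemma nn_integral_lborel_Pair:
  fixes f :: "'a::euclidean_space \<times> 'b::euclidean_space \<Rightarrow> ennreal"
  assumes "f \<in> borel_measurable borel"
  shows "(\<integral>\<^sup>+u. f u \<partial>lborel) = (\<integral>\<^sup>+z. \<integral>\<^sup>+t. f (z, t) \<partial>lborel \<partial>lborel)"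
  using lborel.nn_integral_fst[of f lborel] assms by (simp add: lborel_prod)

text \<open>For fixed \<open>z\<close> the group law shifts the last coordinate by a constant that
  depends on \<open>w\<close> and \<open>z\<close> only, so Tonelli reduces the claim to a Euclidean
  translation in \<open>t\<close> followed by one in \<open>z\<close>.\<close>

lemma nn_integral_heis_translate:
  fixes f :: "'n::finite heis \<Rightarrow> ennreal"
  assumes [measurable]: "f \<in> borel_measurable borel"
  shows "(\<integral>\<^sup>+u. f (w \<cdot>\<^sub>H u) \<partial>lborel) = (\<integral>\<^sup>+u. f u \<partial>lborel)"
proof -
  have "(\<integral>\<^sup>+u. f (w \<cdot>\<^sub>H u) \<partial>lborel) = (\<integral>\<^sup>+z. \<integral>\<^sup>+t. f (w \<cdot>\<^sub>H (z, t)) \<partial>lborel \<partial>lborel)"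
    by (rule nn_integral_lborel_Pair) measurable
  also have "\<dots> = (\<integral>\<^sup>+z. \<integral>\<^sup>+t. f (fst w + z, t) \<partial>lborel \<partial>lborel)"
  proof (rule nn_integral_cong)
    fix z :: "complex ^ 'n"
    let ?c = "snd w + 2 * Im (cform (fst w) z)"
    have "(\<integral>\<^sup>+t. f (w \<cdot>\<^sub>H (z, t)) \<partial>lborel) = (\<integral>\<^sup>+t. f (fst w + z, ?c + t) \<partial>lborel)"
      by (simp add: heis_mult_eq algebra_simps)
    also have "\<dots> = (\<integral>\<^sup>+t. f (fst w + z, t) \<partial>lborel)"
      by (rule nn_integral_lborel_translate[of "\<lambda>t. f (fst w + z, t)"]) measurable
    finally show "(\<integral>\<^sup>+t. f (w \<cdot>\<^sub>H (z, t)) \<partial>lborel) = (\<integral>\<^sup>+t. f (fst w + z, t) \<partial>lborel)" .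
  qed
  also have "\<dots> = (\<integral>\<^sup>+z. \<integral>\<^sup>+t. f (z, t) \<partial>lborel \<partial>lborel)"
    by (rule nn_integral_lborel_translate[of "\<lambda>z. \<integral>\<^sup>+t. f (z, t) \<partial>lborel"]) measurable
  also have "\<dots> = (\<integral>\<^sup>+u. f u \<partial>lborel)"
    by (rule nn_integral_lborel_Pair[symmetric]) measurable
  finally show ?thesis .
qed

text \<open>The central coordinate scales by \<open>c ^ 2\<close> and contributes 2 to the exponent,
  each of the \<open>2 * CARD('n)\<close> real coordinates of \<open>z\<close> contributes 1; the
  sum is \<open>hom_dim\<close>.\<close>

lemma nn_integral_heis_dil:
  fixes f :: "'n::finite heis \<Rightarrow> ennreal"
  assumes [measurable]: "f \<in> borel_measurable borel" and c: "c > 0"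
  shows "(\<integral>\<^sup>+u. f (heis_dil c u) \<partial>lborel) =
    ennreal (c powr - hom_dim TYPE('n)) * (\<integral>\<^sup>+u. f u \<partial>lborel)"
proof -
  have "(\<integral>\<^sup>+u. f (heis_dil c u) \<partial>lborel) = (\<integral>\<^sup>+z. \<integral>\<^sup>+t. f (heis_dil c (z, t)) \<partial>lborel \<partial>lborel)"
    by (rule nn_integral_lborel_Pair) measurable
  also have "\<dots> = (\<integral>\<^sup>+z. ennreal ((c^2) powr - 1) * (\<integral>\<^sup>+t. f (c *\<^sub>R z, t) \<partial>lborel) \<partial>lborel)"
  proof (rule nn_integral_cong)
    fix z :: "complex ^ 'n"
    have "(\<integral>\<^sup>+t. f (heis_dil c (z, t)) \<partial>lborel) = (\<integral>\<^sup>+t. f (c *\<^sub>R z, c^2 *\<^sub>R t) \<partial>lborel)"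
      by (simp add: heis_dil_def)
    also have "\<dots> = ennreal ((c^2) powr - 1) * (\<integral>\<^sup>+t. f (c *\<^sub>R z, t) \<partial>lborel)"
      using c by (subst nn_integral_lborel_scaleR[of "\<lambda>t. f (c *\<^sub>R z, t)"]) auto
    finally show "(\<integral>\<^sup>+t. f (heis_dil c (z, t)) \<partial>lborel) =
      ennreal ((c^2) powr - 1) * (\<integral>\<^sup>+t. f (c *\<^sub>R z, t) \<partial>lborel)" .
  qed
  also have "\<dots> = ennreal ((c^2) powr - 1) * (ennreal (c powr - real DIM(complex ^ 'n)) *
      (\<integral>\<^sup>+z. \<integral>\<^sup>+t. f (z, t) \<partial>lborel \<partial>lborel))"
    using c by (subst nn_integral_cmult) (simp_all add: nn_integral_lborel_scaleR[of "\<lambda>z. \<integral>\<^sup>+t. f (z, t) \<partial>lborel"])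
  also have "(\<integral>\<^sup>+z. \<integral>\<^sup>+t. f (z, t) \<partial>lborel \<partial>lborel) = (\<integral>\<^sup>+u. f u \<partial>lborel)"
    by (rule nn_integral_lborel_Pair[symmetric]) measurable
  also have "ennreal ((c^2) powr - 1) * (ennreal (c powr - real DIM(complex ^ 'n)) * (\<integral>\<^sup>+u. f u \<partial>lborel))
     = ennreal (c powr - hom_dim TYPE('n)) * (\<integral>\<^sup>+u. f u \<partial>lborel)"
  proof -
    have "(c^2) powr - 1 = c powr - 2" using c by (simp add: powr_minus powr_numeral)
    then have "(c^2) powr - 1 * c powr - real DIM(complex ^ 'n) = c powr - hom_dim TYPE('n)"
      by (simp add: hom_dim_def powr_add[symmetric] algebra_simps)
    then show ?thesis by (simp add: mult.assoc[symmetric] ennreal_mult[symmetric])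
  qed
  finally show ?thesis .
qed

section \<open>Volumes of balls and integrals of powers of the distance\<close>

lemma nn_integral_powr_from_0:
  fixes s c :: real
  assumes "s > 0" "c \<ge> 0"
  shows "(\<integral>\<^sup>+x. (if 0 < x \<and> x < c then ennreal (s * x powr (s - 1)) else 0) \<partial>lborel) = ennreal (c powr s)"
proof -
  have "((\<lambda>x. s * x powr (s - 1)) has_integral s * (c powr s / s)) {0..c}"
    using has_integral_mult_right[OF has_integral_powr_from_0[of "s - 1" c], of s] assms by simp
  then have "(\<integral>\<^sup>+x. ennreal (indicator {0..c} x * (s * x powr (s - 1))) \<partial>lborel) = ennreal (c powr s)"
    using nn_integral_has_integral_lebesgue[of "{0..c}" "\<lambda>x. s * x powr (s - 1)" "c powr s"] assms by simp
  moreover have "(\<integral>\<^sup>+x. (if 0 < x \<and> x < c then ennreal (s * x powr (s - 1)) else 0) \<partial>lborel) =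
      (\<integral>\<^sup>+x. ennreal (indicator {0..c} x * (s * x powr (s - 1))) \<partial>lborel)"
    by (rule nn_integral_cong_AE, use AE_lborel_singleton[of 0] AE_lborel_singleton[of c] in eventually_elim)
       (auto simp: indicator_def)
  ultimately show ?thesis by simp
qed

lemma nn_integral_powr_to_inf:
  fixes s c :: real
  assumes "s > 0" "c > 0"
  shows "(\<integral>\<^sup>+x. (if c < x then ennreal (s * x powr (- s - 1)) else 0) \<partial>lborel) = ennreal (c powr - s)"
proof -
  have "((\<lambda>x. s * x powr (- s - 1)) has_integral s * (- (c powr (- s)) / (- s))) {c..}"
    using has_integral_mult_right[OF has_integral_powr_to_inf[of "- s - 1" c], of s] assms by simp
  then have "(\<integral>\<^sup>+x. ennreal (indicator {c..} x * (s * x powr (- s - 1))) \<partial>lborel) = ennreal (c powr - s)"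
    using nn_integral_has_integral_lebesgue[of "{c..}" "\<lambda>x. s * x powr (- s - 1)" "c powr - s"] assms by simp
  moreover have "(\<integral>\<^sup>+x. (if c < x then ennreal (s * x powr (- s - 1)) else 0) \<partial>lborel) =
      (\<integral>\<^sup>+x. ennreal (indicator {c..} x * (s * x powr (- s - 1))) \<partial>lborel)"
    by (rule nn_integral_cong_AE, use AE_lborel_singleton[of c] in eventually_elim)
       (auto simp: indicator_def)
  ultimately show ?thesis by simp
qed

definition heis_vol :: "'n::finite itself \<Rightarrow> real" where
  "heis_vol _ = measure lborel {v :: 'n heis. heis_norm v < 1}"

lemma hom_dim_pos: "hom_dim TYPE('n::finite) > 0"
  by (simp add: hom_dim_def add_nonneg_pos)

lemma heis_norm_0 [simp]: "heis_norm 0 = 0"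
  by simp

lemma heis_dist_0_left: "heis_dist 0 v = heis_norm v"
  by (simp add: heis_dist_def)

lemma borel_measurable_heis_norm [measurable]: "heis_norm \<in> borel_measurable borel"
proof -
  have "(\<lambda>v. heis_dist 0 v) \<in> borel_measurable borel" by measurable
  then show ?thesis by (simp add: heis_dist_0_left)
qed

lemma open_heis_unit_ball: "open {v :: 'n::finite heis. heis_norm v < 1}"
proof -
  have "continuous_on UNIV (\<lambda>v :: 'n heis. heis_dist 0 v)" by (intro continuous_intros)
  then have "open {v :: 'n heis. heis_dist 0 v < 1}"
    by (rule open_Collect_less) (rule continuous_on_const)
  then show ?thesis by (simp add: heis_dist_0_left)
qed

text \<open>The gauge ball is bounded in the Euclidean norm, hence of finite volume; as an open set
  it contains a Euclidean ball around the origin, hence its volume is positive.\<close>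

lemma heis_vol:
  "heis_vol TYPE('n::finite) > 0"
  "emeasure lborel {v :: 'n heis. heis_norm v < 1} = ennreal (heis_vol TYPE('n))"
proof -
  let ?B = "{v :: 'n heis. heis_norm v < 1}"
  have "norm v \<le> 2" if "v \<in> ?B" for v
  proof -
    have "norm (fst v) \<le> 1" "norm (snd v) \<le> 1"
      using norm_fst_le_heis_norm[of v] abs_snd_le_heis_norm[of v] that power_le_one[of "heis_norm v" 2] by simp_all
    then show ?thesis using norm_Pair_le[of "fst v" "snd v"] by simp
  qed
  then have "bounded ?B" by (auto simp: bounded_iff)
  then have fin: "emeasure lborel ?B < \<infinity>" by (rule emeasure_bounded_finite)
  then show "emeasure lborel ?B = ennreal (heis_vol TYPE('n))"
    by (simp add: heis_vol_def emeasure_eq_ennreal_measure)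
  have "emeasure lborel ?B \<noteq> 0"
  proof
    assume *: "emeasure lborel ?B = 0"
    have "(0::'n heis) \<in> ?B" by simp
    with open_heis_unit_ball obtain e where "e > 0" "ball 0 e \<subseteq> ?B" unfolding open_contains_ball by blast
    then have "emeasure lborel (ball (0::'n heis) e) \<le> emeasure lborel ?B"
      using borel_open[OF open_heis_unit_ball] by (intro emeasure_mono) auto
    with * have "emeasure lborel (ball (0::'n heis) e) = 0" by simp
    moreover have "emeasure lborel (ball (0::'n heis) e) > 0"
      using \<open>e > 0\<close> by (subst emeasure_ball) (auto intro!: mult_pos_pos unit_ball_vol_pos)
    ultimately show False by simp
  qed
  then show "heis_vol TYPE('n) > 0"
    using fin by (simp add: heis_vol_def emeasure_eq_ennreal_measure measure_nonneg less_le)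
qed

lemma nn_integral_heis_dist:
  fixes u :: "'n::finite heis"
  assumes [measurable]: "g \<in> borel_measurable borel"
  shows "(\<integral>\<^sup>+v. g (heis_dist u v) \<partial>lborel) = (\<integral>\<^sup>+(v::'n heis). g (heis_norm v) \<partial>lborel)"
  using nn_integral_heis_translate[of "\<lambda>v. g (heis_norm v)" "heis_inv u"] by (simp add: heis_dist_def)

lemma nn_integral_heis_ball:
  fixes u :: "'n::finite heis"
  assumes r: "r > 0"
  shows "(\<integral>\<^sup>+v. (if heis_dist u v < r then 1 else 0) \<partial>lborel) =
    ennreal (heis_vol TYPE('n) * r powr hom_dim TYPE('n))"
proof -
  have "(\<integral>\<^sup>+v. (if heis_dist u v < r then 1 else 0) \<partial>lborel) =
      (\<integral>\<^sup>+(v::'n heis). (if heis_norm v < r then 1 else 0) \<partial>lborel)"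
    by (rule nn_integral_heis_dist) measurable
  also have "\<dots> = (\<integral>\<^sup>+(v::'n heis). (if heis_norm (heis_dil (1 / r) v) < 1 then 1 else 0) \<partial>lborel)"
    using r by (simp add: heis_norm_dil divide_simps)
  also have "\<dots> = ennreal ((1 / r) powr - hom_dim TYPE('n)) * (\<integral>\<^sup>+(v::'n heis). (if heis_norm v < 1 then 1 else 0) \<partial>lborel)"
    using r by (intro nn_integral_heis_dil) auto
  also have "(\<integral>\<^sup>+(v::'n heis). (if heis_norm v < 1 then 1 else 0) \<partial>lborel) =
      (\<integral>\<^sup>+(v::'n heis). indicator {v. heis_norm v < 1} v \<partial>lborel)"
    by (intro nn_integral_cong) (simp add: indicator_def)
  also have "\<dots> = ennreal (heis_vol TYPE('n))"
    using borel_open[OF open_heis_unit_ball] by (simp add: heis_vol)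
  also have "(1 / r) powr - hom_dim TYPE('n) = r powr hom_dim TYPE('n)"
    using r by (simp add: powr_minus_divide powr_divide)
  finally show ?thesis
    using heis_vol(1)[where 'n='n] by (simp add: ennreal_mult[symmetric] mult.commute)
qed

text \<open>Both bounds come from writing \<open>d powr - \<gamma>\<close> as the integral of \<open>\<gamma> * r powr (- \<gamma> - 1)\<close>
  over \<open>r > d\<close> and exchanging the integrations.\<close>

lemma nn_integral_heis_far:
  fixes F :: "'n::finite heis \<Rightarrow> ennreal"
  assumes [measurable]: "F \<in> borel_measurable borel"
    and "\<gamma> > 0" "\<gamma> > \<beta>" "A \<ge> 0" "R > 0"
    and F: "\<And>r. r > R \<Longrightarrow> (\<integral>\<^sup>+v. (if heis_dist u v < r then F v else 0) \<partial>lborel) \<le> ennreal (A * r powr \<beta>)"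
  shows "(\<integral>\<^sup>+v. (if R \<le> heis_dist u v then F v * ennreal (heis_dist u v powr - \<gamma>) else 0) \<partial>lborel)
    \<le> ennreal (A * \<gamma> / (\<gamma> - \<beta>) * R powr (\<beta> - \<gamma>))"
proof -
  define g where "g r = ennreal (\<gamma> * r powr (- \<gamma> - 1))" for r
  have [measurable]: "g \<in> borel_measurable borel" unfolding g_def by measurable
  have "(\<integral>\<^sup>+v. (if R \<le> heis_dist u v then F v * ennreal (heis_dist u v powr - \<gamma>) else 0) \<partial>lborel)
      \<le> (\<integral>\<^sup>+v. \<integral>\<^sup>+r. (if R < r then g r else 0) * (if heis_dist u v < r then F v else 0) \<partial>lborel \<partial>lborel)"
  proof (rule nn_integral_mono)
    fix v
    show "(if R \<le> heis_dist u v then F v * ennreal (heis_dist u v powr - \<gamma>) else 0) \<le>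
      (\<integral>\<^sup>+r. (if R < r then g r else 0) * (if heis_dist u v < r then F v else 0) \<partial>lborel)"
    proof (cases "R \<le> heis_dist u v")
      case True
      have "F v * ennreal (heis_dist u v powr - \<gamma>) = F v * (\<integral>\<^sup>+r. (if heis_dist u v < r then g r else 0) \<partial>lborel)"
        unfolding g_def using True assms by (subst nn_integral_powr_to_inf) auto
      also have "\<dots> = (\<integral>\<^sup>+r. F v * (if heis_dist u v < r then g r else 0) \<partial>lborel)"
        by (rule nn_integral_cmult[symmetric]) measurable
      also have "\<dots> = (\<integral>\<^sup>+r. (if R < r then g r else 0) * (if heis_dist u v < r then F v else 0) \<partial>lborel)"
        using True by (intro nn_integral_cong) (auto simp: mult.commute)
      finally show ?thesis using True by simp
    qed simp
  qed
  also have "\<dots> = (\<integral>\<^sup>+r. \<integral>\<^sup>+v. (if R < r then g r else 0) * (if heis_dist u v < r then F v else 0) \<partial>lborel \<partial>lborel)"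
    by (rule lborel_pair.Fubini') measurable
  also have "\<dots> = (\<integral>\<^sup>+r. (if R < r then g r else 0) * (\<integral>\<^sup>+v. (if heis_dist u v < r then F v else 0) \<partial>lborel) \<partial>lborel)"
    by (intro nn_integral_cong nn_integral_cmult) measurable
  also have "\<dots> \<le> (\<integral>\<^sup>+r. ennreal (A * \<gamma> / (\<gamma> - \<beta>)) * (if R < r then ennreal ((\<gamma> - \<beta>) * r powr (- (\<gamma> - \<beta>) - 1)) else 0) \<partial>lborel)"
  proof (rule nn_integral_mono)
    fix r
    show "(if R < r then g r else 0) * (\<integral>\<^sup>+v. (if heis_dist u v < r then F v else 0) \<partial>lborel)
      \<le> ennreal (A * \<gamma> / (\<gamma> - \<beta>)) * (if R < r then ennreal ((\<gamma> - \<beta>) * r powr (- (\<gamma> - \<beta>) - 1)) else 0)"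
    proof (cases "R < r")
      case True
      have "g r * (\<integral>\<^sup>+v. (if heis_dist u v < r then F v else 0) \<partial>lborel) \<le> g r * ennreal (A * r powr \<beta>)"
        by (intro mult_left_mono F True) simp
      also have "\<dots> = ennreal (\<gamma> * A * (r powr (- \<gamma> - 1) * r powr \<beta>))"
        unfolding g_def using assms by (simp add: ennreal_mult[symmetric] mult_ac)
      also have "r powr (- \<gamma> - 1) * r powr \<beta> = r powr (- (\<gamma> - \<beta>) - 1)"
        by (simp add: powr_add[symmetric] algebra_simps)
      also have "\<gamma> * A * r powr (- (\<gamma> - \<beta>) - 1) = A * \<gamma> / (\<gamma> - \<beta>) * ((\<gamma> - \<beta>) * r powr (- (\<gamma> - \<beta>) - 1))"
        using assms by simp
      also have "ennreal \<dots> = ennreal (A * \<gamma> / (\<gamma> - \<beta>)) * ennreal ((\<gamma> - \<beta>) * r powr (- (\<gamma> - \<beta>) - 1))"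
        using assms by (intro ennreal_mult) auto
      finally show ?thesis using True by simp
    qed simp
  qed
  also have "\<dots> = ennreal (A * \<gamma> / (\<gamma> - \<beta>)) * ennreal (R powr - (\<gamma> - \<beta>))"
    using assms by (subst nn_integral_cmult, measurable) (subst nn_integral_powr_to_inf, auto)
  finally show ?thesis using assms by (simp add: ennreal_mult[symmetric])
qed

lemma nn_integral_heis_near:
  fixes u :: "'n::finite heis"
  assumes "\<gamma> > 0" "\<gamma> < hom_dim TYPE('n)" "R > 0"
  shows "(\<integral>\<^sup>+(v::'n heis). (if heis_dist u v < R then ennreal (heis_dist u v powr - \<gamma>) else 0) \<partial>lborel)
    \<le> ennreal (heis_vol TYPE('n) * hom_dim TYPE('n) / (hom_dim TYPE('n) - \<gamma>) * R powr (hom_dim TYPE('n) - \<gamma>))"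
proof -
  define Q where "Q = hom_dim TYPE('n)"
  define V where "V = heis_vol TYPE('n)"
  have Q: "Q > 0" "\<gamma> < Q" and V: "V > 0" using hom_dim_pos heis_vol assms by (auto simp: Q_def V_def)
  define g where "g r = ennreal (\<gamma> * r powr (- \<gamma> - 1))" for r
  have [measurable]: "g \<in> borel_measurable borel" unfolding g_def by measurable
  have "(\<integral>\<^sup>+(v::'n heis). (if heis_dist u v < R then ennreal (heis_dist u v powr - \<gamma>) else 0) \<partial>lborel)
      \<le> (\<integral>\<^sup>+(v::'n heis). \<integral>\<^sup>+r. (if 0 < r then g r else 0) * (if heis_dist u v < min r R then 1 else 0) \<partial>lborel \<partial>lborel)"
  proof (rule nn_integral_mono)
    fix v :: "'n heis"
    show "(if heis_dist u v < R then ennreal (heis_dist u v powr - \<gamma>) else 0) \<le>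
      (\<integral>\<^sup>+r. (if 0 < r then g r else 0) * (if heis_dist u v < min r R then 1 else 0) \<partial>lborel)"
    \<comment> \<open>At \<open>v = u\<close> the left side is the junk value
      \<open>0 powr - \<gamma> = 0\<close>, and the inequality is trivial.\<close>
    proof (cases "heis_dist u v < R \<and> u \<noteq> v")
      case True
      then have "0 < heis_dist u v" using heis_dist_nonneg[of u v] heis_dist_eq_0[of u v] by linarith
      then have "ennreal (heis_dist u v powr - \<gamma>) = (\<integral>\<^sup>+r. (if heis_dist u v < r then g r else 0) \<partial>lborel)"
        unfolding g_def using True assms by (subst nn_integral_powr_to_inf) auto
      also have "\<dots> = (\<integral>\<^sup>+r. (if 0 < r then g r else 0) * (if heis_dist u v < min r R then 1 else 0) \<partial>lborel)"
        using True \<open>0 < heis_dist u v\<close> by (intro nn_integral_cong) auto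
      finally show ?thesis using True by simp
    qed auto
  qed
  also have "\<dots> = (\<integral>\<^sup>+r. \<integral>\<^sup>+(v::'n heis). (if 0 < r then g r else 0) * (if heis_dist u v < min r R then 1 else 0) \<partial>lborel \<partial>lborel)"
    by (rule lborel_pair.Fubini') measurable
  also have "\<dots> = (\<integral>\<^sup>+r. (if 0 < r then g r else 0) * (\<integral>\<^sup>+(v::'n heis). (if heis_dist u v < min r R then 1 else 0) \<partial>lborel) \<partial>lborel)"
    by (intro nn_integral_cong nn_integral_cmult) measurable
  also have "\<dots> = (\<integral>\<^sup>+r. (if 0 < r then g r * ennreal (V * min r R powr Q) else 0) \<partial>lborel)"
    using assms by (intro nn_integral_cong) (simp add: nn_integral_heis_ball V_def Q_def del: min_less_iff_conj)
  \<comment> \<open>Below radius \<open>R\<close> the balls grow like \<open>r powr Q\<close>;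
    beyond it the volume stays at \<open>V * R powr Q\<close>. The value \<open>r = R\<close> is a
    null set.\<close>
  also have "\<dots> = (\<integral>\<^sup>+r. (ennreal (V * \<gamma> / (Q - \<gamma>)) * (if 0 < r \<and> r < R then ennreal ((Q - \<gamma>) * r powr (Q - \<gamma> - 1)) else 0)
      + ennreal (V * R powr Q) * (if R < r then ennreal (\<gamma> * r powr (- \<gamma> - 1)) else 0)) \<partial>lborel)"
  proof (rule nn_integral_cong_AE, use AE_lborel_singleton[of R] in eventually_elim)
    case (elim r)
    show ?case
    proof (cases "0 < r \<and> r < R")
      case True
      have "r powr (- \<gamma> - 1) * r powr Q = r powr (Q - \<gamma> - 1)"
        by (simp add: powr_add[symmetric] algebra_simps)
      then have "\<gamma> * r powr (- \<gamma> - 1) * (V * r powr Q) = V * \<gamma> / (Q - \<gamma>) * ((Q - \<gamma>) * r powr (Q - \<gamma> - 1))"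
        using Q by (simp add: field_simps)
      then show ?thesis unfolding g_def using True assms V Q
        by (simp add: ennreal_mult[symmetric])
    next
      case False
      then show ?thesis using elim assms by (cases "R < r") (auto simp: g_def mult.commute)
    qed
  qed
  also have "\<dots> = ennreal (V * \<gamma> / (Q - \<gamma>)) * ennreal (R powr (Q - \<gamma>)) + ennreal (V * R powr Q) * ennreal (R powr - \<gamma>)"
  proof -
    have "(\<integral>\<^sup>+r. ennreal (V * \<gamma> / (Q - \<gamma>)) * (if 0 < r \<and> r < R then ennreal ((Q - \<gamma>) * r powr (Q - \<gamma> - 1)) else 0) \<partial>lborel)
        = ennreal (V * \<gamma> / (Q - \<gamma>)) * ennreal (R powr (Q - \<gamma>))"
      using assms Q by (subst nn_integral_cmult, measurable) (subst nn_integral_powr_from_0, auto)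
    moreover have "(\<integral>\<^sup>+r. ennreal (V * R powr Q) * (if R < r then ennreal (\<gamma> * r powr (- \<gamma> - 1)) else 0) \<partial>lborel)
        = ennreal (V * R powr Q) * ennreal (R powr - \<gamma>)"
      using assms by (subst nn_integral_cmult, measurable) (subst nn_integral_powr_to_inf, auto)
    ultimately show ?thesis by (subst nn_integral_add) auto
  qed
  also have "\<dots> = ennreal (V * \<gamma> / (Q - \<gamma>) * R powr (Q - \<gamma>) + V * R powr (Q - \<gamma>))"
    using assms Q V by (simp add: ennreal_mult[symmetric] powr_diff powr_minus_divide)
  also have "V * \<gamma> / (Q - \<gamma>) * R powr (Q - \<gamma>) + V * R powr (Q - \<gamma>) = V * Q / (Q - \<gamma>) * R powr (Q - \<gamma>)"
    using Q by (simp add: field_simps)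
  finally show ?thesis by (simp add: Q_def V_def)
qed

section \<open>A Hedberg type inequality\<close>

text \<open>At \<open>v = u\<close> the kernel takes the junk value \<open>0 powr - lam = 0\<close>, on a null set.\<close>

definition heis_pot :: "real \<Rightarrow> ('n::finite heis \<Rightarrow> complex) \<Rightarrow> 'n heis \<Rightarrow> ennreal" where
  "heis_pot lam f u = (\<integral>\<^sup>+v. ennreal (norm (f v) * heis_dist u v powr - lam) \<partial>lborel)"

lemma borel_measurable_heis_pot [measurable]:
  assumes [measurable]: "f \<in> borel_measurable borel"
  shows "heis_pot lam f \<in> borel_measurable borel"
  unfolding heis_pot_def by measurable

text \<open>A bound \<open>A\<close> for a Morrey norm of L^1 type. For
  \<open>\<beta> = Q * (1 - 1 / p)\<close> it follows from an L^p bound (see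
  \<open>heis_morrey_of_mass\<close>) and has the same behaviour under translations and
  dilations.\<close>

definition heis_morrey :: "real \<Rightarrow> real \<Rightarrow> ('n::finite heis \<Rightarrow> complex) \<Rightarrow> bool" where
  "heis_morrey \<beta> A f \<longleftrightarrow> (\<forall>u r. r > 0 \<longrightarrow>
     (\<integral>\<^sup>+v. (if heis_dist u v < r then ennreal (norm (f v)) else 0) \<partial>lborel) \<le> ennreal (A * r powr \<beta>))"

lemma heis_morreyD:
  "heis_morrey \<beta> A f \<Longrightarrow> r > 0 \<Longrightarrow>
    (\<integral>\<^sup>+v. (if heis_dist u v < r then ennreal (norm (f v)) else 0) \<partial>lborel) \<le> ennreal (A * r powr \<beta>)"
  unfolding heis_morrey_def by blast

text \<open>The exponents are locale parameters because the pair
  \<open>(q / (q - 1), p / (p - 1))\<close> satisfies the same relation: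
  \<open>dual_exponents\<close> instantiates the locale there, which makes every estimate available
  for the dual functions too.\<close>

locale hls_exponents =
  fixes lam p q Q :: real and n :: "'n::finite itself"
  assumes Q_eq: "Q = hom_dim TYPE('n)"
    and lam_pos: "0 < lam" and lam_less: "lam < Q" and p_gt1: "1 < p" and q_gt1: "1 < q"
    and pq: "1 / q = 1 / p - (Q - lam) / Q"
begin

lemma Q_pos: "Q > 0"
  using lam_pos lam_less by simp

lemma p_less_q: "p < q"
proof -
  have "1 / q < 1 / p" using pq lam_less Q_pos by simp
  then show ?thesis using p_gt1 q_gt1 by (simp add: divide_simps split: if_splits)
qed

lemma Q_lam: "(Q - lam) * q / Q = q / p - 1"
proof -
  have "q * (1 / q) = q * (1 / p - (Q - lam) / Q)" unfolding pq ..
  then show ?thesis using q_gt1 by (simp add: algebra_simps)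
qed

text \<open>The scaling identity behind the argument: the left side is the power of the radius in
  the estimate of the far part of the kernel, and also the power of \<open>d\<close> that
  \<open>frac_int\<close> picks up under dilations.\<close>

lemma lam_eq: "Q * (1 - 1 / p) - lam = - Q / q"
proof -
  have "(Q - lam) = Q * (1 / p - 1 / q)" using pq Q_pos by (simp add: field_simps)
  then show ?thesis by (simp add: algebra_simps)
qed

text \<open>The kernel is split at the radius \<open>R\<close> where the far part is at most \<open>s / 2\<close>; the near part
  of the potential of \<open>min (norm f) t\<close> is at most \<open>s / 4\<close>, so only the values of \<open>f\<close> above \<open>t\<close>
  contribute to the level set.\<close>

definition "near_const = heis_vol TYPE('n) * Q / (Q - lam)"

definition "far_const = 2 * (lam / (lam - Q * (1 - 1 / p)))"

definition "level A s = 1 / (4 * near_const) * (far_const * A) powr - (q / p - 1) * s powr (q / p)"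

lemma near_const_pos: "near_const > 0"
  using heis_vol(1)[where 'n='n] Q_pos lam_less by (simp add: near_const_def)

lemma lam_gt: "lam > Q * (1 - 1 / p)"
  using lam_eq Q_pos q_gt1 by (smt (verit) divide_pos_pos minus_divide_left)

lemma far_const_pos: "far_const > 0"
  using lam_gt lam_pos by (simp add: far_const_def)

text \<open>The far part absorbs \<open>s / 2\<close> and the values of \<open>f\<close> up to
  \<open>t\<close> absorb \<open>s / 4\<close>, so on the level set the near potential
  \<open>Y\<close> of the larger values exceeds \<open>s / 4\<close>. Markov's inequality and
  Tonelli then apply; the near kernel has integral at most \<open>V * R powr (Q - lam)\<close> in
  either variable, and this is the quantity that defines \<open>t\<close>, whence the constant
  \<open>1 / t\<close>.\<close>

lemma emeasure_heis_pot_gt: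
  fixes f :: "'n heis \<Rightarrow> complex"
  assumes A: "A > 0" and s: "s > 0" and [measurable]: "f \<in> borel_measurable borel"
    and morrey: "heis_morrey (Q * (1 - 1 / p)) A f"
  shows "emeasure lborel {u. heis_pot lam f u > ennreal s} \<le>
    ennreal (1 / level A s) * (\<integral>\<^sup>+v. (if norm (f v) > level A s then ennreal (norm (f v)) else 0) \<partial>lborel)"
proof -
  define V where "V = near_const"
  define C where "C = far_const"
  note VC_def = V_def C_def
  have V: "V > 0" and C: "C > 0" using near_const_pos far_const_pos by (simp_all add: VC_def)
  \<comment> \<open>Solves \<open>C / 2 * A * R powr (- Q / q) = s / 2\<close>, where the left side
    is the bound of \<open>nn_integral_heis_far\<close> for the far part.\<close>
  define R where "R = (C * A / s) powr (q / Q)"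
  \<comment> \<open>\<open>V * R powr (Q - lam)\<close> bounds the integral of the near kernel, and
    \<open>t\<close> times this is \<open>s / 4\<close>.\<close>
  define t where "t = s / (4 * V * R powr (Q - lam))"
  have R: "R > 0" using C A s by (simp add: R_def)
  have t: "t > 0" using s V R by (simp add: t_def)
  have t_eq: "level A s = t"
  proof -
    define e where "e = q / p - 1"
    have "R powr (Q - lam) = (C * A / s) powr (q / p - 1)"
      using Q_lam by (simp add: R_def powr_powr mult.commute)
    also have "\<dots> = (C * A) powr (q / p - 1) * s powr (- (q / p - 1))"
      using C A s by (simp add: powr_divide powr_minus_divide[of s "q / p - 1"] del: minus_diff_eq)
    finally have "t = 1 / (4 * V) * (s / ((C * A) powr (q / p - 1) * s powr (- (q / p - 1))))"
      by (simp add: t_def)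
    also have "s / ((C * A) powr (q / p - 1) * s powr (- (q / p - 1))) = (C * A) powr - (q / p - 1) * (s * s powr (q / p - 1))"
      unfolding e_def[symmetric] using C A s by (simp add: powr_minus field_simps)
    also have "s * s powr (q / p - 1) = s powr (q / p)"
      using s by (simp add: powr_diff)
    finally show ?thesis by (simp add: level_def VC_def)
  qed
  define k where "k u v = heis_dist u v powr - lam" for u v :: "'n heis"
  let ?N = "\<lambda>u v. if heis_dist u v < R then ennreal (k u v) else 0"
  let ?F = "\<lambda>u v. if R \<le> heis_dist u v then ennreal (norm (f v)) * ennreal (k u v) else 0"
  define g where "g v = (if norm (f v) > t then ennreal (norm (f v)) else 0)" for v
  define Y where "Y u = (\<integral>\<^sup>+v. g v * ?N u v \<partial>lborel)" for u
  have [measurable]: "g \<in> borel_measurable borel"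
    unfolding g_def by measurable
  have [measurable]: "(\<lambda>v. k u v) \<in> borel_measurable borel" for u unfolding k_def by measurable
  have [measurable]: "Y \<in> borel_measurable borel" unfolding Y_def k_def by measurable
  have near: "(\<integral>\<^sup>+v. ?N u v \<partial>lborel) \<le> ennreal (V * R powr (Q - lam))" for u
    using nn_integral_heis_near[of lam R u] lam_pos lam_less R unfolding k_def V_def near_const_def unfolding Q_eq by simp
  have far: "(\<integral>\<^sup>+v. ?F u v \<partial>lborel) \<le> ennreal (s / 2)" for u
  proof -
    have "(\<integral>\<^sup>+v. ?F u v \<partial>lborel)
      \<le> ennreal (A * lam / (lam - Q * (1 - 1 / p)) * R powr (Q * (1 - 1 / p) - lam))"
      unfolding k_def
      by (rule nn_integral_heis_far) (use heis_morreyD[OF morrey] R lam_pos lam_gt A in auto)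
    also have "R powr (Q * (1 - 1 / p) - lam) = s / (C * A)"
      unfolding lam_eq R_def using Q_pos q_gt1 C A s
      by (simp add: powr_powr powr_minus_divide)
    also have "A * lam / (lam - Q * (1 - 1 / p)) * (s / (C * A)) = s / 2"
    proof -
      define D where "D = lam - Q * (1 - 1 / p)"
      have "D > 0" using lam_gt by (simp add: D_def)
      then show ?thesis using A lam_pos unfolding C_def far_const_def D_def[symmetric] by (simp add: field_simps)
    qed
    finally show ?thesis .
  qed
  have pot_le: "heis_pot lam f u \<le> ennreal (3 * s / 4) + Y u" for u
  proof -
    have "heis_pot lam f u \<le> (\<integral>\<^sup>+v. ?F u v
        + (ennreal t * ?N u v
        + g v * ?N u v) \<partial>lborel)"
      unfolding heis_pot_def
    proof (rule nn_integral_mono)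
      fix v
      have k0: "k u v \<ge> 0" by (simp add: k_def)
      show "ennreal (norm (f v) * heis_dist u v powr - lam) \<le> ?F u v
        + (ennreal t * ?N u v
        + g v * ?N u v)"
        unfolding k_def[symmetric] g_def using k0 t
        by (auto simp: ennreal_mult intro!: mult_right_mono add_increasing2)
    qed
    also have "\<dots> = (\<integral>\<^sup>+v. ?F u v \<partial>lborel)
        + (ennreal t * (\<integral>\<^sup>+v. ?N u v \<partial>lborel) + Y u)"
      unfolding Y_def by (simp add: nn_integral_add nn_integral_cmult)
    also have "\<dots> \<le> ennreal (s / 2) + (ennreal t * ennreal (V * R powr (Q - lam)) + Y u)"
      by (intro add_mono far order_refl mult_left_mono near) simp
    also have "ennreal t * ennreal (V * R powr (Q - lam)) = ennreal (s / 4)"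
      using t V R by (simp add: ennreal_mult[symmetric] t_def)
    also have "ennreal (s / 2) + (ennreal (s / 4) + Y u) = ennreal (3 * s / 4) + Y u"
      using s by (simp add: add.assoc[symmetric] ennreal_plus[symmetric] del: ennreal_plus)
    finally show ?thesis .
  qed
  have "emeasure lborel {u. heis_pot lam f u > ennreal s} \<le> emeasure lborel {u \<in> UNIV. 1 \<le> ennreal (4 / s) * Y u}"
  proof (rule emeasure_mono)
    show "{u. heis_pot lam f u > ennreal s} \<subseteq> {u \<in> UNIV. 1 \<le> ennreal (4 / s) * Y u}"
    proof safe
      fix u assume "heis_pot lam f u > ennreal s"
      then have *: "ennreal s < ennreal (3 * s / 4) + Y u" using pot_le[of u] by simp
      show "1 \<le> ennreal (4 / s) * Y u"
      proof (cases "Y u")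
        case (real y)
        then have "s < 3 * s / 4 + y" using * s
          by (simp add: ennreal_plus[symmetric] ennreal_less_iff del: ennreal_plus)
        then show ?thesis using real s
          by (simp add: ennreal_mult[symmetric] field_simps)
      next
        case top
        then show ?thesis using s by (simp add: ennreal_mult_top)
      qed
    qed simp
  qed measurable
  also have "\<dots> \<le> ennreal (4 / s) * (\<integral>\<^sup>+u. Y u * indicator UNIV u \<partial>lborel)"
    by (rule nn_integral_Markov_inequality) auto
  also have "(\<integral>\<^sup>+u. Y u * indicator UNIV u \<partial>lborel) =
    (\<integral>\<^sup>+v. \<integral>\<^sup>+u. g v * ?N u v \<partial>lborel \<partial>lborel)"
    unfolding Y_def by (simp, rule lborel_pair.Fubini') (unfold k_def, measurable)
  also have "\<dots> = (\<integral>\<^sup>+v. g v * (\<integral>\<^sup>+u. ?N u v \<partial>lborel) \<partial>lborel)"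
    by (intro nn_integral_cong nn_integral_cmult) (unfold k_def, measurable)
  also have "\<dots> \<le> (\<integral>\<^sup>+v. g v * ennreal (V * R powr (Q - lam)) \<partial>lborel)"
  proof (intro nn_integral_mono mult_left_mono)
    fix v
    show "(\<integral>\<^sup>+u. ?N u v \<partial>lborel) \<le> ennreal (V * R powr (Q - lam))"
      using near[of v] by (simp only: k_def heis_dist_commute[of v])
  qed simp
  also have "\<dots> = (\<integral>\<^sup>+v. g v \<partial>lborel) * ennreal (V * R powr (Q - lam))"
    by (rule nn_integral_multc) measurable
  finally have "emeasure lborel {u. heis_pot lam f u > ennreal s} \<le>
      ennreal (4 / s) * ((\<integral>\<^sup>+v. g v \<partial>lborel) * ennreal (V * R powr (Q - lam)))"
    by (simp add: mult_left_mono)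
  also have "\<dots> = (ennreal (4 / s) * ennreal (V * R powr (Q - lam))) * (\<integral>\<^sup>+v. g v \<partial>lborel)"
    by (simp add: mult_ac)
  also have "ennreal (4 / s) * ennreal (V * R powr (Q - lam)) = ennreal (1 / t)"
    using s V R by (simp add: ennreal_mult[symmetric] t_def)
  finally show ?thesis unfolding t_eq g_def .
qed

text \<open>The factor \<open>p / (p - 1)\<close> comes from the integration over the level
  \<open>s\<close>; the other two are what \<open>level\<close> contributes when its coefficient is
  raised to the power \<open>- p\<close>, which also produces \<open>A powr (q - p)\<close>.\<close>

definition "hedberg_const = p / (p - 1) * (1 / (4 * near_const)) powr - p * far_const powr (q - p)"

lemma hedberg_const_pos: "hedberg_const > 0"
  using p_gt1 near_const_pos far_const_pos by (simp add: hedberg_const_def)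

text \<open>The level set estimate is integrated over \<open>s\<close> by the layer cake formula,
  and the integrals are exchanged. An arbitrary minorant \<open>H\<close> in place of the potential
  lets the result serve \<open>norm (frac_int lam f u)\<close>, \<open>enn2real\<close> of the
  potential, and large multiples of the indicator of the set where the potential is
  infinite.\<close>

lemma nn_integral_heis_pot_le:
  fixes f :: "'n heis \<Rightarrow> complex" and H :: "'n heis \<Rightarrow> real"
  assumes A: "A > 0" and [measurable]: "f \<in> borel_measurable borel" "H \<in> borel_measurable borel"
    and morrey: "heis_morrey (Q * (1 - 1 / p)) A f"
    and H0: "\<And>u. 0 \<le> H u" and H: "\<And>u. ennreal (H u) \<le> heis_pot lam f u"
  shows "(\<integral>\<^sup>+u. ennreal (H u powr q) \<partial>lborel) \<le>
    ennreal (hedberg_const * A powr (q - p)) * (\<integral>\<^sup>+v. ennreal (norm (f v) powr p) \<partial>lborel)"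
proof -
  define m where "m = 1 / (4 * near_const)"
  define C where "C = far_const"
  have mC: "m > 0" "C > 0" using near_const_pos far_const_pos by (simp_all add: m_def C_def)
  define \<kappa> where "\<kappa> = m * (C * A) powr - (q / p - 1)"
  have level: "level A s = \<kappa> * s powr (q / p)" for s
    by (simp add: level_def \<kappa>_def m_def C_def)
  have \<kappa>: "\<kappa> > 0" using mC A by (simp add: \<kappa>_def)
  let ?G = "\<lambda>s v. if 0 < s \<and> norm (f v) > \<kappa> * s powr (q / p)
      then ennreal (norm (f v)) * ennreal (q / \<kappa> * s powr (q - q / p - 1)) else 0"
  let ?U = "\<lambda>s. \<integral>\<^sup>+v. (if norm (f v) > \<kappa> * s powr (q / p) then ennreal (norm (f v)) else 0) \<partial>lborel"
  let ?L = "\<lambda>s u. if 0 < s \<and> s < H u then ennreal (q * s powr (q - 1)) else 0"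
  have pq_pos: "q - q / p > 0" "q / p > 0" using p_gt1 q_gt1 by (simp_all add: field_simps)
  have "(\<integral>\<^sup>+u. ennreal (H u powr q) \<partial>lborel) =
    (\<integral>\<^sup>+u. \<integral>\<^sup>+s. ?L s u \<partial>lborel \<partial>lborel)"
    using q_gt1 H0 by (simp add: nn_integral_powr_from_0)
  also have "\<dots> = (\<integral>\<^sup>+s. \<integral>\<^sup>+u. ?L s u \<partial>lborel \<partial>lborel)"
    by (rule lborel_pair.Fubini') measurable
  also have "\<dots> \<le> (\<integral>\<^sup>+s. \<integral>\<^sup>+v. ?G s v \<partial>lborel \<partial>lborel)"
  proof (rule nn_integral_mono)
    fix s :: real
    show "(\<integral>\<^sup>+u. ?L s u \<partial>lborel) \<le>
      (\<integral>\<^sup>+v. ?G s v \<partial>lborel)"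
    proof (cases "s > 0")
      case True
      have "(\<integral>\<^sup>+u. ?L s u \<partial>lborel)
        = (\<integral>\<^sup>+u. ennreal (q * s powr (q - 1)) * indicator {u. s < H u} u \<partial>lborel)"
        using True by (intro nn_integral_cong) (simp add: indicator_def)
      also have "\<dots> = ennreal (q * s powr (q - 1)) * emeasure lborel {u. s < H u}"
        by (rule nn_integral_cmult_indicator) measurable
      also have "\<dots> \<le> ennreal (q * s powr (q - 1)) * (ennreal (1 / (\<kappa> * s powr (q / p))) *
          ?U s)"
      proof (rule mult_left_mono)
        have "emeasure lborel {u. s < H u} \<le> emeasure lborel {u. heis_pot lam f u > ennreal s}"
        proof (rule emeasure_mono)
          show "{u. s < H u} \<subseteq> {u. heis_pot lam f u > ennreal s}"
          proof
            fix u assume "u \<in> {u. s < H u}"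
            then have "ennreal s < ennreal (H u)" using True by (simp add: ennreal_less_iff)
            then show "u \<in> {u. heis_pot lam f u > ennreal s}" using H[of u] by (auto intro: less_le_trans)
          qed
        qed measurable
        also have "\<dots> \<le> ennreal (1 / (\<kappa> * s powr (q / p))) *
          ?U s"
          unfolding level[symmetric] by (rule emeasure_heis_pot_gt[OF A True _ morrey]) measurable
        finally show "emeasure lborel {u. s < H u} \<le> ennreal (1 / (\<kappa> * s powr (q / p))) *
          ?U s" .
      qed simp
      also have "\<dots> = ennreal (q / \<kappa> * s powr (q - q / p - 1)) *
          ?U s"
      proof -
        have "q * s powr (q - 1) * (1 / (\<kappa> * s powr (q / p))) = q / \<kappa> * (s powr (q - 1) * s powr (- (q / p)))"
          by (simp add: powr_minus field_simps)
        also have "s powr (q - 1) * s powr (- (q / p)) = s powr (q - q / p - 1)"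
          by (simp add: powr_add[symmetric] algebra_simps)
        finally show ?thesis using \<kappa> True q_gt1 by (simp add: mult.assoc[symmetric] ennreal_mult[symmetric])
      qed
      also have "\<dots> = (\<integral>\<^sup>+v. ennreal (q / \<kappa> * s powr (q - q / p - 1)) *
          (if norm (f v) > \<kappa> * s powr (q / p) then ennreal (norm (f v)) else 0) \<partial>lborel)"
        by (rule nn_integral_cmult[symmetric]) measurable
      also have "\<dots> = (\<integral>\<^sup>+v. ?G s v \<partial>lborel)"
        using True by (intro nn_integral_cong) (simp add: mult.commute)
      finally show ?thesis .
    qed simp
  qed
  also have "\<dots> = (\<integral>\<^sup>+v. \<integral>\<^sup>+s. ?G s v \<partial>lborel \<partial>lborel)"
    by (rule lborel_pair.Fubini') measurable
  also have "\<dots> = (\<integral>\<^sup>+v. ennreal (p / (p - 1) * \<kappa> powr - p) * ennreal (norm (f v) powr p) \<partial>lborel)"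
  proof (rule nn_integral_cong)
    fix v
    define x where "x = norm (f v)"
    have x0: "x \<ge> 0" by (simp add: x_def)
    \<comment> \<open>The level at which \<open>\<kappa> * c powr (q / p) = x\<close>, so that the
      condition on \<open>s\<close> becomes an interval.\<close>
    define c where "c = (x / \<kappa>) powr (p / q)"
    have iff: "\<kappa> * s powr (q / p) < x \<longleftrightarrow> s < c" if "s > 0" for s
    proof (cases "x > 0")
      case True
      have "s < c \<longleftrightarrow> s powr (q / p) < c powr (q / p)"
        using that pq_pos powr_less_mono2[of "q / p" s c] powr_mono2[of "q / p" c s]
        by (force simp: c_def)
      also have "c powr (q / p) = x / \<kappa>"
        using True \<kappa> p_gt1 q_gt1 by (simp add: c_def powr_powr)
      finally show ?thesis using \<kappa> by (simp add: field_simps)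
    next
      case False
      then have "x = 0" by (simp add: x_def)
      moreover have "\<kappa> * s powr (q / p) > 0" using \<kappa> that by simp
      ultimately show ?thesis using that by (simp add: c_def)
    qed
    have "(\<integral>\<^sup>+s. ?G s v \<partial>lborel)
      = (\<integral>\<^sup>+s. ennreal (x * (q / \<kappa> / (q - q / p))) * (if 0 < s \<and> s < c then ennreal ((q - q / p) * s powr (q - q / p - 1)) else 0) \<partial>lborel)"
      unfolding x_def[symmetric] using pq_pos \<kappa> q_gt1
      by (intro nn_integral_cong) (auto simp: iff ennreal_mult[symmetric] x0)
    also have "\<dots> = ennreal (x * (q / \<kappa> / (q - q / p))) * ennreal (c powr (q - q / p))"
      using pq_pos by (subst nn_integral_cmult, measurable) (subst nn_integral_powr_from_0, auto simp: c_def)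
    also have "c powr (q - q / p) = (x / \<kappa>) powr (p - 1)"
    proof -
      have "p / q * (q - q / p) = p - 1" using p_gt1 q_gt1 by (simp add: field_simps)
      then show ?thesis by (simp add: c_def powr_powr)
    qed
    also have "ennreal (x * (q / \<kappa> / (q - q / p))) * ennreal ((x / \<kappa>) powr (p - 1)) =
        ennreal (x * (q / \<kappa> / (q - q / p)) * (x / \<kappa>) powr (p - 1))"
      using pq_pos \<kappa> q_gt1 by (intro ennreal_mult[symmetric]) (auto simp: x_def)
    also have "x * (q / \<kappa> / (q - q / p)) * (x / \<kappa>) powr (p - 1) = q / (q - q / p) * ((x / \<kappa>) * (x / \<kappa>) powr (p - 1))"
      by (simp add: mult_ac)
    also have "(x / \<kappa>) * (x / \<kappa>) powr (p - 1) = (x / \<kappa>) powr p"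
      using \<kappa> by (cases "x = 0") (auto simp: x_def powr_diff)
    also have "(x / \<kappa>) powr p = x powr p * \<kappa> powr - p"
      using \<kappa> by (simp add: x_def powr_divide powr_minus_divide)
    also have "q / (q - q / p) = p / (p - 1)"
      using p_gt1 q_gt1 by (simp add: field_simps)
    also have "ennreal (p / (p - 1) * (x powr p * \<kappa> powr - p)) = ennreal (p / (p - 1) * \<kappa> powr - p) * ennreal (x powr p)"
      using p_gt1 by (simp add: ennreal_mult[symmetric] mult_ac)
    finally show "(\<integral>\<^sup>+s. ?G s v \<partial>lborel)
      = ennreal (p / (p - 1) * \<kappa> powr - p) * ennreal (norm (f v) powr p)" by (simp add: x_def)
  qed
  also have "\<dots> = ennreal (p / (p - 1) * \<kappa> powr - p) * (\<integral>\<^sup>+v. ennreal (norm (f v) powr p) \<partial>lborel)"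
    by (rule nn_integral_cmult) measurable
  also have "p / (p - 1) * \<kappa> powr - p = p / (p - 1) * m powr - p * C powr (q - p) * A powr (q - p)"
  proof -
    have "- (q / p - 1) * - p = q - p" using p_gt1 by (simp add: field_simps)
    then have "\<kappa> powr - p = m powr - p * (C powr (q - p) * A powr (q - p))"
      using mC A unfolding \<kappa>_def by (simp add: powr_mult powr_powr)
    then show ?thesis by simp
  qed
  finally show ?thesis by (simp only: hedberg_const_def m_def C_def)
qed

end

section \<open>Lebesgue spaces through p-th powers, and finiteness of the potential\<close>

definition Lp_mass :: "real \<Rightarrow> ('a::euclidean_space \<Rightarrow> complex) \<Rightarrow> real" where
  "Lp_mass p f = (LINT u|lborel. norm (f u) powr p)"

lemma Lp_mass_nonneg [simp]: "Lp_mass p f \<ge> 0"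
  by (simp add: Lp_mass_def)

lemma Lp_space_iff:
  "f \<in> Lp_space p \<longleftrightarrow> f \<in> borel_measurable borel \<and> integrable lborel (\<lambda>u. norm (f u) powr p)"
proof (cases "f \<in> borel_measurable borel")
  case True
  then have "integrable lborel (\<lambda>u. norm (f u) powr p) \<longleftrightarrow> (\<integral>\<^sup>+ u. ennreal (norm (f u) powr p) \<partial>lborel) < \<infinity>"
    by (simp add: integrable_iff_bounded)
  also have "\<dots> \<longleftrightarrow> Lp_norm p f < \<infinity>"
    by (simp add: Lp_norm_def Let_def top.not_eq_extremum)
  finally show ?thesis using True by (simp add: Lp_space_def)
qed (simp add: Lp_space_def)

lemma Lp_space_measurable: "f \<in> Lp_space p \<Longrightarrow> f \<in> borel_measurable borel"
  and Lp_space_integrable: "f \<in> Lp_space p \<Longrightarrow> integrable lborel (\<lambda>u. norm (f u) powr p)"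
  by (simp_all add: Lp_space_iff)

lemma nn_integral_Lp_mass:
  "f \<in> Lp_space p \<Longrightarrow> (\<integral>\<^sup>+ u. ennreal (norm (f u) powr p) \<partial>lborel) = ennreal (Lp_mass p f)"
  unfolding Lp_mass_def by (rule nn_integral_eq_integral) (auto simp: Lp_space_iff)

lemma Lp_norm_eq: "f \<in> Lp_space p \<Longrightarrow> Lp_norm p f = ennreal (Lp_mass p f powr (1 / p))"
  by (simp add: Lp_norm_def nn_integral_Lp_mass)

lemma Lp_norm_eq_1_iff:
  assumes "f \<in> Lp_space p" "p > 0"
  shows "Lp_norm p f = 1 \<longleftrightarrow> Lp_mass p f = 1"
  using assms
proof (intro iffI)
  assume "Lp_norm p f = 1"
  then have "Lp_mass p f powr (1 / p) = 1" using assms by (simp add: Lp_norm_eq)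
  then have "(Lp_mass p f powr (1 / p)) powr p = 1" by simp
  then show "Lp_mass p f = 1" using assms by (simp add: powr_powr)
qed (simp add: Lp_norm_eq)

lemma Lp_spaceI_nn:
  assumes "f \<in> borel_measurable borel" "(\<integral>\<^sup>+ u. ennreal (norm (f u) powr p) \<partial>lborel) \<le> ennreal c" "c \<ge> 0"
  shows "f \<in> Lp_space p" "Lp_mass p f \<le> c"
proof -
  show "f \<in> Lp_space p"
    using assms by (auto simp: Lp_space_iff integrable_iff_bounded le_less_trans)
  then show "Lp_mass p f \<le> c"
    using assms by (simp add: nn_integral_Lp_mass)
qed

text \<open>Cruder than Minkowski's inequality, but valid for all \<open>p > 0\<close> and
  sufficient wherever only boundedness of masses matters.\<close>

lemma norm_add_powr_le:
  fixes a b :: "'b::real_normed_vector"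
  assumes "p > 0"
  shows "norm (a + b) powr p \<le> 2 powr p * (norm a powr p + norm b powr p)"
proof -
  have "norm (a + b) powr p \<le> (2 * max (norm a) (norm b)) powr p"
    using norm_triangle_ineq[of a b] assms by (intro powr_mono2) auto
  also have "\<dots> = 2 powr p * max (norm a) (norm b) powr p"
    by (simp add: powr_mult)
  also have "max (norm a) (norm b) powr p \<le> norm a powr p + norm b powr p"
    by (simp add: max_def)
  finally show ?thesis by simp
qed

lemma Lp_space_add:
  assumes "f \<in> Lp_space p" "g \<in> Lp_space p" "p > 0"
  shows "(\<lambda>u. f u + g u) \<in> Lp_space p" "Lp_mass p (\<lambda>u. f u + g u) \<le> 2 powr p * (Lp_mass p f + Lp_mass p g)"
proof -
  have [measurable]: "f \<in> borel_measurable borel" "g \<in> borel_measurable borel"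
    and i: "integrable lborel (\<lambda>u. norm (f u) powr p)" "integrable lborel (\<lambda>u. norm (g u) powr p)"
    using assms by (auto simp: Lp_space_iff)
  then have ib: "integrable lborel (\<lambda>u. 2 powr p * (norm (f u) powr p + norm (g u) powr p))"
    by auto
  have int: "integrable lborel (\<lambda>u. norm (f u + g u) powr p)"
    by (rule Bochner_Integration.integrable_bound[OF ib]) (use norm_add_powr_le[OF \<open>p > 0\<close>] in auto)
  then show "(\<lambda>u. f u + g u) \<in> Lp_space p" by (auto simp: Lp_space_iff)
  have "Lp_mass p (\<lambda>u. f u + g u) \<le> (LINT u|lborel. 2 powr p * (norm (f u) powr p + norm (g u) powr p))"
    unfolding Lp_mass_def by (rule integral_mono[OF int ib]) (rule norm_add_powr_le[OF \<open>p > 0\<close>])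
  also have "\<dots> = 2 powr p * (Lp_mass p f + Lp_mass p g)"
    using i by (simp add: Lp_mass_def)
  finally show "Lp_mass p (\<lambda>u. f u + g u) \<le> 2 powr p * (Lp_mass p f + Lp_mass p g)" .
qed

lemma Lp_space_mult:
  assumes "f \<in> Lp_space p"
  shows "(\<lambda>u. c * f u) \<in> Lp_space p" "Lp_mass p (\<lambda>u. c * f u) = norm c powr p * Lp_mass p f"
  using assms by (auto simp: Lp_space_iff Lp_mass_def norm_mult powr_mult)

lemma Lp_space_uminus:
  assumes "f \<in> Lp_space p"
  shows "(\<lambda>u. - f u) \<in> Lp_space p" "Lp_mass p (\<lambda>u. - f u) = Lp_mass p f"
  using assms by (auto simp: Lp_space_iff Lp_mass_def)

lemma Lp_space_diff:
  assumes "f \<in> Lp_space p" "g \<in> Lp_space p" "p > 0"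
  shows "(\<lambda>u. f u - g u) \<in> Lp_space p" "Lp_mass p (\<lambda>u. f u - g u) \<le> 2 powr p * (Lp_mass p f + Lp_mass p g)"
  using Lp_space_add[OF assms(1) Lp_space_uminus(1)[OF assms(2)] assms(3)] Lp_space_uminus(2)[OF assms(2)] by auto

lemma Lp_mass_cong_AE:
  assumes "f \<in> borel_measurable borel" "g \<in> borel_measurable borel" "AE u in lborel. f u = g u"
  shows "Lp_mass p f = Lp_mass p g"
  unfolding Lp_mass_def using assms by (intro integral_cong_AE) auto

lemma Lp_mass_eq_0_iff:
  assumes "f \<in> Lp_space p"
  shows "Lp_mass p f = 0 \<longleftrightarrow> (AE u in lborel. f u = 0)"
  unfolding Lp_mass_def
  using assms by (subst integral_nonneg_eq_0_iff_AE) (auto simp: Lp_space_iff)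

text \<open>Also correct at \<open>v = u\<close>, where division by zero and
  \<open>0 powr - lam\<close> both give zero.\<close>

lemma frac_int_eq: "frac_int lam f u = (LINT v|lborel. of_real (heis_dist u v powr - lam) * f v)"
  by (simp add: frac_int_def heis_dist_def powr_minus_divide)

lemma borel_measurable_frac_int [measurable]:
  assumes [measurable]: "f \<in> borel_measurable borel"
  shows "frac_int lam f \<in> borel_measurable borel"
proof -
  have "(\<lambda>u. LINT v|lborel. of_real (heis_dist u v powr - lam) * f v) \<in> borel_measurable borel"
    by measurable
  then show ?thesis by (simp add: frac_int_eq[abs_def])
qed

lemma heis_pot_eq_norm:
  "heis_pot lam f u = (\<integral>\<^sup>+v. ennreal (norm (of_real (heis_dist u v powr - lam) * f v)) \<partial>lborel)"
  by (simp add: heis_pot_def norm_mult mult.commute)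

lemma integrable_heis_pot:
  assumes "f \<in> borel_measurable borel" "heis_pot lam f u < \<infinity>"
  shows "integrable lborel (\<lambda>v. of_real (heis_dist u v powr - lam) * f v)"
  using assms unfolding heis_pot_eq_norm by (intro integrableI_bounded) auto

text \<open>There is no exceptional set: where the integrand is not integrable, the Bochner integral
  is zero.\<close>

lemma norm_frac_int_le: "ennreal (norm (frac_int lam f u)) \<le> heis_pot lam f u"
proof (cases "integrable lborel (\<lambda>v. of_real (heis_dist u v powr - lam) * f v)")
  case True
  then show ?thesis unfolding frac_int_eq heis_pot_eq_norm
    by (subst nn_integral_eq_integral) (auto intro: integral_norm_bound)
qed (simp add: frac_int_eq not_integrable_integral_eq)

lemma frac_int_mult: "frac_int lam (\<lambda>v. c * f v) u = c * frac_int lam f u"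
  by (simp add: frac_int_eq mult.left_commute)

lemma heis_pot_mult: "f \<in> borel_measurable borel \<Longrightarrow> heis_pot lam (\<lambda>v. c * f v) u = ennreal (norm c) * heis_pot lam f u"
  unfolding heis_pot_def by (subst nn_integral_cmult[symmetric]) (auto simp: norm_mult mult.assoc ennreal_mult)

context hls_exponents
begin

text \<open>A pointwise inequality plays the role of Hoelder's: values above a height
  \<open>y\<close> are at most \<open>y powr (1 - p)\<close> times their p-th power, and values up
  to \<open>y\<close> are simply integrated over the ball.\<close>

lemma heis_morrey_of_mass:
  fixes f :: "'n heis \<Rightarrow> complex"
  assumes "f \<in> Lp_space p" "Lp_mass p f \<le> 1"
  shows "heis_morrey (Q * (1 - 1 / p)) (1 + heis_vol TYPE('n)) f"
  unfolding heis_morrey_def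
proof (intro allI impI)
  fix u :: "'n heis" and r :: real
  assume r: "r > 0"
  have [measurable]: "f \<in> borel_measurable borel" using assms by (simp add: Lp_space_iff)
  \<comment> \<open>The height at which both contributions scale like
    \<open>r powr (Q * (1 - 1 / p))\<close>.\<close>
  define y where "y = r powr (- Q / p)"
  have y: "y > 0" using r by (simp add: y_def)
  have le: "x \<le> y powr (1 - p) * x powr p + y" if "x \<ge> 0" for x
  proof (cases "x \<le> y")
    case False
    then have "(x / y) powr 1 \<le> (x / y) powr p" using y p_gt1 by (intro powr_mono) auto
    then have "x \<le> y * (x powr p / y powr p)" using y that by (simp add: powr_divide field_simps)
    then show ?thesis using y by (simp add: powr_diff)
  qed (use y in \<open>simp add: add_increasing\<close>)
  have "(\<integral>\<^sup>+v. (if heis_dist u v < r then ennreal (norm (f v)) else 0) \<partial>lborel) \<le>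
    (\<integral>\<^sup>+v. ennreal (y powr (1 - p)) * ennreal (norm (f v) powr p) + ennreal y * (if heis_dist u v < r then 1 else 0) \<partial>lborel)"
  proof (rule nn_integral_mono)
    fix v
    have "ennreal (norm (f v)) \<le> ennreal (y powr (1 - p) * norm (f v) powr p + y)"
      by (intro ennreal_leI le) simp
    then show "(if heis_dist u v < r then ennreal (norm (f v)) else 0) \<le>
        ennreal (y powr (1 - p)) * ennreal (norm (f v) powr p) + ennreal y * (if heis_dist u v < r then 1 else 0)"
      using y by (simp add: ennreal_mult[symmetric])
  qed
  also have "\<dots> = ennreal (y powr (1 - p)) * ennreal (Lp_mass p f) + ennreal y * ennreal (heis_vol TYPE('n) * r powr Q)"
    using assms r by (simp add: nn_integral_add nn_integral_cmult nn_integral_Lp_mass nn_integral_heis_ball Q_eq)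
  also have "\<dots> = ennreal (y powr (1 - p) * Lp_mass p f + y * (heis_vol TYPE('n) * r powr Q))"
    using y heis_vol(1)[where 'n='n] by (simp add: ennreal_mult[symmetric])
  also have "\<dots> \<le> ennreal ((1 + heis_vol TYPE('n)) * r powr (Q * (1 - 1 / p)))"
  proof (rule ennreal_leI)
    have yp: "y powr (1 - p) = r powr (Q * (1 - 1 / p))"
    proof -
      have "- Q / p * (1 - p) = Q * (1 - 1 / p)" using p_gt1 by (simp add: field_simps)
      then show ?thesis by (simp add: y_def powr_powr)
    qed
    have "y powr (1 - p) * Lp_mass p f \<le> y powr (1 - p) * 1"
      using assms by (intro mult_left_mono) auto
    then have 1: "y powr (1 - p) * Lp_mass p f \<le> r powr (Q * (1 - 1 / p))" by (simp add: yp)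
    have "y * r powr Q = r powr (Q * (1 - 1 / p))"
      by (simp add: y_def powr_add[symmetric] algebra_simps)
    then have 2: "y * (heis_vol TYPE('n) * r powr Q) = heis_vol TYPE('n) * r powr (Q * (1 - 1 / p))"
      by (simp add: mult.left_commute)
    show "y powr (1 - p) * Lp_mass p f + y * (heis_vol TYPE('n) * r powr Q) \<le>
        (1 + heis_vol TYPE('n)) * r powr (Q * (1 - 1 / p))"
      unfolding 2 distrib_right using 1 by simp
  qed
  finally show "(\<integral>\<^sup>+v. (if heis_dist u v < r then ennreal (norm (f v)) else 0) \<partial>lborel) \<le>
    ennreal ((1 + heis_vol TYPE('n)) * r powr (Q * (1 - 1 / p)))" .
qed

text \<open>For mass at most one the potential is controlled by the Morrey bound alone, with the
  positive power \<open>q - p\<close>. A function whose potential is not small must therefore be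
  large on some ball.\<close>

lemma HLS_morrey:
  fixes f :: "'n heis \<Rightarrow> complex"
  assumes A: "A > 0" and f: "f \<in> Lp_space p" "Lp_mass p f \<le> 1" and m: "heis_morrey (Q * (1 - 1 / p)) A f"
    and H: "H \<in> borel_measurable borel" "\<And>u. 0 \<le> H u" "\<And>u. ennreal (H u) \<le> heis_pot lam f u"
  shows "(\<integral>\<^sup>+u. ennreal (H u powr q) \<partial>lborel) \<le> ennreal (hedberg_const * A powr (q - p))"
proof -
  have "(\<integral>\<^sup>+u. ennreal (H u powr q) \<partial>lborel) \<le>
      ennreal (hedberg_const * A powr (q - p)) * (\<integral>\<^sup>+v. ennreal (norm (f v) powr p) \<partial>lborel)"
    by (rule nn_integral_heis_pot_le[OF A Lp_space_measurable[OF f(1)] H(1) m H(2,3)])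
  also have "\<dots> \<le> ennreal (hedberg_const * A powr (q - p)) * ennreal 1"
    unfolding nn_integral_Lp_mass[OF f(1)] using f by (intro mult_left_mono ennreal_leI) auto
  finally show ?thesis by simp
qed

definition "hls_bound = hedberg_const * (1 + heis_vol TYPE('n)) powr (q - p)"

lemma hls_bound_pos: "hls_bound > 0"
  using hedberg_const_pos heis_vol(1)[where 'n='n] by (simp add: hls_bound_def)

lemma heis_pot_unit:
  fixes f :: "'n heis \<Rightarrow> complex"
  assumes f: "f \<in> Lp_space p" "Lp_mass p f \<le> 1"
    and H: "H \<in> borel_measurable borel" "\<And>u. 0 \<le> H u" "\<And>u. ennreal (H u) \<le> heis_pot lam f u"
  shows "(\<integral>\<^sup>+u. ennreal (H u powr q) \<partial>lborel) \<le> ennreal hls_bound"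
  unfolding hls_bound_def
  by (rule HLS_morrey[OF _ f heis_morrey_of_mass[OF f] H]) (use heis_vol(1)[where 'n='n] in simp)

text \<open>Reduction to mass at most one; the summand 1 in the scaling factor covers functions of
  mass zero.\<close>

lemma heis_pot_scaled:
  fixes f :: "'n heis \<Rightarrow> complex"
  assumes f: "f \<in> Lp_space p"
  obtains c g where "c > 0" "g \<in> Lp_space p" "Lp_mass p g \<le> 1" "f = (\<lambda>u. of_real c * g u)"
proof (rule that)
  define c where "c = (1 + Lp_mass p f) powr (1 / p)"
  show c: "c > 0" unfolding c_def using Lp_mass_nonneg[of p f] by (smt (verit) powr_gt_zero)
  have cp: "c powr p = 1 + Lp_mass p f" using p_gt1 by (simp add: c_def powr_powr)
  show "(\<lambda>u. of_real (1 / c) * f u) \<in> Lp_space p" by (rule Lp_space_mult[OF f])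
  have "Lp_mass p (\<lambda>u. of_real (1 / c) * f u) = Lp_mass p f / (1 + Lp_mass p f)"
    using c by (subst Lp_space_mult(2)[OF f]) (simp add: norm_divide powr_divide cp)
  also have "\<dots> \<le> 1" by (smt (verit) Lp_mass_nonneg divide_le_eq_1_pos)
  finally show "Lp_mass p (\<lambda>u. of_real (1 / c) * f u) \<le> 1" .
  show "f = (\<lambda>u. of_real c * (of_real (1 / c) * f u))" using c by auto
qed

text \<open>\<open>heis_pot_unit\<close> is tested with \<open>N\<close> times the indicator of the
  set \<open>E\<close> where the potential is infinite; \<open>N powr q\<close> times the measure of
  \<open>E\<close> is then bounded independently of \<open>N\<close>.\<close>

lemma heis_pot_finite_AE:
  fixes f :: "'n heis \<Rightarrow> complex"
  assumes f: "f \<in> Lp_space p"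
  shows "AE u in lborel. heis_pot lam f u < \<infinity>"
proof (rule heis_pot_scaled[OF f])
  fix c g
  assume c: "c > 0" and g: "g \<in> Lp_space p" "Lp_mass p g \<le> 1" and f_eq: "f = (\<lambda>u. of_real c * g u)"
  have [measurable]: "g \<in> borel_measurable borel" using g by (simp add: Lp_space_iff)
  define E where "E = {u. heis_pot lam g u = \<infinity>}"
  have [measurable]: "E \<in> sets borel" unfolding E_def by measurable
  have bound: "ennreal (real N powr q) * emeasure lborel E \<le> ennreal hls_bound" for N :: nat
  proof -
    have "(\<integral>\<^sup>+u. ennreal ((real N * indicator E u) powr q) \<partial>lborel) \<le> ennreal hls_bound"
      by (rule heis_pot_unit[OF g]) (auto simp: E_def indicator_def)
    also have "(\<integral>\<^sup>+u. ennreal ((real N * indicator E u) powr q) \<partial>lborel) =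
        (\<integral>\<^sup>+u. ennreal (real N powr q) * indicator E u \<partial>lborel)"
      by (intro nn_integral_cong) (auto simp: indicator_def)
    finally show ?thesis by (simp add: nn_integral_cmult_indicator)
  qed
  have "emeasure lborel E = 0"
  proof (rule ccontr)
    assume ne: "emeasure lborel E \<noteq> 0"
    have "emeasure lborel E < \<infinity>" using bound[of 1] by (simp add: le_less_trans)
    then obtain e where e: "emeasure lborel E = ennreal e" "e > 0" using ne by (cases "emeasure lborel E") auto
    obtain N :: nat where N: "real N > 1 + hls_bound / e" using reals_Archimedean2 by blast
    have "1 \<le> real N" using N e hls_bound_pos by (smt (verit) divide_pos_pos)
    then have "real N powr 1 \<le> real N powr q" using q_gt1 by (intro powr_mono) auto
    then have "real N * e \<le> real N powr q * e" using e \<open>1 \<le> real N\<close> by simp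
    also have "\<dots> \<le> hls_bound" using bound[of N] e hls_bound_pos by (simp add: ennreal_mult[symmetric])
    finally show False using N e by (simp add: field_simps)
  qed
  then have "AE u in lborel. u \<notin> E" by (intro AE_not_in) (auto simp: null_sets_def)
  then show ?thesis
    by eventually_elim (auto simp: f_eq heis_pot_mult E_def ennreal_mult_less_top less_top)
qed

lemma nn_integral_heis_pot_powr:
  fixes f :: "'n heis \<Rightarrow> complex"
  assumes f: "f \<in> Lp_space p"
  shows "integrable lborel (\<lambda>u. enn2real (heis_pot lam f u) powr q)"
proof (rule heis_pot_scaled[OF f])
  fix c g
  assume c: "c > 0" and g: "g \<in> Lp_space p" "Lp_mass p g \<le> 1" and f_eq: "f = (\<lambda>u. of_real c * g u)"
  have [measurable]: "g \<in> borel_measurable borel" using g by (simp add: Lp_space_iff)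
  have le: "ennreal (enn2real (heis_pot lam g u)) \<le> heis_pot lam g u" for u
    by (cases "heis_pot lam g u") auto
  have "(\<integral>\<^sup>+u. ennreal (enn2real (heis_pot lam g u) powr q) \<partial>lborel) \<le> ennreal hls_bound"
    by (rule heis_pot_unit[OF g]) (auto intro: le)
  then have "integrable lborel (\<lambda>u. enn2real (heis_pot lam g u) powr q)"
    by (intro integrableI_bounded) (auto simp: le_less_trans)
  then have "integrable lborel (\<lambda>u. c powr q * enn2real (heis_pot lam g u) powr q)" by simp
  then show ?thesis using c by (simp add: f_eq heis_pot_mult enn2real_mult powr_mult)
qed

lemma frac_int_Lq:
  fixes f :: "'n heis \<Rightarrow> complex"
  assumes f: "f \<in> Lp_space p"
  shows "frac_int lam f \<in> Lp_space q"
proof -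
  have [measurable]: "f \<in> borel_measurable borel" using f by (simp add: Lp_space_iff)
  have "integrable lborel (\<lambda>u. norm (frac_int lam f u) powr q)"
  proof (rule Bochner_Integration.integrable_bound[OF nn_integral_heis_pot_powr[OF f]])
    show "AE u in lborel. norm (norm (frac_int lam f u) powr q) \<le> norm (enn2real (heis_pot lam f u) powr q)"
      using heis_pot_finite_AE[OF f]
    proof eventually_elim
      case (elim u)
      then have "norm (frac_int lam f u) \<le> enn2real (heis_pot lam f u)"
        using norm_frac_int_le[of lam f u] by (cases "heis_pot lam f u") auto
      then show ?case using q_gt1 by (simp add: powr_mono2)
    qed
  qed measurable
  then show ?thesis by (simp add: Lp_space_iff)
qed

lemma frac_int_diff_AE:
  fixes f g :: "'n heis \<Rightarrow> complex"
  assumes f: "f \<in> Lp_space p" and g: "g \<in> Lp_space p"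
  shows "AE u in lborel. frac_int lam (\<lambda>v. f v - g v) u = frac_int lam f u - frac_int lam g u"
  using heis_pot_finite_AE[OF f] heis_pot_finite_AE[OF g]
proof eventually_elim
  case (elim u)
  then show ?case
    unfolding frac_int_eq right_diff_distrib
    by (intro Bochner_Integration.integral_diff integrable_heis_pot Lp_space_measurable[OF f] Lp_space_measurable[OF g])
qed

lemma HLS_const_finite: "HLS_const TYPE('n) p q lam < \<infinity>"
proof -
  have "HLS_const TYPE('n) p q lam \<le> ennreal (hls_bound powr (1 / q))"
    unfolding HLS_const_def
  proof (rule Sup_least, safe)
    fix f :: "'n heis \<Rightarrow> complex" assume f: "f \<in> Lp_space p" "Lp_norm p f = 1"
    then have m: "Lp_mass p f \<le> 1" using Lp_norm_eq_1_iff[of f p] p_gt1 by simp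
    have [measurable]: "f \<in> borel_measurable borel" using f by (simp add: Lp_space_iff)
    have "(\<integral>\<^sup>+u. ennreal (norm (frac_int lam f u) powr q) \<partial>lborel) \<le> ennreal hls_bound"
      by (rule heis_pot_unit[OF f(1) m]) (auto intro: norm_frac_int_le)
    then have "frac_int lam f \<in> Lp_space q" "Lp_mass q (frac_int lam f) \<le> hls_bound"
      using Lp_spaceI_nn[of "frac_int lam f" q hls_bound] hls_bound_pos by auto
    then show "Lp_norm q (frac_int lam f) \<le> ennreal (hls_bound powr (1 / q))"
      using q_gt1 by (simp add: Lp_norm_eq powr_mono2)
  qed
  then show ?thesis by (simp add: le_less_trans)
qed

end

section \<open>Convergence in Lebesgue spaces\<close>

text \<open>A dominated convergence theorem with a dominating function only up to a small multiple
  of an L^1-bounded sequence: the part of \<open>\<Phi> j\<close> above \<open>e * G j\<close> is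
  dominated by \<open>W e\<close> and tends to zero, and the rest costs at most
  \<open>e * B\<close>. It drives both the Brezis-Lieb lemma and the passage from convergence almost
  everywhere to weak convergence.\<close>

lemma integral_tendsto_0_split:
  fixes \<Phi> G :: "nat \<Rightarrow> 'a::euclidean_space \<Rightarrow> real" and W :: "real \<Rightarrow> 'a \<Rightarrow> real"
  assumes [measurable]: "\<And>j. \<Phi> j \<in> borel_measurable borel" and \<Phi>0: "\<And>j x. 0 \<le> \<Phi> j x"
    and G: "\<And>j. integrable lborel (G j)" "\<And>j x. 0 \<le> G j x" "\<And>j. (LINT x|lborel. G j x) \<le> B"
    and W: "\<And>e. e > 0 \<Longrightarrow> integrable lborel (W e)" "\<And>e x. e > 0 \<Longrightarrow> 0 \<le> W e x"
    and le: "\<And>e j x. e > 0 \<Longrightarrow> \<Phi> j x \<le> e * G j x + W e x"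
    and lim: "AE x in lborel. (\<lambda>j. \<Phi> j x) \<longlonglongrightarrow> 0"
  shows "integrable lborel (\<Phi> j)" "(\<lambda>j. LINT x|lborel. \<Phi> j x) \<longlonglongrightarrow> 0"
proof -
  have [measurable]: "\<And>j. G j \<in> borel_measurable borel" using G(1) by (auto dest: borel_measurable_integrable)
  show int: "integrable lborel (\<Phi> j)" for j
  proof (rule Bochner_Integration.integrable_bound)
    show "integrable lborel (\<lambda>x. 1 * G j x + W 1 x)" using G(1) W(1)[of 1] by auto
    show "AE x in lborel. norm (\<Phi> j x) \<le> norm (1 * G j x + W 1 x)"
      using le[of 1 j] \<Phi>0[of j] G(2)[of j] W(2)[of 1] by (auto intro!: AE_I2)
  qed measurable
  have B0: "B \<ge> 0" using order_trans[OF Bochner_Integration.integral_nonneg G(3)[of 0]] G(2) by blast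
  show "(\<lambda>j. LINT x|lborel. \<Phi> j x) \<longlonglongrightarrow> 0"
  proof (rule LIMSEQ_I)
    fix r :: real assume r: "r > 0"
    define e where "e = r / (2 * (B + 1))"
    have e: "e > 0" "e * B < r / 2" using r B0 by (auto simp: e_def field_simps)
    define \<Psi> where "\<Psi> j x = max 0 (\<Phi> j x - e * G j x)" for j x
    have [measurable]: "\<Psi> j \<in> borel_measurable borel" for j unfolding \<Psi>_def by measurable
    have "(\<lambda>j. LINT x|lborel. \<Psi> j x) \<longlonglongrightarrow> (LINT (x::'a)|lborel. 0)"
    proof (rule integral_dominated_convergence)
      show "integrable lborel (W e)" by (rule W(1)[OF e(1)])
      show "AE x in lborel. (\<lambda>j. \<Psi> j x) \<longlonglongrightarrow> 0"
        using lim
      proof eventually_elim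
        case (elim x)
        show ?case
          by (rule real_tendsto_sandwich[OF _ _ tendsto_const elim])
             (use e G(2) \<Phi>0 in \<open>auto simp: \<Psi>_def intro!: eventuallyI\<close>)
      qed
      show "AE x in lborel. norm (\<Psi> j x) \<le> W e x" for j
        using le[OF e(1), of j] W(2)[OF e(1)] by (auto simp: \<Psi>_def algebra_simps intro!: AE_I2)
    qed auto
    then have "eventually (\<lambda>j. (LINT x|lborel. \<Psi> j x) < r / 2) sequentially"
      using r by (intro order_tendstoD(2)[where a="r/2"]) auto
    then obtain N where N: "\<And>j. j \<ge> N \<Longrightarrow> (LINT x|lborel. \<Psi> j x) < r / 2"
      unfolding eventually_sequentially by blast
    have "norm ((LINT x|lborel. \<Phi> j x) - 0) < r" if "j \<ge> N" for j
    proof -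
      have \<Psi>i: "integrable lborel (\<Psi> j)"
        by (rule Bochner_Integration.integrable_bound[OF int[of j]])
           (use e G(2) \<Phi>0 in \<open>auto simp: \<Psi>_def intro!: AE_I2\<close>)
      have "(LINT x|lborel. \<Phi> j x) \<le> (LINT x|lborel. \<Psi> j x + e * G j x)"
        by (rule integral_mono[OF int Bochner_Integration.integrable_add[OF \<Psi>i integrable_mult_right[OF G(1)]]])
           (auto simp: \<Psi>_def)
      also have "\<dots> = (LINT x|lborel. \<Psi> j x) + e * (LINT x|lborel. G j x)"
        using \<Psi>i G(1) by simp
      also have "\<dots> < r / 2 + r / 2"
        using N[OF that] mult_left_mono[OF G(3)[of j], of e] e by linarith
      finally show ?thesis using Bochner_Integration.integral_nonneg[of lborel "\<Phi> j"] \<Phi>0 by simp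
    qed
    then show "\<exists>N. \<forall>j\<ge>N. norm ((LINT x|lborel. \<Phi> j x) - 0) < r" by blast
  qed
qed

text \<open>If \<open>norm b\<close> is at most \<open>d * norm a\<close>, then
  \<open>norm (a + b)\<close> lies between \<open>(1 - d) * norm a\<close> and
  \<open>(1 + d) * norm a\<close>, and continuity of the power at 1 gives the factor
  \<open>e\<close>. Otherwise everything is bounded by a multiple of \<open>norm b\<close>.\<close>

lemma powr_norm_add_approx:
  fixes e p :: real
  assumes e: "e > 0" and p: "p > 0"
  obtains C where "C \<ge> 0"
    "\<And>a b :: complex. \<bar>norm (a + b) powr p - norm a powr p - norm b powr p\<bar> \<le> e * norm a powr p + C * norm b powr p"
proof -
  have "((\<lambda>d. (1 + d) powr p) \<longlongrightarrow> (1 + 0) powr p) (at_right 0)" "((\<lambda>d. (1 - d) powr p) \<longlongrightarrow> (1 - 0) powr p) (at_right 0)"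
    by (intro tendsto_powr tendsto_add tendsto_diff tendsto_const tendsto_ident_at; simp)+
  then have "eventually (\<lambda>d. (1 + d) powr p < 1 + e) (at_right 0)" "eventually (\<lambda>d. (1 - d) powr p > 1 - e) (at_right 0)"
    using e by (auto intro: order_tendstoD)
  moreover have "eventually (\<lambda>d::real. 0 < d \<and> d < 1) (at_right 0)"
    unfolding eventually_at_right_field by (auto intro: exI[of _ 1])
  ultimately have "eventually (\<lambda>d. (1 + d) powr p < 1 + e \<and> (1 - d) powr p > 1 - e \<and> 0 < d \<and> d < 1) (at_right (0::real))"
    by eventually_elim auto
  then obtain d where d: "(1 + d) powr p < 1 + e" "(1 - d) powr p > 1 - e" "0 < d" "d < 1"
    using eventually_happens'[OF trivial_limit_at_right_real[of 0]] by blast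
  show ?thesis
  \<comment> \<open>The summand 1 pays for \<open>norm b powr p\<close> itself, the other two for
    \<open>norm (a + b)\<close> and \<open>norm a\<close> in the case
    \<open>norm b > d * norm a\<close>.\<close>
  proof (rule that[of "1 + (1 / d + 1) powr p + (1 / d) powr p"])
    fix a b :: complex
    define x y s where "x = norm a" and "y = norm b" and "s = norm (a + b)"
    have xy: "x \<ge> 0" "y \<ge> 0" "s \<ge> 0" "s \<le> x + y" "x \<le> s + y"
      using norm_triangle_ineq[of a b] norm_triangle_ineq4[of "a + b" b] by (auto simp: x_def y_def s_def)
    have "\<bar>s powr p - x powr p\<bar> \<le> e * x powr p + ((1 / d + 1) powr p + (1 / d) powr p) * y powr p"
    proof (cases "y \<le> d * x")
      case True
      have "s powr p \<le> ((1 + d) * x) powr p"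
        using True xy p by (intro powr_mono2) (auto simp: algebra_simps)
      also have "\<dots> = (1 + d) powr p * x powr p" using d xy by (simp add: powr_mult)
      also have "\<dots> \<le> (1 + e) * x powr p" using d by (intro mult_right_mono) auto
      finally have 1: "s powr p - x powr p \<le> e * x powr p" by (simp add: algebra_simps)
      have "d * x \<le> x" using d xy mult_right_mono[of d 1 x] by simp
      have "(1 - e) * x powr p \<le> (1 - d) powr p * x powr p" using d by (intro mult_right_mono) auto
      also have "\<dots> = ((1 - d) * x) powr p" using d xy by (simp add: powr_mult)
      also have "\<dots> \<le> s powr p"
        using True xy p d \<open>d * x \<le> x\<close> by (intro powr_mono2) (auto simp: algebra_simps)
      finally have 2: "x powr p - s powr p \<le> e * x powr p" by (simp add: algebra_simps)
      have "0 \<le> ((1 / d + 1) powr p + (1 / d) powr p) * y powr p" by simp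
      then show ?thesis using 1 2 by linarith
    next
      case False
      then have x: "x \<le> 1 / d * y" using d by (simp add: field_simps)
      have "s powr p \<le> ((1 / d + 1) * y) powr p"
        using x xy p by (intro powr_mono2) (auto simp: algebra_simps)
      moreover have "x powr p \<le> (1 / d * y) powr p"
        using x xy p by (intro powr_mono2) auto
      moreover have "((1 / d + 1) * y) powr p = (1 / d + 1) powr p * y powr p" "(1 / d * y) powr p = (1 / d) powr p * y powr p"
        by (simp_all only: powr_mult)
      ultimately have "s powr p + x powr p \<le> ((1 / d + 1) powr p + (1 / d) powr p) * y powr p"
        unfolding distrib_right[of _ _ "y powr p"] by linarith
      moreover have "0 \<le> s powr p" "0 \<le> x powr p" "0 \<le> e * x powr p" using e by auto
      ultimately show ?thesis by linarith
    qed
    then show "\<bar>norm (a + b) powr p - norm a powr p - norm b powr p\<bar> \<le>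
        e * norm a powr p + (1 + (1 / d + 1) powr p + (1 / d) powr p) * norm b powr p"
      unfolding x_def[symmetric] y_def[symmetric] s_def[symmetric] distrib_right
      using powr_ge_zero[of y p] by linarith
  qed (auto intro!: add_nonneg_nonneg)
qed

lemma Fatou_Lp:
  assumes f: "\<And>j. f j \<in> Lp_space p" "\<And>j. Lp_mass p (f j) \<le> B" and [measurable]: "g \<in> borel_measurable borel"
    and lim: "AE x in lborel. (\<lambda>j. f j x) \<longlonglongrightarrow> g x" and "p > 0"
  shows "g \<in> Lp_space p" "Lp_mass p g \<le> B"
proof -
  have [measurable]: "\<And>j. f j \<in> borel_measurable borel" using f by (simp add: Lp_space_iff)
  have B0: "B \<ge> 0" using f(2)[of 0] Lp_mass_nonneg[of p "f 0"] by linarith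
  have "(\<integral>\<^sup>+x. ennreal (norm (g x) powr p) \<partial>lborel) = (\<integral>\<^sup>+x. liminf (\<lambda>j. ennreal (norm (f j x) powr p)) \<partial>lborel)"
  proof (rule nn_integral_cong_AE, use lim in eventually_elim)
    case (elim x)
    have "(\<lambda>j. norm (f j x) powr p) \<longlonglongrightarrow> norm (g x) powr p"
      using elim \<open>p > 0\<close> by (intro tendsto_powr' tendsto_norm) auto
    then have "(\<lambda>j. ennreal (norm (f j x) powr p)) \<longlonglongrightarrow> ennreal (norm (g x) powr p)"
      by (rule tendsto_ennrealI)
    then show ?case by (rule lim_imp_Liminf[OF trivial_limit_sequentially, symmetric])
  qed
  also have "\<dots> \<le> liminf (\<lambda>j. \<integral>\<^sup>+x. ennreal (norm (f j x) powr p) \<partial>lborel)"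
    by (rule nn_integral_liminf) measurable
  also have "\<dots> \<le> liminf (\<lambda>j. ennreal B)"
    using f by (intro Liminf_mono) (auto simp: nn_integral_Lp_mass ennreal_leI)
  also have "\<dots> = ennreal B" by (simp add: Liminf_const)
  finally show "g \<in> Lp_space p" "Lp_mass p g \<le> B"
    using Lp_spaceI_nn[of g p B] B0 by auto
qed

text \<open>In \<open>powr_norm_add_approx\<close> take \<open>a = f j - g\<close> and
  \<open>b = g\<close>: the small coefficient \<open>e\<close> falls on the bounded masses of the
  differences, the large constant on the fixed integrable function
  \<open>norm (g x) powr p\<close>.\<close>

lemma Brezis_Lieb:
  assumes f: "\<And>j. f j \<in> Lp_space p" "\<And>j. Lp_mass p (f j) \<le> B" and [measurable]: "g \<in> borel_measurable borel"
    and lim: "AE x in lborel. (\<lambda>j. f j x) \<longlonglongrightarrow> g x" and p: "p > 0"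
  shows "(\<lambda>j. Lp_mass p (f j) - Lp_mass p (\<lambda>x. f j x - g x)) \<longlonglongrightarrow> Lp_mass p g"
proof -
  have [measurable]: "\<And>j. f j \<in> borel_measurable borel" using f by (simp add: Lp_space_iff)
  have g: "g \<in> Lp_space p" "Lp_mass p g \<le> B" using Fatou_Lp[OF f _ lim p] by auto
  have d: "(\<lambda>x. f j x - g x) \<in> Lp_space p" "Lp_mass p (\<lambda>x. f j x - g x) \<le> 2 powr p * (B + B)" for j
  proof -
    show "(\<lambda>x. f j x - g x) \<in> Lp_space p" using Lp_space_diff[OF f(1) g(1) p] by auto
    have "2 powr p * (Lp_mass p (f j) + Lp_mass p g) \<le> 2 powr p * (B + B)"
      by (intro mult_left_mono add_mono f g) auto
    then show "Lp_mass p (\<lambda>x. f j x - g x) \<le> 2 powr p * (B + B)" 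
      using Lp_space_diff(2)[OF f(1) g(1) p, of j] by linarith
  qed
  define C where "C e = (SOME C. C \<ge> 0 \<and> (\<forall>a b :: complex.
    \<bar>norm (a + b) powr p - norm a powr p - norm b powr p\<bar> \<le> e * norm a powr p + C * norm b powr p))" for e
  have C: "C e \<ge> 0 \<and> (\<forall>a b :: complex.
    \<bar>norm (a + b) powr p - norm a powr p - norm b powr p\<bar> \<le> e * norm a powr p + C e * norm b powr p)" if "e > 0" for e
    unfolding C_def by (rule someI_ex) (metis powr_norm_add_approx[OF that p])
  define \<Phi> where "\<Phi> j x = \<bar>norm (f j x) powr p - norm (f j x - g x) powr p - norm (g x) powr p\<bar>" for j x
  have 1: "(\<lambda>j. LINT x|lborel. \<Phi> j x) \<longlonglongrightarrow> 0"
  proof (rule integral_tendsto_0_split)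
    show "\<Phi> j \<in> borel_measurable borel" for j unfolding \<Phi>_def by measurable
    show "integrable lborel (\<lambda>x. norm (f j x - g x) powr p)" for j
      using Lp_space_integrable[OF d(1)] .
    show "(LINT x|lborel. norm (f j x - g x) powr p) \<le> 2 powr p * (B + B)" for j
      using d(2)[of j] by (simp add: Lp_mass_def)
    show "integrable lborel (\<lambda>x. C e * norm (g x) powr p)" for e
      using Lp_space_integrable[OF g(1)] by simp
    show "\<Phi> j x \<le> e * norm (f j x - g x) powr p + C e * norm (g x) powr p" if "e > 0" for e j x
      using C[OF that] unfolding \<Phi>_def by (elim conjE allE[of _ "f j x - g x"] allE[of _ "g x"]) simp
    show "AE x in lborel. (\<lambda>j. \<Phi> j x) \<longlonglongrightarrow> 0"
      using lim
    proof eventually_elim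
      case (elim x)
      have "(\<lambda>j. \<Phi> j x) \<longlonglongrightarrow> \<bar>norm (g x) powr p - norm (g x - g x) powr p - norm (g x) powr p\<bar>"
        unfolding \<Phi>_def using elim p
        by (intro tendsto_rabs tendsto_diff tendsto_powr' tendsto_norm tendsto_const) auto
      then show ?case by simp
    qed
  qed (use C in \<open>auto simp: \<Phi>_def\<close>)
  have 2: "norm (Lp_mass p (f j) - Lp_mass p (\<lambda>x. f j x - g x) - Lp_mass p g) \<le> (LINT x|lborel. \<Phi> j x)" for j
  proof -
    have "Lp_mass p (f j) - Lp_mass p (\<lambda>x. f j x - g x) - Lp_mass p g =
       (LINT x|lborel. norm (f j x) powr p - norm (f j x - g x) powr p - norm (g x) powr p)"
      unfolding Lp_mass_def
      using Lp_space_integrable[OF f(1)] Lp_space_integrable[OF d(1)] Lp_space_integrable[OF g(1)] by simp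
    also have "norm \<dots> \<le> (LINT x|lborel. \<Phi> j x)"
      unfolding \<Phi>_def using integral_norm_bound[of lborel "\<lambda>x. norm (f j x) powr p - norm (f j x - g x) powr p - norm (g x) powr p"]
      by simp
    finally show ?thesis .
  qed
  have "(\<lambda>j. Lp_mass p (f j) - Lp_mass p (\<lambda>x. f j x - g x) - Lp_mass p g) \<longlonglongrightarrow> 0"
    by (rule Lim_null_comparison[OF always_eventually 1]) (rule allI, rule 2)
  then show ?thesis by (simp add: LIM_zero_iff)
qed

section \<open>Conjugate exponents and near equality in Young's inequality\<close>

locale conjugate_exponents =
  fixes p p' :: real
  assumes p_gt: "p > 1" and p'_gt: "p' > 1" and conj: "1 / p + 1 / p' = 1"
begin

lemma conj_mult: "p' * (p - 1) = p" "p * (p' - 1) = p'"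
  using p_gt p'_gt conj by (simp_all add: field_simps)

lemma mult_le_powr: "a \<ge> 0 \<Longrightarrow> b \<ge> 0 \<Longrightarrow> a * b \<le> a powr p + b powr p'"
proof -
  assume ab: "a \<ge> 0" "b \<ge> 0"
  have "a * b \<le> a powr p / p + b powr p' / p'" by (rule Youngs_inequality[OF p_gt p'_gt conj ab])
  also have "\<dots> \<le> a powr p / 1 + b powr p' / 1" using p_gt p'_gt by (intro add_mono divide_left_mono) auto
  finally show ?thesis by simp
qed

lemma mult_le_eps:
  assumes "a \<ge> 0" "b \<ge> 0" "e > 0"
  shows "a * b \<le> e * a powr p + e powr (- p' / p) * b powr p'"
proof -
  have "a * b = (e powr (1 / p) * a) * (e powr (- 1 / p) * b)"
    using assms by (simp add: powr_minus field_simps)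
  also have "\<dots> \<le> (e powr (1 / p) * a) powr p + (e powr (- 1 / p) * b) powr p'"
    using assms by (intro mult_le_powr) auto
  also have "\<dots> = e * a powr p + e powr (- p' / p) * b powr p'"
    using assms p_gt by (simp add: powr_mult powr_powr)
  finally show ?thesis .
qed

lemma integrable_mult_Lp:
  assumes f: "f \<in> Lp_space p" and [measurable]: "\<phi> \<in> borel_measurable borel"
    and \<phi>: "integrable lborel (\<lambda>x. norm (\<phi> x) powr p')"
  shows "integrable lborel (\<lambda>x. \<phi> x * f x)"
proof (rule Bochner_Integration.integrable_bound)
  note [measurable] = Lp_space_measurable[OF f(1)]
  show "integrable lborel (\<lambda>x. norm (f x) powr p + norm (\<phi> x) powr p')"
    using Lp_space_integrable[OF f] \<phi> by simp
  show "AE x in lborel. norm (\<phi> x * f x) \<le> norm (norm (f x) powr p + norm (\<phi> x) powr p')"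
  proof (rule AE_I2)
    fix x
    have "norm (f x) * norm (\<phi> x) \<le> norm (f x) powr p + norm (\<phi> x) powr p'" by (rule mult_le_powr) auto
    then show "norm (\<phi> x * f x) \<le> norm (norm (f x) powr p + norm (\<phi> x) powr p')"
      by (simp add: norm_mult mult.commute)
  qed
  show "(\<lambda>x. \<phi> x * f x) \<in> borel_measurable lborel" by measurable
qed

text \<open>Young's inequality with a small factor on the p-th power of the differences leaves a
  multiple of the integrable \<open>\<bar>\<phi> x\<bar> powr p'\<close>, so
  \<open>integral_tendsto_0_split\<close> applies. The absolute values inside make this stronger
  than weak convergence.\<close>

lemma weak_convergence_of_AE:
  fixes \<phi> :: "'a::euclidean_space \<Rightarrow> real"
  assumes f: "\<And>j. f j \<in> Lp_space p" "\<And>j. Lp_mass p (f j) \<le> B" and [measurable]: "g \<in> borel_measurable borel"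
    and lim: "AE x in lborel. (\<lambda>j. f j x) \<longlonglongrightarrow> g x"
    and [measurable]: "\<phi> \<in> borel_measurable borel"
    and \<phi>: "integrable lborel (\<lambda>x. \<bar>\<phi> x\<bar> powr p')"
  shows "(\<lambda>j. LINT x|lborel. \<bar>\<phi> x\<bar> * norm (f j x - g x)) \<longlonglongrightarrow> 0"
proof -
  have p: "p > 0" using p_gt by simp
  have [measurable]: "\<And>j. f j \<in> borel_measurable borel" using f by (simp add: Lp_space_iff)
  have g: "g \<in> Lp_space p" "Lp_mass p g \<le> B" using Fatou_Lp[OF f _ lim p] by auto
  show ?thesis
  proof (rule integral_tendsto_0_split)
    show "integrable lborel (\<lambda>x. norm (f j x - g x) powr p)" for j
      using Lp_space_diff(1)[OF f(1) g(1) p] by (rule Lp_space_integrable)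
    show "(LINT x|lborel. norm (f j x - g x) powr p) \<le> 2 powr p * (B + B)" for j
    proof -
      have "2 powr p * (Lp_mass p (f j) + Lp_mass p g) \<le> 2 powr p * (B + B)"
        by (intro mult_left_mono add_mono f g) auto
      with Lp_space_diff(2)[OF f(1) g(1) p, of j] show ?thesis unfolding Lp_mass_def by (rule order_trans)
    qed
    show "integrable lborel (\<lambda>x. e powr (- p' / p) * \<bar>\<phi> x\<bar> powr p')" for e using \<phi> by simp
    show "\<bar>\<phi> x\<bar> * norm (f j x - g x) \<le> e * norm (f j x - g x) powr p + e powr (- p' / p) * \<bar>\<phi> x\<bar> powr p'"
      if "e > 0" for e j x
      using mult_le_eps[of "norm (f j x - g x)" "\<bar>\<phi> x\<bar>" e] that by (simp add: mult.commute)
    show "AE x in lborel. (\<lambda>j. \<bar>\<phi> x\<bar> * norm (f j x - g x)) \<longlonglongrightarrow> 0"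
      using lim
    proof eventually_elim
      case (elim x)
      have "(\<lambda>j. \<bar>\<phi> x\<bar> * norm (f j x - g x)) \<longlonglongrightarrow> \<bar>\<phi> x\<bar> * norm (g x - g x)"
        using elim by (intro tendsto_intros)
      then show ?case by simp
    qed
  qed auto
qed

text \<open>The defect in Young's inequality, as a function of the first argument, is nonnegative
  and vanishes at \<open>x\<close>. For \<open>x > 0\<close> this is an interior minimum, so the
  derivative vanishes there.\<close>

lemma Young_eq_imp:
  fixes x y :: real
  assumes x: "x \<ge> 0" and y: "y \<ge> 0" and eq: "x * y = x powr p / p + y powr p' / p'"
  shows "x = y powr (1 / (p - 1))"
proof (cases "x = 0")
  case True
  then have "y powr p' = 0" using eq p_gt p'_gt by simp
  then show ?thesis using True by simp
next
  case False
  then have x0: "x > 0" using x by simp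
  define g where "g t = t powr p / p - t * y + y powr p' / p'" for t
  have g0: "g t \<ge> 0" if "t \<ge> 0" for t
    using Youngs_inequality[OF p_gt p'_gt conj that y] by (simp add: g_def)
  have "(g has_real_derivative (p * x powr (p - 1) / p - y)) (at x)"
    unfolding g_def using x0 p_gt by (auto intro!: derivative_eq_intros)
  then have "p * x powr (p - 1) / p - y = 0"
  proof (rule DERIV_local_min[where d=x])
    show "\<forall>t. \<bar>x - t\<bar> < x \<longrightarrow> g x \<le> g t"
      using g0 eq by (auto simp: g_def)
  qed (rule x0)
  then have "y = x powr (p - 1)" using p_gt by simp
  then show ?thesis using x0 p_gt by (simp add: powr_powr)
qed

text \<open>A zero defect forces equality in \<open>Re (z * w) \<le> norm z * norm w\<close>, which
  fixes the phase of \<open>z\<close>, and in Young's inequality, which fixes its modulus. For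
  \<open>w = 0\<close> both sides are zero.\<close>

lemma Young_defect_limit_unique:
  fixes z w :: complex
  assumes "norm z powr p / p + norm w powr p' / p' - Re (z * w) = 0"
  shows "z = of_real (norm w powr (1 / (p - 1))) * (cnj w / of_real (norm w))"
proof -
  have 1: "Re (z * w) \<le> norm z * norm w" using complex_Re_le_cmod[of "z * w"] by (simp add: norm_mult)
  have 2: "norm z * norm w \<le> norm z powr p / p + norm w powr p' / p'"
    by (rule Youngs_inequality[OF p_gt p'_gt conj]) auto
  have nz: "norm z = norm w powr (1 / (p - 1))"
    using 1 2 assms by (intro Young_eq_imp) auto
  show ?thesis
  proof (cases "w = 0")
    case True
    then show ?thesis using nz by simp
  next
    case False
    have re: "Re (z * w) = norm (z * w)" using 1 2 assms by (simp add: norm_mult)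
    then have "Im (z * w) = 0" using cmod_power2[of "z * w"] by simp
    then have "z * w = of_real (norm z * norm w)" using re by (simp add: complex_eq_iff norm_mult)
    then have "z = of_real (norm z * norm w) / w" using False by (simp add: field_simps)
    also have "\<dots> = of_real (norm z * norm w) * cnj w / (w * cnj w)" using False by simp
    also have "w * cnj w = of_real (norm w ^ 2)" by (simp add: complex_norm_square[symmetric])
    finally show ?thesis using False nz by (simp add: power2_eq_square field_simps)
  qed
qed

text \<open>For bounded \<open>w\<close> the defect is coercive in \<open>z\<close>, so the sequence
  \<open>z\<close> stays bounded; each of its limit points has defect zero against
  \<open>w0\<close>, and there is only one such point.\<close>

lemma Young_defect_tendsto:
  fixes z w :: "nat \<Rightarrow> complex"
  assumes w: "w \<longlonglongrightarrow> w0"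
    and e: "(\<lambda>j. norm (z j) powr p / p + norm (w j) powr p' / p' - Re (z j * w j)) \<longlonglongrightarrow> 0"
  shows "z \<longlonglongrightarrow> of_real (norm w0 powr (1 / (p - 1))) * (cnj w0 / of_real (norm w0))" (is "_ \<longlonglongrightarrow> ?z")
proof -
  define E where "E j = norm (z j) powr p / p + norm (w j) powr p' / p' - Re (z j * w j)" for j
  have "E \<longlonglongrightarrow> 0" using e by (simp add: E_def[abs_def])
  then obtain B1 where B1: "\<And>j. norm (E j) \<le> B1"
    using convergent_imp_Bseq[of E] by (auto simp: convergent_def Bseq_def)
  obtain B2 where B2: "B2 > 0" "\<And>j. norm (w j) \<le> B2"
    using convergent_imp_Bseq[of w] w by (auto simp: convergent_def Bseq_def)
  have bz: "norm (z j) powr p * ((1 - (1 / 2) powr p) / p) \<le> B1 + (2 * B2) powr p' / p'" for j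
  proof -
    have "Re (z j * w j) \<le> norm (z j) * norm (w j)"
      using complex_Re_le_cmod[of "z j * w j"] by (simp add: norm_mult)
    \<comment> \<open>Moving a factor 2 from \<open>z\<close> to \<open>w\<close> before Young's
      inequality is applied leaves the positive share \<open>1 - (1 / 2) powr p\<close> of
      \<open>norm (z j) powr p / p\<close>.\<close>
    also have "\<dots> = (norm (z j) * (1 / 2)) * (2 * norm (w j))" by simp
    also have "\<dots> \<le> (norm (z j) * (1 / 2)) powr p / p + (2 * norm (w j)) powr p' / p'"
      by (rule Youngs_inequality[OF p_gt p'_gt conj]) auto
    also have "(2 * norm (w j)) powr p' / p' \<le> (2 * B2) powr p' / p'"
      using B2 p'_gt by (intro divide_right_mono powr_mono2) auto
    also have "(norm (z j) * (1 / 2)) powr p / p = norm (z j) powr p * (1 / 2) powr p / p"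
      by (subst powr_mult) auto
    finally have "norm (z j) powr p / p - norm (z j) powr p * (1 / 2) powr p / p \<le> E j - norm (w j) powr p' / p' + (2 * B2) powr p' / p'"
      unfolding E_def by linarith
    moreover have "E j \<le> B1" using B1[of j] by simp
    moreover have "norm (w j) powr p' / p' \<ge> 0" using p'_gt by simp
    moreover have "norm (z j) powr p * ((1 - (1 / 2) powr p) / p) = norm (z j) powr p / p - norm (z j) powr p * (1 / 2) powr p / p"
      by (simp add: diff_divide_distrib right_diff_distrib)
    ultimately show ?thesis by linarith
  qed
  have "(1 / 2 :: real) powr p < 1" using p_gt powr_less_mono2[of p "1/2" 1] by simp
  then have c: "(1 - (1 / 2 :: real) powr p) / p > 0" using p_gt by simp
  define M where "M = (B1 + (2 * B2) powr p' / p') / ((1 - (1 / 2) powr p) / p)"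
  have bz': "norm (z j) powr p \<le> M" for j
    unfolding M_def using bz[of j] c by (simp only: pos_le_divide_eq)
  have bound: "norm (z j) \<le> M powr (1 / p)" for j
  proof -
    have "(norm (z j) powr p) powr (1 / p) \<le> M powr (1 / p)"
      using bz'[of j] p_gt by (intro powr_mono2) auto
    then show ?thesis using p_gt by (simp add: powr_powr)
  qed
  have sub: "\<exists>t. strict_mono t \<and> (z \<circ> (r \<circ> t)) \<longlonglongrightarrow> ?z" if r: "strict_mono r" for r :: "nat \<Rightarrow> nat"
  proof -
    have "bounded (range (z \<circ> r))" using bound by (auto simp: bounded_iff)
    from bounded_imp_convergent_subsequence[OF this] obtain l t where t: "strict_mono t" "((z \<circ> r) \<circ> t) \<longlonglongrightarrow> l"
      by (auto simp: o_assoc)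
    have rt: "strict_mono (r \<circ> t)" using r t(1) by (rule strict_mono_o)
    have zl: "(\<lambda>j. z ((r \<circ> t) j)) \<longlonglongrightarrow> l" using t(2) by (simp add: o_def)
    have wl: "(\<lambda>j. w ((r \<circ> t) j)) \<longlonglongrightarrow> w0" using LIMSEQ_subseq_LIMSEQ[OF w rt] by (simp add: o_def)
    have "(\<lambda>j. norm (z ((r \<circ> t) j)) powr p / p + norm (w ((r \<circ> t) j)) powr p' / p' - Re (z ((r \<circ> t) j) * w ((r \<circ> t) j)))
      \<longlonglongrightarrow> norm l powr p / p + norm w0 powr p' / p' - Re (l * w0)"
      using p_gt p'_gt by (intro tendsto_intros tendsto_powr' zl wl) auto
    moreover have "(\<lambda>j. norm (z ((r \<circ> t) j)) powr p / p + norm (w ((r \<circ> t) j)) powr p' / p' - Re (z ((r \<circ> t) j) * w ((r \<circ> t) j)))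
      \<longlonglongrightarrow> 0" using LIMSEQ_subseq_LIMSEQ[OF e rt] by (simp add: o_def)
    ultimately have "norm l powr p / p + norm w0 powr p' / p' - Re (l * w0) = 0" by (rule LIMSEQ_unique)
    then have "l = ?z" by (rule Young_defect_limit_unique)
    then show ?thesis using t by (auto simp: o_assoc)
  qed
  show ?thesis
  proof (rule ccontr)
    assume "\<not> z \<longlonglongrightarrow> ?z"
    then obtain d where d: "d > 0" "\<And>N. \<exists>j\<ge>N. \<not> dist (z j) ?z < d"
      unfolding lim_sequentially by blast
    define S where "S = {j. \<not> dist (z j) ?z < d}"
    have "infinite S" using d(2) unfolding S_def infinite_nat_iff_unbounded_le by blast
    then obtain r :: "nat \<Rightarrow> nat" where r: "strict_mono r" "\<And>i. r i \<in> S"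
      using infinite_enumerate by blast
    from sub[OF r(1)] obtain t where t: "(z \<circ> (r \<circ> t)) \<longlonglongrightarrow> ?z" by blast
    then have "eventually (\<lambda>i. dist (z (r (t i))) ?z < d) sequentially"
      using d(1) by (auto simp: o_def tendsto_iff)
    then obtain i where "dist (z (r (t i))) ?z < d" by (auto simp: eventually_sequentially)
    then show False using r(2)[of "t i"] by (simp add: S_def)
  qed
qed

end

lemma powr_sum_ge_1:
  fixes a r :: real
  assumes "0 \<le> a" "a \<le> 1" "r > 1" "1 \<le> a powr r + (1 - a) powr r"
  shows "a = 0 \<or> a = 1"
proof (rule ccontr)
  assume *: "\<not> (a = 0 \<or> a = 1)"
  have lt: "x powr r < x" if "0 < x" "x < 1" for x :: real
    using powr_less_mono'[of x 1 r] that assms by simp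
  have "a powr r < a" "(1 - a) powr r < 1 - a" using * assms by (intro lt; simp)+
  then show False using assms by linarith
qed

section \<open>Local compactness of the potential\<close>

text \<open>With \<open>p'\<close> conjugate to \<open>p\<close>, the tail of the kernel is in L^p'
  but its singularity is not, as \<open>lam * p' > Q\<close>. Capping at \<open>e\<close> puts the
  kernel into L^p', where it depends continuously on \<open>u\<close>; hence
  \<open>trunc_int\<close> can be handled point by point.\<close>

definition trunc_int :: "real \<Rightarrow> real \<Rightarrow> ('n::finite heis \<Rightarrow> complex) \<Rightarrow> 'n heis \<Rightarrow> complex" where
  "trunc_int lam e f u = (LINT v|lborel. of_real (max e (heis_dist u v) powr - lam) * f v)"

text \<open>A strictly positive integrable weight: convergence in weighted L^1 on the whole group
  replaces convergence on each ball of an exhaustion, and the weight can be divided out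
  pointwise.\<close>

definition heis_weight :: "'n::finite heis \<Rightarrow> real" where
  "heis_weight u = max 1 (heis_dist 0 u) powr - (hom_dim TYPE('n) + 1)"

lemma nn_integral_max_heis_dist:
  fixes u :: "'n::finite heis"
  assumes "a > hom_dim TYPE('n)" "e > 0"
  shows "(\<integral>\<^sup>+v. ennreal (max e (heis_dist u v) powr - a) \<partial>lborel) \<le>
    ennreal (e powr - a * (heis_vol TYPE('n) * e powr hom_dim TYPE('n)) +
      heis_vol TYPE('n) * a / (a - hom_dim TYPE('n)) * e powr (hom_dim TYPE('n) - a))"
proof -
  define Q where "Q = hom_dim TYPE('n)"
  define V where "V = heis_vol TYPE('n)"
  have Q: "Q > 0" "a > Q" and V: "V > 0" using hom_dim_pos heis_vol(1) assms by (auto simp: Q_def V_def)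
  have "(\<integral>\<^sup>+v. ennreal (max e (heis_dist u v) powr - a) \<partial>lborel) \<le>
    (\<integral>\<^sup>+v. ennreal (e powr - a) * (if heis_dist u v < e then 1 else 0) +
       (if e \<le> heis_dist u v then 1 * ennreal (heis_dist u v powr - a) else 0) \<partial>lborel)"
    by (intro nn_integral_mono) (auto simp: max_def)
  also have "\<dots> = ennreal (e powr - a) * (\<integral>\<^sup>+v. (if heis_dist u v < e then 1 else 0) \<partial>lborel) +
       (\<integral>\<^sup>+v. (if e \<le> heis_dist u v then 1 * ennreal (heis_dist u v powr - a) else 0) \<partial>lborel)"
    by (subst nn_integral_add, measurable) (subst nn_integral_cmult, measurable)
  also have "\<dots> \<le> ennreal (e powr - a) * ennreal (V * e powr Q) + ennreal (V * a / (a - Q) * e powr (Q - a))"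
  proof (intro add_mono)
    show "ennreal (e powr - a) * (\<integral>\<^sup>+v. (if heis_dist u v < e then 1 else 0) \<partial>lborel) \<le> ennreal (e powr - a) * ennreal (V * e powr Q)"
      using assms by (simp add: nn_integral_heis_ball V_def Q_def)
    show "(\<integral>\<^sup>+v. (if e \<le> heis_dist u v then 1 * ennreal (heis_dist u v powr - a) else 0) \<partial>lborel) \<le> ennreal (V * a / (a - Q) * e powr (Q - a))"
      using assms Q V by (intro nn_integral_heis_far) (auto simp: nn_integral_heis_ball V_def Q_def)
  qed
  also have "\<dots> = ennreal (e powr - a * (V * e powr Q) + V * a / (a - Q) * e powr (Q - a))"
    using Q V by (simp add: ennreal_mult[symmetric])
  finally show ?thesis by (simp add: Q_def V_def)
qed

lemma integrable_max_heis_dist: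
  fixes u :: "'n::finite heis"
  assumes "a > hom_dim TYPE('n)" "e > 0"
  shows "integrable lborel (\<lambda>v. max e (heis_dist u v) powr - a)"
    "(LINT v|lborel. max e (heis_dist u v) powr - a) \<le>
      e powr - a * (heis_vol TYPE('n) * e powr hom_dim TYPE('n)) +
      heis_vol TYPE('n) * a / (a - hom_dim TYPE('n)) * e powr (hom_dim TYPE('n) - a)" (is "_ \<le> ?c")
proof -
  show *: "integrable lborel (\<lambda>v. max e (heis_dist u v) powr - a)"
    using nn_integral_max_heis_dist[OF assms, of u] by (intro integrableI_bounded) (auto simp: le_less_trans)
  have "?c \<ge> 0" using assms hom_dim_pos[where 'n='n] heis_vol(1)[where 'n='n] by simp
  then show "(LINT v|lborel. max e (heis_dist u v) powr - a) \<le> ?c"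
    using nn_integral_max_heis_dist[OF assms, of u] by (subst (asm) nn_integral_eq_integral[OF *]) auto
qed

lemma heis_weight:
  fixes u :: "'n::finite heis"
  shows "0 < heis_weight u" "heis_weight u \<le> 1" "integrable lborel (heis_weight :: 'n heis \<Rightarrow> real)"
proof -
  show "0 < heis_weight u" by (simp add: heis_weight_def)
  show "heis_weight u \<le> 1"
    using powr_mono2'[of "- (hom_dim TYPE('n) + 1)" 1 "max 1 (heis_dist 0 u)"] hom_dim_pos[where 'n='n]
    by (simp add: heis_weight_def)
  show "integrable lborel (heis_weight :: 'n heis \<Rightarrow> real)"
    unfolding heis_weight_def[abs_def] by (rule integrable_max_heis_dist) auto
qed

lemma borel_measurable_heis_weight [measurable]: "heis_weight \<in> borel_measurable borel"
  unfolding heis_weight_def[abs_def] by measurable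

section \<open>The truncated kernel and its error\<close>

context hls_exponents
begin

abbreviation "trunc_kernel e u v \<equiv> max e (heis_dist u v) powr - lam"

abbreviation "kernel_diff e u u' v \<equiv> \<bar>trunc_kernel e u v - trunc_kernel e u' v\<bar>"

definition "trunc_err e u v = \<bar>heis_dist u v powr - lam - trunc_kernel e u v\<bar>" for u v :: "'n heis"

definition "err_const = heis_vol TYPE('n) * Q / (Q - lam) + heis_vol TYPE('n)"

definition "weight_mass = (LINT (u :: 'n heis)|lborel. heis_weight u)"

lemma err_const_pos: "err_const > 0"
  using heis_vol(1)[where 'n='n] Q_pos lam_less by (simp add: err_const_def add_pos_pos)

lemma trunc_err_nonneg [simp]: "trunc_err e u v \<ge> 0"
  by (simp add: trunc_err_def)

lemma trunc_err_commute: "trunc_err e u v = trunc_err e v u"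
  by (simp add: trunc_err_def heis_dist_commute[of u v])

lemma borel_measurable_trunc_err [measurable (raw)]:
  assumes "f \<in> borel_measurable M" "g \<in> borel_measurable M"
  shows "(\<lambda>x. trunc_err e (f x) (g x)) \<in> borel_measurable M"
  unfolding trunc_err_def using assms by measurable

text \<open>The two kernels agree outside the ball of radius \<open>e\<close>, and inside it the
  error is at most their sum. As \<open>Q - lam > 0\<close>, truncation is harmless for small
  \<open>e\<close>, uniformly in \<open>u\<close>.\<close>

lemma nn_integral_trunc_err:
  assumes "e > 0"
  shows "(\<integral>\<^sup>+v. ennreal (trunc_err e u v) \<partial>lborel) \<le> ennreal (err_const * e powr (Q - lam))"
proof -
  have "(\<integral>\<^sup>+v. ennreal (trunc_err e u v) \<partial>lborel) \<le>
    (\<integral>\<^sup>+v. (if heis_dist u v < e then ennreal (heis_dist u v powr - lam) else 0) +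
      ennreal (e powr - lam) * (if heis_dist u v < e then 1 else 0) \<partial>lborel)"
  proof (rule nn_integral_mono)
    fix v
    show "ennreal (trunc_err e u v) \<le> (if heis_dist u v < e then ennreal (heis_dist u v powr - lam) else 0) +
      ennreal (e powr - lam) * (if heis_dist u v < e then 1 else 0)"
    proof (cases "heis_dist u v < e")
      case True
      have "trunc_err e u v \<le> heis_dist u v powr - lam + e powr - lam"
        using True unfolding trunc_err_def by (intro order_trans[OF abs_triangle_ineq4]) (simp add: max_def)
      then show ?thesis using True by (simp add: ennreal_plus[symmetric] ennreal_leI del: ennreal_plus)
    qed (simp add: trunc_err_def max_def)
  qed
  also have "\<dots> = (\<integral>\<^sup>+v. (if heis_dist u v < e then ennreal (heis_dist u v powr - lam) else 0) \<partial>lborel) +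
      ennreal (e powr - lam) * (\<integral>\<^sup>+v. (if heis_dist u v < e then 1 else 0) \<partial>lborel)"
    by (subst nn_integral_add, measurable) (subst nn_integral_cmult, measurable)
  also have "\<dots> \<le> ennreal (heis_vol TYPE('n) * Q / (Q - lam) * e powr (Q - lam)) + ennreal (e powr - lam) * ennreal (heis_vol TYPE('n) * e powr Q)"
    using nn_integral_heis_near[of lam e u] lam_pos lam_less assms
    by (intro add_mono mult_left_mono) (auto simp: nn_integral_heis_ball Q_eq)
  also have "\<dots> = ennreal (heis_vol TYPE('n) * Q / (Q - lam) * e powr (Q - lam) + e powr - lam * (heis_vol TYPE('n) * e powr Q))"
    using heis_vol(1)[where 'n='n] Q_pos lam_less by (simp add: ennreal_mult[symmetric])
  also have "heis_vol TYPE('n) * Q / (Q - lam) * e powr (Q - lam) + e powr - lam * (heis_vol TYPE('n) * e powr Q) = err_const * e powr (Q - lam)"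
    unfolding err_const_def distrib_right using assms by (simp add: powr_diff powr_minus_divide)
  finally show ?thesis .
qed

text \<open>Integrability at infinity of the p'-th power of the kernel; by \<open>lam_eq\<close> the
  margin \<open>lam - Q * (1 - 1 / p)\<close> equals \<open>Q / q\<close>.\<close>

lemma lam_conj: "lam * (p / (p - 1)) > hom_dim TYPE('n)"
proof -
  have "lam > Q * (1 - 1 / p)" using lam_eq Q_pos q_gt1 by (smt (verit) divide_pos_pos minus_divide_left)
  then have "lam * p > Q * (p - 1)" using p_gt1 by (simp add: field_simps)
  then show ?thesis using p_gt1 by (simp add: Q_eq[symmetric] field_simps)
qed

sublocale conj: conjugate_exponents p "p / (p - 1)"
  using p_gt1 by unfold_locales (auto simp: field_simps)

abbreviation "p' \<equiv> p / (p - 1)"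

lemma trunc_powr: "(trunc_kernel e u v) powr p' = max e (heis_dist u v) powr - (lam * p')" for u v :: "'n heis"
  by (simp add: powr_powr)

lemma integrable_trunc:
  fixes f :: "'n heis \<Rightarrow> complex"
  assumes f: "f \<in> Lp_space p" and e: "e > 0"
  shows "integrable lborel (\<lambda>v. of_real (trunc_kernel e u v) * f v)"
proof (rule conj.integrable_mult_Lp[OF f])
  show "integrable lborel (\<lambda>v. norm (complex_of_real (trunc_kernel e u v)) powr p')"
    using integrable_max_heis_dist(1)[OF lam_conj e, of u] by (simp add: trunc_powr del: times_divide_eq_right)
qed measurable

definition "trunc_const e = e powr - (lam * p') * (heis_vol TYPE('n) * e powr hom_dim TYPE('n)) +
      heis_vol TYPE('n) * (lam * p') / (lam * p' - hom_dim TYPE('n)) * e powr (hom_dim TYPE('n) - lam * p')"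

text \<open>The bound is independent of \<open>u\<close> because the distance is left invariant. It
  supplies the dominating function under the weight and the boundedness for the diagonal
  extraction.\<close>

lemma norm_trunc_int_le:
  fixes f :: "'n heis \<Rightarrow> complex"
  assumes f: "f \<in> Lp_space p" and e: "e > 0"
  shows "norm (trunc_int lam e f u) \<le> Lp_mass p f + trunc_const e"
proof -
  have "norm (trunc_int lam e f u) \<le> (LINT v|lborel. norm (of_real (trunc_kernel e u v) * f v))"
    unfolding trunc_int_def by (rule integral_norm_bound)
  also have "\<dots> \<le> (LINT v|lborel. norm (f v) powr p + max e (heis_dist u v) powr - (lam * p'))"
  proof (rule integral_mono)
    show "integrable lborel (\<lambda>v. norm (of_real (trunc_kernel e u v) * f v))"
      using integrable_trunc[OF f e, of u] by (rule integrable_norm)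
    show "integrable lborel (\<lambda>v. norm (f v) powr p + max e (heis_dist u v) powr - (lam * p'))"
      using Lp_space_integrable[OF f] integrable_max_heis_dist(1)[OF lam_conj e, of u] by (rule Bochner_Integration.integrable_add)
    fix v
    show "norm (of_real (trunc_kernel e u v) * f v) \<le> norm (f v) powr p + max e (heis_dist u v) powr - (lam * p')"
      using conj.mult_le_powr[of "norm (f v)" "trunc_kernel e u v"]
      by (simp add: norm_mult trunc_powr mult.commute del: times_divide_eq_right)
  qed
  also have "\<dots> \<le> Lp_mass p f + trunc_const e"
    using Lp_space_integrable[OF f] integrable_max_heis_dist[OF lam_conj e, of u]
    by (simp add: Lp_mass_def trunc_const_def del: times_divide_eq_right)
  finally show ?thesis .
qed

lemma borel_measurable_trunc_int [measurable]:
  assumes [measurable]: "f \<in> borel_measurable borel"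
  shows "(trunc_int lam e f :: 'n heis \<Rightarrow> complex) \<in> borel_measurable borel"
  unfolding trunc_int_def[abs_def] by measurable

lemma norm_frac_int_le_trunc:
  fixes f :: "'n heis \<Rightarrow> complex"
  assumes f: "f \<in> Lp_space p" and e: "e > 0"
  shows "ennreal (norm (frac_int lam f u)) \<le> ennreal (norm (trunc_int lam e f u)) + (\<integral>\<^sup>+v. ennreal (norm (f v) * trunc_err e u v) \<partial>lborel)"
proof (cases "integrable lborel (\<lambda>v. of_real (heis_dist u v powr - lam) * f v)")
  case True
  note tr = integrable_trunc[OF f e, of u]
  have int: "integrable lborel (\<lambda>v. of_real (heis_dist u v powr - lam) * f v - of_real (trunc_kernel e u v) * f v)"
    using True tr by (rule Bochner_Integration.integrable_diff)
  have norm_eq: "norm (of_real (heis_dist u v powr - lam) * f v - of_real (trunc_kernel e u v) * f v) = norm (f v) * trunc_err e u v" for v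
    unfolding left_diff_distrib[symmetric] of_real_diff[symmetric] norm_mult norm_of_real trunc_err_def by (simp add: mult.commute)
  have "frac_int lam f u - trunc_int lam e f u =
    (LINT v|lborel. of_real (heis_dist u v powr - lam) * f v - of_real (trunc_kernel e u v) * f v)"
    unfolding frac_int_eq trunc_int_def using True tr by (rule Bochner_Integration.integral_diff[symmetric])
  then have "norm (frac_int lam f u - trunc_int lam e f u) \<le> (LINT v|lborel. norm (f v) * trunc_err e u v)"
    using integral_norm_bound[of lborel "\<lambda>v. of_real (heis_dist u v powr - lam) * f v - of_real (trunc_kernel e u v) * f v"]
    by (simp only: norm_eq)
  then have "norm (frac_int lam f u) \<le> norm (trunc_int lam e f u) + (LINT v|lborel. norm (f v) * trunc_err e u v)"
    using norm_triangle_ineq2[of "frac_int lam f u" "trunc_int lam e f u"] by linarith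
  then have "ennreal (norm (frac_int lam f u)) \<le> ennreal (norm (trunc_int lam e f u)) + ennreal (LINT v|lborel. norm (f v) * trunc_err e u v)"
    using ennreal_leI by (subst ennreal_plus[symmetric]) (auto simp del: ennreal_plus intro!: Bochner_Integration.integral_nonneg)
  also have "ennreal (LINT v|lborel. norm (f v) * trunc_err e u v) = (\<integral>\<^sup>+v. ennreal (norm (f v) * trunc_err e u v) \<partial>lborel)"
    using integrable_norm[OF int] unfolding norm_eq by (subst nn_integral_eq_integral) auto
  finally show ?thesis .
qed (simp add: frac_int_eq not_integrable_integral_eq)

text \<open>By \<open>x \<le> 1 + x powr p\<close> the error splits. The part with 1 is integrated
  in \<open>v\<close> first and meets the weight; in the part with the p-th power the weight is
  dropped and, after Tonelli, the symmetric error is integrated in \<open>u\<close>. Only the mass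
  of \<open>f\<close> enters.\<close>

lemma nn_integral_weight_err:
  fixes f :: "'n heis \<Rightarrow> complex"
  assumes f: "f \<in> Lp_space p" and e: "e > 0"
  shows "(\<integral>\<^sup>+u. ennreal (heis_weight u) * (\<integral>\<^sup>+v. ennreal (norm (f v) * trunc_err e u v) \<partial>lborel) \<partial>lborel)
    \<le> ennreal (err_const * e powr (Q - lam) * (weight_mass + Lp_mass p f))"
proof -
  note [measurable] = Lp_space_measurable[OF f(1)]
  define c where "c = err_const * e powr (Q - lam)"
  have c: "c \<ge> 0" using err_const_pos by (simp add: c_def)
  have err: "(\<integral>\<^sup>+v. ennreal (trunc_err e u v) \<partial>lborel) \<le> ennreal c" for u
    unfolding c_def by (rule nn_integral_trunc_err[OF e])
  have "(\<integral>\<^sup>+u. ennreal (heis_weight u) * (\<integral>\<^sup>+v. ennreal (norm (f v) * trunc_err e u v) \<partial>lborel) \<partial>lborel)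
    \<le> (\<integral>\<^sup>+u. ennreal (heis_weight u) * ennreal c + (\<integral>\<^sup>+v. ennreal (norm (f v) powr p) * ennreal (trunc_err e u v) \<partial>lborel) \<partial>lborel)"
  proof (rule nn_integral_mono)
    fix u :: "'n heis"
    have le: "x \<le> 1 + x powr p" if "x \<ge> 0" for x :: real
      using conj.mult_le_powr[of x 1] that by simp
    have "(\<integral>\<^sup>+v. ennreal (norm (f v) * trunc_err e u v) \<partial>lborel) \<le>
      (\<integral>\<^sup>+v. ennreal (trunc_err e u v) + ennreal (norm (f v) powr p) * ennreal (trunc_err e u v) \<partial>lborel)"
    proof (rule nn_integral_mono)
      fix v
      have "norm (f v) * trunc_err e u v \<le> (1 + norm (f v) powr p) * trunc_err e u v"
        by (intro mult_right_mono le) auto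
      then have "ennreal (norm (f v) * trunc_err e u v) \<le> ennreal (trunc_err e u v + norm (f v) powr p * trunc_err e u v)"
        by (intro ennreal_leI) (simp add: distrib_right)
      then show "ennreal (norm (f v) * trunc_err e u v) \<le> ennreal (trunc_err e u v) + ennreal (norm (f v) powr p) * ennreal (trunc_err e u v)"
        by (simp add: ennreal_mult)
    qed
    also have "\<dots> = (\<integral>\<^sup>+v. ennreal (trunc_err e u v) \<partial>lborel) + (\<integral>\<^sup>+v. ennreal (norm (f v) powr p) * ennreal (trunc_err e u v) \<partial>lborel)"
      by (rule nn_integral_add) measurable
    also have "\<dots> \<le> ennreal c + (\<integral>\<^sup>+v. ennreal (norm (f v) powr p) * ennreal (trunc_err e u v) \<partial>lborel)"
      by (intro add_right_mono err)
    finally have "ennreal (heis_weight u) * (\<integral>\<^sup>+v. ennreal (norm (f v) * trunc_err e u v) \<partial>lborel) \<le>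
      ennreal (heis_weight u) * (ennreal c + (\<integral>\<^sup>+v. ennreal (norm (f v) powr p) * ennreal (trunc_err e u v) \<partial>lborel))"
      by (intro mult_left_mono) auto
    also have "\<dots> \<le> ennreal (heis_weight u) * ennreal c + 1 * (\<integral>\<^sup>+v. ennreal (norm (f v) powr p) * ennreal (trunc_err e u v) \<partial>lborel)"
      unfolding distrib_left using heis_weight(2)[of u] by (intro add_left_mono mult_right_mono) auto
    finally show "ennreal (heis_weight u) * (\<integral>\<^sup>+v. ennreal (norm (f v) * trunc_err e u v) \<partial>lborel) \<le>
      ennreal (heis_weight u) * ennreal c + (\<integral>\<^sup>+v. ennreal (norm (f v) powr p) * ennreal (trunc_err e u v) \<partial>lborel)" by simp
  qed
  also have "\<dots> = (\<integral>\<^sup>+(u::'n heis). ennreal (heis_weight u) * ennreal c \<partial>lborel) +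
      (\<integral>\<^sup>+u. \<integral>\<^sup>+v. ennreal (norm (f v) powr p) * ennreal (trunc_err e u v) \<partial>lborel \<partial>lborel)"
    by (rule nn_integral_add) measurable
  also have "(\<integral>\<^sup>+(u::'n heis). ennreal (heis_weight u) * ennreal c \<partial>lborel) = (\<integral>\<^sup>+(u::'n heis). ennreal (heis_weight u) \<partial>lborel) * ennreal c"
    by (rule nn_integral_multc) measurable
  also have "(\<integral>\<^sup>+(u::'n heis). ennreal (heis_weight u) \<partial>lborel) = ennreal weight_mass"
    unfolding weight_mass_def using heis_weight(1) by (intro nn_integral_eq_integral heis_weight) (auto intro!: AE_I2 less_imp_le)
  also have "(\<integral>\<^sup>+u. \<integral>\<^sup>+v. ennreal (norm (f v) powr p) * ennreal (trunc_err e u v) \<partial>lborel \<partial>lborel) =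
    (\<integral>\<^sup>+v. \<integral>\<^sup>+u. ennreal (norm (f v) powr p) * ennreal (trunc_err e u v) \<partial>lborel \<partial>lborel)"
    by (rule lborel_pair.Fubini') measurable
  also have "\<dots> = (\<integral>\<^sup>+v. ennreal (norm (f v) powr p) * (\<integral>\<^sup>+u. ennreal (trunc_err e u v) \<partial>lborel) \<partial>lborel)"
    by (intro nn_integral_cong nn_integral_cmult) measurable
  also have "\<dots> \<le> (\<integral>\<^sup>+v. ennreal (norm (f v) powr p) * ennreal c \<partial>lborel)"
  proof (intro nn_integral_mono mult_left_mono)
    fix v show "(\<integral>\<^sup>+u. ennreal (trunc_err e u v) \<partial>lborel) \<le> ennreal c"
      using err[of v] by (simp only: trunc_err_commute[of e v])
  qed simp
  also have "\<dots> = ennreal (Lp_mass p f) * ennreal c"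
    by (subst nn_integral_multc) (auto simp: nn_integral_Lp_mass[OF f])
  finally have "(\<integral>\<^sup>+u. ennreal (heis_weight u) * (\<integral>\<^sup>+v. ennreal (norm (f v) * trunc_err e u v) \<partial>lborel) \<partial>lborel)
    \<le> ennreal weight_mass * ennreal c + ennreal (Lp_mass p f) * ennreal c"
    by (simp add: add_left_mono)
  also have "\<dots> = ennreal (c * (weight_mass + Lp_mass p f))"
  proof -
    have "weight_mass \<ge> 0" unfolding weight_mass_def
      using heis_weight(1) by (intro Bochner_Integration.integral_nonneg) (auto intro: less_imp_le)
    then show ?thesis using c by (simp add: ennreal_mult[symmetric] algebra_simps ennreal_plus[symmetric] del: ennreal_plus)
  qed
  finally show ?thesis by (simp add: c_def)
qed

lemma weighted_frac_int_le:
  fixes f :: "'n heis \<Rightarrow> complex"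
  assumes f: "f \<in> Lp_space p" and e: "e > 0"
  shows "integrable lborel (\<lambda>u. heis_weight u * norm (frac_int lam f u))"
    "(LINT u|lborel. heis_weight u * norm (frac_int lam f u)) \<le>
      (LINT u|lborel. heis_weight u * norm (trunc_int lam e f u)) + err_const * e powr (Q - lam) * (weight_mass + Lp_mass p f)"
    "integrable lborel (\<lambda>u. heis_weight u * norm (trunc_int lam e f u))"
proof -
  note [measurable] = Lp_space_measurable[OF f(1)]
  define c where "c = err_const * e powr (Q - lam) * (weight_mass + Lp_mass p f)"
  have "weight_mass \<ge> 0" unfolding weight_mass_def
      using heis_weight(1) by (intro Bochner_Integration.integral_nonneg) (auto intro: less_imp_le)
  then have c: "c \<ge> 0" using err_const_pos by (simp add: c_def)
  have w0: "heis_weight u \<ge> 0" for u :: "'n heis" using heis_weight(1)[of u] by simp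
  show tr: "integrable lborel (\<lambda>u. heis_weight u * norm (trunc_int lam e f u))"
  proof (rule Bochner_Integration.integrable_bound)
    show "integrable lborel (\<lambda>u::'n heis. heis_weight u * (Lp_mass p f + trunc_const e))"
      using heis_weight(3) by (rule integrable_mult_left)
    show "AE u in lborel. norm (heis_weight u * norm (trunc_int lam e f u)) \<le> norm (heis_weight u * (Lp_mass p f + trunc_const e))"
    proof (rule AE_I2)
      fix u
      show "norm (heis_weight u * norm (trunc_int lam e f u)) \<le> norm (heis_weight u * (Lp_mass p f + trunc_const e))"
        using norm_trunc_int_le[OF f e, of u] w0[of u] by (simp add: abs_mult mult_left_mono)
    qed
  qed measurable
  have "(\<integral>\<^sup>+u. ennreal (heis_weight u * norm (frac_int lam f u)) \<partial>lborel) \<le>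
    (\<integral>\<^sup>+u. ennreal (heis_weight u * norm (trunc_int lam e f u)) +
      ennreal (heis_weight u) * (\<integral>\<^sup>+v. ennreal (norm (f v) * trunc_err e u v) \<partial>lborel) \<partial>lborel)"
  proof (rule nn_integral_mono)
    fix u
    have "ennreal (heis_weight u) * ennreal (norm (frac_int lam f u)) \<le>
      ennreal (heis_weight u) * (ennreal (norm (trunc_int lam e f u)) + (\<integral>\<^sup>+v. ennreal (norm (f v) * trunc_err e u v) \<partial>lborel))"
      by (intro mult_left_mono norm_frac_int_le_trunc[OF f e]) simp
    then show "ennreal (heis_weight u * norm (frac_int lam f u)) \<le> ennreal (heis_weight u * norm (trunc_int lam e f u)) +
      ennreal (heis_weight u) * (\<integral>\<^sup>+v. ennreal (norm (f v) * trunc_err e u v) \<partial>lborel)"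
      using w0[of u] by (simp add: ennreal_mult distrib_left)
  qed
  also have "\<dots> = (\<integral>\<^sup>+u. ennreal (heis_weight u * norm (trunc_int lam e f u)) \<partial>lborel) +
      (\<integral>\<^sup>+u. ennreal (heis_weight u) * (\<integral>\<^sup>+v. ennreal (norm (f v) * trunc_err e u v) \<partial>lborel) \<partial>lborel)"
    by (rule nn_integral_add) measurable
  also have "\<dots> \<le> ennreal (LINT u|lborel. heis_weight u * norm (trunc_int lam e f u)) + ennreal c"
    unfolding c_def using nn_integral_weight_err[OF f e] w0
    by (intro add_mono) (auto simp: nn_integral_eq_integral[OF tr])
  also have "\<dots> = ennreal ((LINT u|lborel. heis_weight u * norm (trunc_int lam e f u)) + c)"
    using c w0 by (subst ennreal_plus) (auto intro!: Bochner_Integration.integral_nonneg)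
  finally have le: "(\<integral>\<^sup>+u. ennreal (heis_weight u * norm (frac_int lam f u)) \<partial>lborel) \<le>
    ennreal ((LINT u|lborel. heis_weight u * norm (trunc_int lam e f u)) + c)" .
  show int: "integrable lborel (\<lambda>u. heis_weight u * norm (frac_int lam f u))"
    using le w0 by (intro integrableI_bounded) (auto simp: le_less_trans)
  have "ennreal (LINT u|lborel. heis_weight u * norm (frac_int lam f u)) \<le>
      ennreal ((LINT u|lborel. heis_weight u * norm (trunc_int lam e f u)) + c)"
    using le w0 by (subst (asm) nn_integral_eq_integral[OF int]) auto
  then show "(LINT u|lborel. heis_weight u * norm (frac_int lam f u)) \<le>
      (LINT u|lborel. heis_weight u * norm (trunc_int lam e f u)) + err_const * e powr (Q - lam) * (weight_mass + Lp_mass p f)"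
    unfolding c_def[symmetric] using c w0
    by (subst (asm) ennreal_le_iff) (auto intro!: add_nonneg_nonneg Bochner_Integration.integral_nonneg)
qed

end

section \<open>Compactness of truncated and full potentials\<close>

context hls_exponents
begin

text \<open>First the truncation level is fixed so that the error is below \<open>r / 2\<close> for
  all \<open>j\<close> at once; then the truncated potentials vanish in the limit by dominated
  convergence, with the uniform bound times the weight as the dominating function.\<close>

lemma weighted_frac_int_tendsto_0:
  fixes f :: "nat \<Rightarrow> 'n heis \<Rightarrow> complex"
  assumes f: "\<And>j. f j \<in> Lp_space p" "\<And>j. Lp_mass p (f j) \<le> B"
    and lim: "\<And>m u. (\<lambda>j. trunc_int lam (1 / real (Suc m)) (f j) u) \<longlonglongrightarrow> 0"
  shows "(\<lambda>j. LINT u|lborel. heis_weight u * norm (frac_int lam (f j) u)) \<longlonglongrightarrow> 0"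
proof (rule LIMSEQ_I)
  fix r :: real assume r: "r > 0"
  have [measurable]: "f j \<in> borel_measurable borel" for j using f by (simp add: Lp_space_iff)
  have w0: "heis_weight u \<ge> 0" for u :: "'n heis" using heis_weight(1)[of u] by simp
  have "(\<lambda>m. err_const * (1 / real (Suc m)) powr (Q - lam) * (weight_mass + B)) \<longlonglongrightarrow> err_const * 0 powr (Q - lam) * (weight_mass + B)"
    using lam_less by (intro tendsto_intros tendsto_powr' LIMSEQ_Suc[OF lim_1_over_n]) auto
  then have "eventually (\<lambda>m. err_const * (1 / real (Suc m)) powr (Q - lam) * (weight_mass + B) < r / 2) sequentially"
    using r by (intro order_tendstoD(2)) auto
  then obtain m where m: "err_const * (1 / real (Suc m)) powr (Q - lam) * (weight_mass + B) < r / 2"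
    by (auto simp: eventually_sequentially)
  define e where "e = 1 / real (Suc m)"
  have e: "e > 0" by (simp add: e_def)
  have "(\<lambda>j. LINT u|lborel. heis_weight u * norm (trunc_int lam e (f j) u)) \<longlonglongrightarrow> (LINT (u::'n heis)|lborel. 0)"
  proof (rule integral_dominated_convergence)
    show "integrable lborel (\<lambda>u::'n heis. heis_weight u * (B + trunc_const e))"
      using heis_weight(3) by (rule integrable_mult_left)
    show "AE u in lborel. (\<lambda>j. heis_weight u * norm (trunc_int lam e (f j) u)) \<longlonglongrightarrow> 0"
      using lim unfolding e_def by (intro AE_I2 tendsto_mult_right_zero tendsto_norm_zero)
    show "AE u in lborel. norm (heis_weight u * norm (trunc_int lam e (f j) u)) \<le> heis_weight u * (B + trunc_const e)" for j
    proof (rule AE_I2)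
      fix u
      have "norm (trunc_int lam e (f j) u) \<le> B + trunc_const e"
        using norm_trunc_int_le[OF f(1)[of j] e, of u] f(2)[of j] by linarith
      then show "norm (heis_weight u * norm (trunc_int lam e (f j) u)) \<le> heis_weight u * (B + trunc_const e)"
        using w0[of u] by (simp add: abs_mult mult_left_mono)
    qed
  qed measurable
  then have "eventually (\<lambda>j. (LINT u|lborel. heis_weight u * norm (trunc_int lam e (f j) u)) < r / 2) sequentially"
    using r by (intro order_tendstoD(2)[where a="r / 2"]) auto
  then obtain N where N: "\<And>j. j \<ge> N \<Longrightarrow> (LINT u|lborel. heis_weight u * norm (trunc_int lam e (f j) u)) < r / 2"
    unfolding eventually_sequentially by blast
  have "norm ((LINT u|lborel. heis_weight u * norm (frac_int lam (f j) u)) - 0) < r" if "j \<ge> N" for j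
  proof -
    have "err_const * e powr (Q - lam) * (weight_mass + Lp_mass p (f j)) \<le> err_const * e powr (Q - lam) * (weight_mass + B)"
      using f(2)[of j] err_const_pos by (intro mult_left_mono) auto
    then have "(LINT u|lborel. heis_weight u * norm (frac_int lam (f j) u)) < r"
      using weighted_frac_int_le(2)[OF f(1)[of j] e] N[OF that] m unfolding e_def by linarith
    moreover have "(LINT u|lborel. heis_weight u * norm (frac_int lam (f j) u)) \<ge> 0"
      using w0 by (intro Bochner_Integration.integral_nonneg) auto
    ultimately show ?thesis by simp
  qed
  then show "\<exists>N. \<forall>j\<ge>N. norm ((LINT u|lborel. heis_weight u * norm (frac_int lam (f j) u)) - 0) < r" by blast
qed

lemma trunc_int_diff:
  fixes f g :: "'n heis \<Rightarrow> complex"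
  assumes "f \<in> Lp_space p" "g \<in> Lp_space p" "e > 0"
  shows "trunc_int lam e (\<lambda>v. f v - g v) u = trunc_int lam e f u - trunc_int lam e g u"
  unfolding trunc_int_def right_diff_distrib using assms
  by (intro Bochner_Integration.integral_diff integrable_trunc)

text \<open>Identifies the limit of the potentials. The capped kernel is an L^p' test function, so
  the truncated potentials of \<open>f j - g\<close> tend to zero at every point; this gives
  weighted L^1 convergence of the full ones, and a subsequence converges almost everywhere.\<close>

lemma frac_int_AE_subseq:
  fixes f :: "nat \<Rightarrow> 'n heis \<Rightarrow> complex"
  assumes f: "\<And>j. f j \<in> Lp_space p" "\<And>j. Lp_mass p (f j) \<le> B" and [measurable]: "g \<in> borel_measurable borel"
    and lim: "AE x in lborel. (\<lambda>j. f j x) \<longlonglongrightarrow> g x"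
  shows "\<exists>r. strict_mono r \<and> (AE u in lborel. (\<lambda>j. frac_int lam (f (r j)) u) \<longlonglongrightarrow> frac_int lam g u)"
proof -
  have p: "p > 0" using p_gt1 by simp
  have [measurable]: "f j \<in> borel_measurable borel" for j using f by (simp add: Lp_space_iff)
  have g: "g \<in> Lp_space p" "Lp_mass p g \<le> B" using Fatou_Lp[OF f _ lim p] by auto
  define h where "h j x = f j x - g x" for j x
  have h: "h j \<in> Lp_space p" "Lp_mass p (h j) \<le> 2 powr p * (B + B)" for j
  proof -
    show "h j \<in> Lp_space p" unfolding h_def using Lp_space_diff[OF f(1) g(1) p] by auto
    have "2 powr p * (Lp_mass p (f j) + Lp_mass p g) \<le> 2 powr p * (B + B)"
      by (intro mult_left_mono add_mono f g) auto
    then show "Lp_mass p (h j) \<le> 2 powr p * (B + B)" 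
      unfolding h_def using Lp_space_diff(2)[OF f(1) g(1) p, of j] by linarith
  qed
  then have [measurable]: "h j \<in> borel_measurable borel" for j by (simp add: Lp_space_iff)
  have tr: "(\<lambda>j. trunc_int lam (1 / real (Suc m)) (h j) u) \<longlonglongrightarrow> 0" for m u
  proof -
    define e where "e = 1 / real (Suc m)"
    have e: "e > 0" by (simp add: e_def)
    have 1: "(\<lambda>j. LINT v|lborel. \<bar>trunc_kernel e u v\<bar> * norm (f j v - g v)) \<longlonglongrightarrow> 0"
    proof (rule conj.weak_convergence_of_AE[OF f _ lim])
      show "integrable lborel (\<lambda>v. \<bar>trunc_kernel e u v\<bar> powr p')"
        using integrable_max_heis_dist(1)[OF lam_conj e, of u] by (simp add: trunc_powr del: times_divide_eq_right)
    qed measurable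
    have 2: "norm (trunc_int lam e (h j) u) \<le> (LINT v|lborel. \<bar>trunc_kernel e u v\<bar> * norm (f j v - g v))" for j
      using integral_norm_bound[of lborel "\<lambda>v. of_real (trunc_kernel e u v) * h j v"]
      by (simp add: trunc_int_def norm_mult h_def)
    show ?thesis unfolding e_def[symmetric]
      by (rule Lim_null_comparison[OF always_eventually 1]) (rule allI, rule 2)
  qed
  have w0: "heis_weight u \<ge> 0" for u :: "'n heis" using heis_weight(1)[of u] by simp
  have "\<exists>r. strict_mono r \<and> (AE u in lborel. (\<lambda>j. heis_weight u * norm (frac_int lam (h (r j)) u)) \<longlonglongrightarrow> 0)"
  proof (rule tendsto_L1_AE_subseq)
    show "integrable lborel (\<lambda>u. heis_weight u * norm (frac_int lam (h j) u))" for j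
      by (rule weighted_frac_int_le(1)[OF h(1) zero_less_one])
    show "(\<lambda>j. LINT u|lborel. norm (heis_weight u * norm (frac_int lam (h j) u))) \<longlonglongrightarrow> 0"
      using weighted_frac_int_tendsto_0[OF h tr] w0 by (simp add: abs_mult)
  qed
  then obtain r where r: "strict_mono r" "AE u in lborel. (\<lambda>j. heis_weight u * norm (frac_int lam (h (r j)) u)) \<longlonglongrightarrow> 0" by blast
  have "AE u in lborel. \<forall>j. frac_int lam (h j) u = frac_int lam (f j) u - frac_int lam g u"
    unfolding AE_all_countable h_def using frac_int_diff_AE[OF f(1) g(1)] by simp
  with r(2) have "AE u in lborel. (\<lambda>j. frac_int lam (f (r j)) u) \<longlonglongrightarrow> frac_int lam g u"
  proof eventually_elim
    case (elim u)
    have "(\<lambda>j. (1 / heis_weight u) * (heis_weight u * norm (frac_int lam (h (r j)) u))) \<longlonglongrightarrow> (1 / heis_weight u) * 0"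
      using elim(1) by (intro tendsto_mult_left)
    then have "(\<lambda>j. norm (frac_int lam (f (r j)) u - frac_int lam g u)) \<longlonglongrightarrow> 0"
      using elim(2) heis_weight(1)[of u] by simp
    then show ?case by (simp add: tendsto_norm_zero_iff LIM_zero_iff)
  qed
  then show ?thesis using r(1) by blast
qed

text \<open>Dominated convergence in L^p'; the cap provides the domination.\<close>

lemma trunc_kernel_continuous:
  fixes x :: "nat \<Rightarrow> 'n heis"
  assumes x: "x \<longlonglongrightarrow> u" and e: "e > 0"
  shows "(\<lambda>i. LINT v|lborel. kernel_diff e (x i) u v powr p') \<longlonglongrightarrow> 0"
proof -
  have cont: "(\<lambda>i. heis_dist (x i) v) \<longlonglongrightarrow> heis_dist u v" for v
  proof -
    have "continuous_on UNIV (\<lambda>y :: 'n heis. heis_dist y v)" by (intro continuous_intros)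
    then have "isCont (\<lambda>y :: 'n heis. heis_dist y v) u"
      using continuous_on_eq_continuous_at[OF open_UNIV] by blast
    then show ?thesis using x by (rule isCont_tendsto_compose)
  qed
  have "eventually (\<lambda>i. heis_dist (x i) u < e) sequentially"
    using cont[of u] e by (intro order_tendstoD(2)[where a=e]) auto
  then obtain N where N: "\<And>i. i \<ge> N \<Longrightarrow> heis_dist (x i) u < e"
    unfolding eventually_sequentially by blast
  have le: "trunc_kernel e (x (i + N)) v \<le> 2 powr lam * trunc_kernel e u v" for i v
  proof -
    have "heis_dist u v \<le> heis_dist (x (i + N)) u + heis_dist (x (i + N)) v"
      using heis_dist_triangle[of u v "x (i + N)"] by (simp add: heis_dist_commute[of u])
    \<comment> \<open>Once the moved center is within \<open>e\<close> of \<open>u\<close>, the cap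
      absorbs the displacement: the capped distances differ at most by a factor 2, and the moved
      kernel is dominated by a multiple of the fixed one.\<close>
    then have "max e (heis_dist u v) / 2 \<le> max e (heis_dist (x (i + N)) v)"
      using N[of "i + N"] e by (auto simp: max_def)
    then have "trunc_kernel e (x (i + N)) v \<le> (max e (heis_dist u v) / 2) powr - lam"
      using lam_pos e by (intro powr_mono2') auto
    also have "\<dots> = 2 powr lam * trunc_kernel e u v"
      using e by (simp add: powr_divide powr_minus_divide)
    finally show ?thesis .
  qed
  have "(\<lambda>i. LINT v|lborel. kernel_diff e (x (i + N)) u v powr p') \<longlonglongrightarrow> (LINT (v::'n heis)|lborel. 0)"
  proof (rule integral_dominated_convergence)
    show "integrable lborel (\<lambda>v. (2 powr lam + 1) powr p' * max e (heis_dist u v) powr - (lam * p'))"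
      using integrable_max_heis_dist(1)[OF lam_conj e, of u] by (rule integrable_mult_right)
    show "AE v in lborel. (\<lambda>i. kernel_diff e (x (i + N)) u v powr p') \<longlonglongrightarrow> 0"
    proof (rule AE_I2)
      fix v
      have "(\<lambda>i. kernel_diff e (x (i + N)) u v powr p')
        \<longlonglongrightarrow> kernel_diff e u u v powr p'"
        using e p_gt1 conj.p'_gt LIMSEQ_ignore_initial_segment[OF cont[of v], of N]
        by (intro tendsto_powr' tendsto_rabs tendsto_diff tendsto_powr tendsto_max tendsto_const) auto
      then show "(\<lambda>i. kernel_diff e (x (i + N)) u v powr p') \<longlonglongrightarrow> 0"
        by simp
    qed
    show "AE v in lborel. norm (kernel_diff e (x (i + N)) u v powr p')
      \<le> (2 powr lam + 1) powr p' * max e (heis_dist u v) powr - (lam * p')" for i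
    proof (rule AE_I2)
      fix v
      have "kernel_diff e (x (i + N)) u v \<le> (2 powr lam + 1) * trunc_kernel e u v"
        using le[of i v] powr_ge_zero[of "max e (heis_dist (x (i + N)) v)" "- lam"] powr_ge_zero[of "max e (heis_dist u v)" "- lam"]
        unfolding distrib_right mult_1 by linarith
      then have "kernel_diff e (x (i + N)) u v powr p'
        \<le> ((2 powr lam + 1) * trunc_kernel e u v) powr p'"
        using conj.p'_gt by (intro powr_mono2) auto
      then show "norm (kernel_diff e (x (i + N)) u v powr p')
      \<le> (2 powr lam + 1) powr p' * max e (heis_dist u v) powr - (lam * p')"
        by (simp only: powr_mult trunc_powr real_norm_def abs_of_nonneg powr_ge_zero)
    qed
  qed measurable
  then show ?thesis
    using LIMSEQ_offset[where k=N and a=0 and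
        f="\<lambda>i. LINT v|lborel. kernel_diff e (x i) u v powr p'"]
    by simp
qed

text \<open>An equicontinuity estimate: \<open>f\<close> enters only through its mass, and the free
  parameter \<open>d\<close> trades this term against the modulus of continuity of the
  kernel.\<close>

lemma trunc_int_dist_le:
  fixes f :: "'n heis \<Rightarrow> complex"
  assumes f: "f \<in> Lp_space p" and e: "e > 0" and d: "d > 0"
  shows "norm (trunc_int lam e f u - trunc_int lam e f u') \<le> d * Lp_mass p f + d powr (- p' / p) *
    (LINT v|lborel. kernel_diff e u' u v powr p')"
proof -
  note [measurable] = Lp_space_measurable[OF f(1)]
  define D where "D v = kernel_diff e u' u v" for v
  have [measurable]: "D \<in> borel_measurable borel" unfolding D_def by measurable
  have p'1: "p' > 0" using conj.p'_gt by simp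
  have iD: "integrable lborel (\<lambda>v. D v powr p')"
  proof (rule Bochner_Integration.integrable_bound)
    show "integrable lborel (\<lambda>v. 2 powr p' * (max e (heis_dist u' v) powr - (lam * p') + max e (heis_dist u v) powr - (lam * p')))"
      using integrable_max_heis_dist(1)[OF lam_conj e] by (intro integrable_mult_right Bochner_Integration.integrable_add)
    show "AE v in lborel. norm (D v powr p') \<le> norm (2 powr p' * (max e (heis_dist u' v) powr - (lam * p') + max e (heis_dist u v) powr - (lam * p')))"
    proof (rule AE_I2)
      fix v
      show "norm (D v powr p') \<le> norm (2 powr p' * (max e (heis_dist u' v) powr - (lam * p') + max e (heis_dist u v) powr - (lam * p')))"
        using norm_add_powr_le[OF p'1, of "trunc_kernel e u' v" "- (trunc_kernel e u v)"]
        by (simp add: D_def trunc_powr del: times_divide_eq_right)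
    qed
  qed measurable
  have int: "integrable lborel (\<lambda>v. of_real (trunc_kernel e u v) * f v - of_real (trunc_kernel e u' v) * f v)"
    using integrable_trunc[OF f e] integrable_trunc[OF f e] by (rule Bochner_Integration.integrable_diff)
  have "trunc_int lam e f u - trunc_int lam e f u' =
    (LINT v|lborel. of_real (trunc_kernel e u v) * f v - of_real (trunc_kernel e u' v) * f v)"
    unfolding trunc_int_def using integrable_trunc[OF f e] integrable_trunc[OF f e] by (rule Bochner_Integration.integral_diff[symmetric])
  also have "norm \<dots> \<le> (LINT v|lborel. norm (of_real (trunc_kernel e u v) * f v - of_real (trunc_kernel e u' v) * f v))"
    by (rule integral_norm_bound)
  also have "\<dots> \<le> (LINT v|lborel. d * norm (f v) powr p + d powr (- p' / p) * D v powr p')"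
  proof (rule integral_mono)
    show "integrable lborel (\<lambda>v. norm (of_real (trunc_kernel e u v) * f v - of_real (trunc_kernel e u' v) * f v))"
      using int by (rule integrable_norm)
    show "integrable lborel (\<lambda>v. d * norm (f v) powr p + d powr (- p' / p) * D v powr p')"
      using Lp_space_integrable[OF f] iD by (intro integrable_mult_right Bochner_Integration.integrable_add)
    fix v
    have "norm (of_real (trunc_kernel e u v) * f v - of_real (trunc_kernel e u' v) * f v) = norm (f v) * D v"
      unfolding left_diff_distrib[symmetric] of_real_diff[symmetric] norm_mult norm_of_real D_def by (simp add: mult.commute abs_minus_commute)
    also have "\<dots> \<le> d * norm (f v) powr p + d powr (- p' / p) * D v powr p'"
      using d by (intro conj.mult_le_eps) (auto simp: D_def)
    finally show "norm (of_real (trunc_kernel e u v) * f v - of_real (trunc_kernel e u' v) * f v) \<le> d * norm (f v) powr p + d powr (- p' / p) * D v powr p'" .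
  qed
  also have "\<dots> = d * Lp_mass p f + d powr (- p' / p) * (LINT v|lborel. D v powr p')"
    unfolding Lp_mass_def using Lp_space_integrable[OF f] iD
    by (subst Bochner_Integration.integral_add) auto
  finally show ?thesis unfolding D_def .
qed

text \<open>An Arzela-Ascoli argument that takes the place of weak compactness: a diagonal sequence
  converges for all truncation levels on a countable dense set of points, and equicontinuity extends
  this to every point.\<close>

lemma trunc_int_convergent_subseq:
  fixes f :: "nat \<Rightarrow> 'n heis \<Rightarrow> complex"
  assumes f: "\<And>j. f j \<in> Lp_space p" "\<And>j. Lp_mass p (f j) \<le> B"
  shows "\<exists>r. strict_mono r \<and> (\<forall>m u. convergent (\<lambda>j. trunc_int lam (1 / real (Suc m)) (f (r j)) u))"
proof -
  obtain D :: "'n heis set" where D: "countable D" "\<And>X. open X \<Longrightarrow> X \<noteq> {} \<Longrightarrow> \<exists>d\<in>D. d \<in> X"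
    using countable_dense_setE by blast
  define E where "E = (UNIV :: nat set) \<times> D"
  have E: "countable E" "E \<noteq> {}" using D(1) D(2)[of UNIV] by (auto simp: E_def)
  define x where "x n j = (case from_nat_into E n of (m, u) \<Rightarrow> trunc_int lam (1 / real (Suc m)) (f j) u)" for n j
  define P where "P n r \<longleftrightarrow> convergent (\<lambda>j. x n (r j))" for n and r :: "nat \<Rightarrow> nat"
  interpret subseqs P
  proof
    fix n and s :: "nat \<Rightarrow> nat" assume "strict_mono s"
    obtain m u where mu: "from_nat_into E n = (m, u)" by (cases "from_nat_into E n")
    have "norm (x n j) \<le> B + trunc_const (1 / real (Suc m))" for j
      using norm_trunc_int_le[OF f(1)[of j], of "1 / real (Suc m)" u] f(2)[of j] by (simp add: x_def mu)
    then have "bounded (range (\<lambda>j. x n (s j)))" by (auto simp: bounded_iff)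
    from bounded_imp_convergent_subsequence[OF this] obtain l t where "strict_mono t" "((\<lambda>j. x n (s j)) \<circ> t) \<longlonglongrightarrow> l"
      by blast
    then show "\<exists>r'. strict_mono r' \<and> P n (s \<circ> r')"
      by (auto simp: P_def convergent_def o_def)
  qed
  have conv: "convergent (\<lambda>j. x n (diagseq j))" for n
  proof -
    \<comment> \<open>The diagonal sequence is guaranteed to be a subsequence of the extraction for
      \<open>n\<close> only from index \<open>Suc n\<close> on; the shift is removed
      afterwards.\<close>
    have "P n (diagseq \<circ> ((+) (Suc n)))"
    proof (rule diagseq_holds)
      fix r s :: "nat \<Rightarrow> nat" and k assume "strict_mono r" "P k s"
      then obtain l where "(\<lambda>j. x k (s j)) \<longlonglongrightarrow> l" by (auto simp: P_def convergent_def)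
      from LIMSEQ_subseq_LIMSEQ[OF this \<open>strict_mono r\<close>] show "P k (s \<circ> r)"
        by (auto simp: P_def convergent_def o_def)
    qed
    then obtain l where "(\<lambda>j. x n (diagseq (j + Suc n))) \<longlonglongrightarrow> l"
      by (auto simp: P_def convergent_def o_def add.commute)
    from LIMSEQ_offset[where f="\<lambda>j. x n (diagseq j)", OF this] show ?thesis by (auto simp: convergent_def)
  qed
  have convD: "convergent (\<lambda>j. trunc_int lam (1 / real (Suc m)) (f (diagseq j)) u)" if u: "u \<in> D" for m u
  proof -
    obtain n where "from_nat_into E n = (m, u)"
      using from_nat_into_surj[OF E(1), of "(m, u)"] u by (auto simp: E_def)
    then show ?thesis using conv[of n] by (simp add: x_def)
  qed
  have B: "B \<ge> 0" using f(2)[of 0] Lp_mass_nonneg[of p "f 0"] by linarith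
  have "convergent (\<lambda>j. trunc_int lam (1 / real (Suc m)) (f (diagseq j)) u)" for m u
  proof -
    define e where "e = 1 / real (Suc m)"
    have e: "e > 0" by (simp add: e_def)
    define t where "t j = trunc_int lam e (f (diagseq j))" for j
    have "u \<in> closure D"
      using D(2) by (subst closure_iff_nhds_not_empty) (metis UNIV_I disjoint_iff empty_iff subsetD)
    then obtain y where y: "\<And>i. y i \<in> D" "y \<longlonglongrightarrow> u" unfolding closure_sequential by blast
    have "Cauchy (\<lambda>j. t j u)"
    proof (rule metric_CauchyI)
      fix \<epsilon> :: real assume \<epsilon>: "\<epsilon> > 0"
      \<comment> \<open>Makes the mass term at most \<open>\<epsilon> / 8\<close>; the
        \<open>B + 1\<close> guards against \<open>B = 0\<close>.\<close>
      define d where "d = \<epsilon> / (8 * (B + 1))"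
      have d: "d > 0" using \<epsilon> B by (simp add: d_def)
      have "d * B = \<epsilon> / 8 * (B / (B + 1))" by (simp add: d_def)
      also have "\<dots> \<le> \<epsilon> / 8 * 1" using \<epsilon> B by (intro mult_left_mono) auto
      finally have dB: "d * B \<le> \<epsilon> / 8" by simp
      have "(\<lambda>i. d powr (- p' / p) * (LINT v|lborel. kernel_diff e (y i) u v powr p'))
        \<longlonglongrightarrow> d powr (- p' / p) * 0"
        by (intro tendsto_mult_left trunc_kernel_continuous y e)
      then have "eventually (\<lambda>i. d powr (- p' / p) * (LINT v|lborel. kernel_diff e (y i) u v powr p') < \<epsilon> / 8) sequentially"
        using \<epsilon> by (intro order_tendstoD(2)[where a="\<epsilon> / 8"]) auto
      then obtain i where i: "d powr (- p' / p) * (LINT v|lborel. kernel_diff e (y i) u v powr p') < \<epsilon> / 8"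
        by (auto simp: eventually_sequentially)
      have close: "norm (t j u - t j (y i)) < \<epsilon> / 4" for j
      proof -
        have "d * Lp_mass p (f (diagseq j)) \<le> d * B" using d f(2) by (intro mult_left_mono) auto
        then show ?thesis
          using trunc_int_dist_le[OF f(1) e d, of "diagseq j" u "y i"] i dB unfolding t_def by linarith
      qed
      have "Cauchy (\<lambda>j. t j (y i))"
        unfolding t_def e_def by (rule convergent_Cauchy[OF convD[OF y(1)]])
      then obtain M where M: "\<And>j k. j \<ge> M \<Longrightarrow> k \<ge> M \<Longrightarrow> dist (t j (y i)) (t k (y i)) < \<epsilon> / 4"
        using \<epsilon> metric_CauchyD[of "\<lambda>j. t j (y i)" "\<epsilon> / 4"] by auto
      show "\<exists>M. \<forall>j\<ge>M. \<forall>k\<ge>M. dist (t j u) (t k u) < \<epsilon>"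
      proof (intro exI allI impI)
        fix j k assume "j \<ge> M" "k \<ge> M"
        have "dist (t j u) (t k u) \<le> dist (t j u) (t j (y i)) + dist (t j (y i)) (t k (y i)) + dist (t k (y i)) (t k u)"
          by (smt (verit) dist_triangle)
        also have "\<dots> < \<epsilon> / 4 + \<epsilon> / 4 + \<epsilon> / 4"
          using close[of j] close[of k] M[OF \<open>j \<ge> M\<close> \<open>k \<ge> M\<close>] by (simp add: dist_norm norm_minus_commute)
        finally show "dist (t j u) (t k u) < \<epsilon>" using \<epsilon> by simp
      qed
    qed
    then show ?thesis by (simp add: t_def e_def Cauchy_convergent_iff)
  qed
  then show ?thesis using subseq_diagseq by blast
qed

text \<open>No limit function is at hand, so the weighted potentials are shown to be Cauchy in L^1.
  If they were not, differences with both indices going to infinity would stay large, although their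
  truncated potentials tend to zero at every point; this contradicts
  \<open>weighted_frac_int_tendsto_0\<close>.\<close>

lemma frac_int_AE_convergent_subseq:
  fixes f :: "nat \<Rightarrow> 'n heis \<Rightarrow> complex"
  assumes f: "\<And>j. f j \<in> Lp_space p" "\<And>j. Lp_mass p (f j) \<le> B"
  shows "\<exists>r. strict_mono r \<and> (AE u in lborel. convergent (\<lambda>j. frac_int lam (f (r j)) u))"
proof -
  have p: "p > 0" using p_gt1 by simp
  obtain r where r: "strict_mono r"
    "\<And>m u. convergent (\<lambda>j. trunc_int lam (1 / real (Suc m)) (f (r j)) u)"
    using trunc_int_convergent_subseq[of f B] f by blast
  define g where "g j = f (r j)" for j
  have g: "g j \<in> Lp_space p" "Lp_mass p (g j) \<le> B" for j using f by (simp_all add: g_def)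
  have [measurable]: "g j \<in> borel_measurable borel" for j using g by (simp add: Lp_space_iff)
  have w0: "heis_weight u \<ge> 0" for u :: "'n heis" using heis_weight(1)[of u] by simp
  define s where "s j u = of_real (heis_weight u) * frac_int lam (g j) u" for j u
  have norm_s: "norm (s i u - s j u) = heis_weight u * norm (frac_int lam (g i) u - frac_int lam (g j) u)" for i j u
    using w0[of u] by (simp add: s_def norm_mult right_diff_distrib[symmetric])
  have int: "integrable lborel (s j)" for j
  proof (rule Bochner_Integration.integrable_bound[OF weighted_frac_int_le(1)[OF g(1)[of j] zero_less_one]])
    show "s j \<in> borel_measurable lborel" unfolding s_def by measurable
  qed (auto simp: s_def norm_mult)
  have LINT_diff: "(LINT u|lborel. norm (s i u - s j u)) = (LINT u|lborel. heis_weight u * norm (frac_int lam (\<lambda>v. g i v - g j v) u))" for i j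
    unfolding norm_s
  proof (rule integral_cong_AE)
    show "AE u in lborel. heis_weight u * norm (frac_int lam (g i) u - frac_int lam (g j) u) = heis_weight u * norm (frac_int lam (\<lambda>v. g i v - g j v) u)"
      using frac_int_diff_AE[OF g(1)[of i] g(1)[of j]] by eventually_elim simp
  qed measurable
  have cau: "\<exists>N. \<forall>i\<ge>N. \<forall>j\<ge>N. (LINT u|lborel. norm (s i u - s j u)) < e" if e: "e > 0" for e
  proof (rule ccontr)
    assume "\<not> ?thesis"
    then have "\<forall>N. \<exists>i j. i \<ge> N \<and> j \<ge> N \<and> e \<le> (LINT u|lborel. norm (s i u - s j u))"
      by (meson not_le)
    then obtain a b where ab: "\<And>N. a N \<ge> N" "\<And>N. b N \<ge> N" "\<And>N. e \<le> (LINT u|lborel. norm (s (a N) u - s (b N) u))"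
      by metis
    define h where "h N v = g (a N) v - g (b N) v" for N v
    have h: "h j \<in> Lp_space p" "Lp_mass p (h j) \<le> 2 powr p * (B + B)" for j
    proof -
      show "h j \<in> Lp_space p" unfolding h_def using Lp_space_diff[OF g(1) g(1) p] by auto
      have "2 powr p * (Lp_mass p (g (a j)) + Lp_mass p (g (b j))) \<le> 2 powr p * (B + B)"
        by (intro mult_left_mono add_mono g) auto
      then show "Lp_mass p (h j) \<le> 2 powr p * (B + B)" 
        unfolding h_def using Lp_space_diff(2)[OF g(1) g(1) p, of "a j" "b j"] by linarith
    qed
    have "(\<lambda>N. trunc_int lam (1 / real (Suc m)) (h N) u) \<longlonglongrightarrow> 0" for m u
    proof -
      obtain l where l: "(\<lambda>j. trunc_int lam (1 / real (Suc m)) (g j) u) \<longlonglongrightarrow> l"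
        using r(2)[of m u] by (auto simp: convergent_def g_def)
      have "filterlim a at_top sequentially" "filterlim b at_top sequentially"
        using ab by (auto intro!: filterlim_at_top_mono[OF filterlim_ident])
      then have "(\<lambda>N. trunc_int lam (1 / real (Suc m)) (g (a N)) u - trunc_int lam (1 / real (Suc m)) (g (b N)) u) \<longlonglongrightarrow> l - l"
        by (intro tendsto_diff filterlim_compose[OF l])
      then show ?thesis unfolding h_def using trunc_int_diff[OF g(1) g(1), of "1 / real (Suc m)"] by simp
    qed
    from weighted_frac_int_tendsto_0[OF h this]
    have "(\<lambda>N. LINT u|lborel. norm (s (a N) u - s (b N) u)) \<longlonglongrightarrow> 0"
      unfolding LINT_diff h_def .
    then have "eventually (\<lambda>N. (LINT u|lborel. norm (s (a N) u - s (b N) u)) < e) sequentially"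
      using e by (intro order_tendstoD(2)[where a=e]) auto
    then obtain N where "(LINT u|lborel. norm (s (a N) u - s (b N) u)) < e" by (auto simp: eventually_sequentially)
    then show False using ab(3)[of N] by simp
  qed
  obtain t where t: "strict_mono t" "AE u in lborel. Cauchy (\<lambda>i. s (t i) u)"
    by (rule cauchy_L1_AE_cauchy_subseq[of lborel s, OF int cau])
  have "AE u in lborel. convergent (\<lambda>j. frac_int lam (f ((r \<circ> t) j)) u)"
    using t(2)
  proof eventually_elim
    case (elim u)
    then obtain l where "(\<lambda>i. s (t i) u) \<longlonglongrightarrow> l" by (auto simp: Cauchy_convergent_iff convergent_def)
    then have "(\<lambda>i. of_real (1 / heis_weight u) * s (t i) u) \<longlonglongrightarrow> of_real (1 / heis_weight u) * l"
      by (rule tendsto_mult_left)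
    moreover have "of_real (1 / heis_weight u) * s (t i) u = frac_int lam (f ((r \<circ> t) i)) u" for i
      using heis_weight(1)[of u] by (simp add: s_def g_def)
    ultimately show ?case by (auto simp: convergent_def)
  qed
  then show ?thesis using strict_mono_o[OF r(1) t(1)] by blast
qed

end

section \<open>Duality and the sharp constant\<close>

lemma (in conjugate_exponents) p'_inverse_mult: "1 / p' * p' = 1"
  using p'_gt by simp

text \<open>Positive bounds \<open>a\<close> and \<open>b\<close> stand in for the norms, so that
  the normalization before Young's inequality is possible for functions of mass zero too.\<close>

lemma (in conjugate_exponents) Holder_Lp:
  assumes f: "f \<in> Lp_space p" "Lp_mass p f \<le> a powr p" and g: "g \<in> Lp_space p'" "Lp_mass p' g \<le> b powr p'"
    and ab: "a > 0" "b > 0"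
  shows "integrable lborel (\<lambda>x. f x * g x)" "(LINT x|lborel. norm (f x * g x)) \<le> a * b"
proof -
  have [measurable]: "f \<in> borel_measurable borel" "g \<in> borel_measurable borel" using f g by (simp_all add: Lp_space_iff)
  show int: "integrable lborel (\<lambda>x. f x * g x)"
    using integrable_mult_Lp[OF f(1) _ Lp_space_integrable[OF g(1)]] by (simp add: mult.commute)
  have "(LINT x|lborel. norm (f x * g x)) \<le>
      (LINT x|lborel. a * b * (norm (f x) powr p / (p * a powr p) + norm (g x) powr p' / (p' * b powr p')))"
  proof (rule integral_mono)
    show "integrable lborel (\<lambda>x. norm (f x * g x))" using int by (rule integrable_norm)
    show "integrable lborel (\<lambda>x. a * b * (norm (f x) powr p / (p * a powr p) + norm (g x) powr p' / (p' * b powr p')))"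
      using Lp_space_integrable[OF f(1)] Lp_space_integrable[OF g(1)]
      by (intro integrable_mult_right Bochner_Integration.integrable_add integrable_divide)
    fix x
    have "norm (f x) / a * (norm (g x) / b) \<le> (norm (f x) / a) powr p / p + (norm (g x) / b) powr p' / p'"
      using ab by (intro Youngs_inequality[OF p_gt p'_gt conj]) auto
    also have "\<dots> = norm (f x) powr p / (p * a powr p) + norm (g x) powr p' / (p' * b powr p')"
      using ab by (simp add: powr_divide mult.commute)
    finally have "a * b * (norm (f x) / a * (norm (g x) / b)) \<le>
        a * b * (norm (f x) powr p / (p * a powr p) + norm (g x) powr p' / (p' * b powr p'))"
      using ab by (intro mult_left_mono) auto
    then show "norm (f x * g x) \<le> a * b * (norm (f x) powr p / (p * a powr p) + norm (g x) powr p' / (p' * b powr p'))"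
      using ab by (simp add: norm_mult)
  qed
  also have "\<dots> = a * b * (Lp_mass p f / a powr p / p + Lp_mass p' g / b powr p' / p')"
    using Lp_space_integrable[OF f(1)] Lp_space_integrable[OF g(1)] by (simp add: Lp_mass_def mult.commute)
  also have "\<dots> \<le> a * b * (1 / p + 1 / p')"
    using f g ab p_gt p'_gt by (intro mult_left_mono add_mono divide_right_mono) (auto simp: divide_le_eq)
  finally show "(LINT x|lborel. norm (f x * g x)) \<le> a * b" using conj by simp
qed

section \<open>The adjoint operator and its norm\<close>

context hls_exponents
begin

abbreviation "q' \<equiv> q / (q - 1)"

lemma conj_q: "conjugate_exponents q q'"
  using q_gt1 by unfold_locales (auto simp: field_simps)

text \<open>Conjugation replaces each reciprocal by its complement to 1; together with the exchange
  of the two exponents it preserves the difference of the reciprocals.\<close>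

lemma dual_exponents: "hls_exponents TYPE('n) lam q' p' Q"
proof
  show "1 / p' = 1 / q' - (Q - lam) / Q"
    using pq p_gt1 q_gt1 Q_pos by (simp add: field_simps)
qed (use Q_eq lam_pos lam_less p_gt1 q_gt1 in \<open>auto simp: field_simps\<close>)

text \<open>Fubini for a kernel that is symmetric because the distance is. Absolute integrability
  comes from Young's inequality between \<open>norm (g u)\<close> and the potential of
  \<open>f\<close>, which has an integrable q-th power.\<close>

lemma frac_int_symmetric:
  fixes f g :: "'n heis \<Rightarrow> complex"
  assumes f: "f \<in> Lp_space p" and g: "g \<in> Lp_space q'"
  shows "integrable lborel (\<lambda>u. g u * frac_int lam f u)" "integrable lborel (\<lambda>v. f v * frac_int lam g v)"
    "(LINT v|lborel. f v * frac_int lam g v) = (LINT u|lborel. g u * frac_int lam f u)"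
proof -
  interpret cq: conjugate_exponents q q' by (rule conj_q)
  have [measurable]: "f \<in> borel_measurable borel" "g \<in> borel_measurable borel" using f g by (simp_all add: Lp_space_iff)
  define K where "K u v = of_real (heis_dist u v powr - lam) * f v * g u" for u v
  have [measurable]: "case_prod K \<in> borel_measurable (lborel \<Otimes>\<^sub>M lborel)" unfolding K_def by measurable
  have Kf: "(LINT v|lborel. K u v) = g u * frac_int lam f u" for u
    unfolding K_def frac_int_eq by (simp add: mult.commute)
  have Kg: "(LINT u|lborel. K u v) = f v * frac_int lam g v" for v
  proof -
    have "(LINT u|lborel. K u v) = (LINT u|lborel. f v * (of_real (heis_dist v u powr - lam) * g u))"
      unfolding K_def by (simp add: heis_dist_commute[of v] mult_ac)
    then show ?thesis by (simp add: frac_int_eq)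
  qed
  have normK: "(LINT v|lborel. norm (K u v)) = norm (g u) * enn2real (heis_pot lam f u)" for u
  proof -
    have "(LINT v|lborel. norm (K u v)) = (LINT v|lborel. norm (g u) * (norm (f v) * heis_dist u v powr - lam))"
      unfolding K_def by (simp add: norm_mult mult_ac)
    also have "\<dots> = norm (g u) * (LINT v|lborel. norm (f v) * heis_dist u v powr - lam)" by simp
    also have "(LINT v|lborel. norm (f v) * heis_dist u v powr - lam) = enn2real (heis_pot lam f u)"
      unfolding heis_pot_def by (rule integral_eq_nn_integral) auto
    finally show ?thesis .
  qed
  have int: "integrable (lborel \<Otimes>\<^sub>M lborel) (case_prod K)"
  proof (rule lborel_pair.Fubini_integrable)
    have "integrable lborel (\<lambda>u. norm (g u) * enn2real (heis_pot lam f u))"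
    proof (rule Bochner_Integration.integrable_bound)
      show "integrable lborel (\<lambda>u. enn2real (heis_pot lam f u) powr q + norm (g u) powr q')"
        using nn_integral_heis_pot_powr[OF f] Lp_space_integrable[OF g] by (rule Bochner_Integration.integrable_add)
      show "AE u in lborel. norm (norm (g u) * enn2real (heis_pot lam f u)) \<le> norm (enn2real (heis_pot lam f u) powr q + norm (g u) powr q')"
      proof (rule AE_I2)
        fix u
        show "norm (norm (g u) * enn2real (heis_pot lam f u)) \<le> norm (enn2real (heis_pot lam f u) powr q + norm (g u) powr q')"
          using cq.mult_le_powr[of "enn2real (heis_pot lam f u)" "norm (g u)"] by (simp add: abs_mult mult.commute)
      qed
    qed measurable
    then show "integrable lborel (\<lambda>u. LINT v|lborel. norm (case (u, v) of (u, v) \<Rightarrow> K u v))" by (simp add: normK)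
    show "AE u in lborel. integrable lborel (\<lambda>v. case (u, v) of (u, v) \<Rightarrow> K u v)"
      using heis_pot_finite_AE[OF f]
    proof eventually_elim
      case (elim u)
      then show ?case unfolding K_def using integrable_heis_pot[of f lam u] by simp
    qed
  qed measurable
  show "integrable lborel (\<lambda>u. g u * frac_int lam f u)"
    using lborel_pair.integrable_fst[OF int] by (simp add: Kf)
  show "integrable lborel (\<lambda>v. f v * frac_int lam g v)"
    using lborel_pair.integrable_snd[OF int] by (simp add: Kg)
  show "(LINT v|lborel. f v * frac_int lam g v) = (LINT u|lborel. g u * frac_int lam f u)"
    using lborel_pair.Fubini_integral[OF int] by (simp add: Kf Kg)
qed

definition "hls_c = enn2real (HLS_const TYPE('n) p q lam)"

lemma HLS_const_eq: "HLS_const TYPE('n) p q lam = ennreal hls_c"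
  using HLS_const_finite by (simp add: hls_c_def)

lemma hls_c_nonneg: "hls_c \<ge> 0"
  by (simp add: hls_c_def)

text \<open>The supremum over functions of norm one, in homogeneous form. A function of mass zero
  cannot be normalized, but its potential vanishes identically.\<close>

lemma HLS_bound:
  fixes f :: "'n heis \<Rightarrow> complex"
  assumes f: "f \<in> Lp_space p"
  shows "Lp_mass q (frac_int lam f) \<le> hls_c powr q * Lp_mass p f powr (q / p)"
proof (cases "Lp_mass p f = 0")
  case True
  then have ae: "AE u in lborel. f u = 0" using Lp_mass_eq_0_iff[OF f] by simp
  note [measurable] = Lp_space_measurable[OF f(1)]
  have "frac_int lam f u = 0" for u
  proof -
    have "frac_int lam f u = (LINT (v::'n heis)|lborel. 0)"
      unfolding frac_int_eq
    proof (rule integral_cong_AE)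
      show "AE v in lborel. of_real (heis_dist u v powr - lam) * f v = 0" using ae by eventually_elim simp
    qed measurable
    then show ?thesis by simp
  qed
  then show ?thesis by (simp add: Lp_mass_def)
next
  case False
  define a where "a = Lp_mass p f powr (1 / p)"
  have a: "a > 0" using False by (simp add: a_def)
  have ap: "a powr p = Lp_mass p f" "a powr q = Lp_mass p f powr (q / p)"
    using p_gt1 by (simp_all add: a_def powr_powr)
  define g where "g u = of_real (1 / a) * f u" for u
  have g: "g \<in> Lp_space p" "Lp_mass p g = 1"
    using Lp_space_mult[OF f, of "of_real (1 / a)"] a False by (auto simp: g_def[abs_def] powr_divide ap norm_divide)
  then have "Lp_norm p g = 1" using Lp_norm_eq_1_iff[OF g(1)] p_gt1 by simp
  then have "Lp_norm q (frac_int lam g) \<le> HLS_const TYPE('n) p q lam"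
    unfolding HLS_const_def using g(1) by (intro Sup_upper) blast
  then have "Lp_mass q (frac_int lam g) powr (1 / q) \<le> hls_c"
    unfolding HLS_const_eq Lp_norm_eq[OF frac_int_Lq[OF g(1)]] by (simp add: hls_c_nonneg)
  then have "(Lp_mass q (frac_int lam g) powr (1 / q)) powr q \<le> hls_c powr q"
    using q_gt1 by (intro powr_mono2) auto
  then have 1: "Lp_mass q (frac_int lam g) \<le> hls_c powr q" using q_gt1 by (simp add: powr_powr)
  have "f = (\<lambda>u. of_real a * g u)" using a by (auto simp: g_def)
  then have "frac_int lam f = (\<lambda>u. of_real a * frac_int lam g u)" by (auto simp: frac_int_mult)
  then have "Lp_mass q (frac_int lam f) = a powr q * Lp_mass q (frac_int lam g)"
    using Lp_space_mult(2)[OF frac_int_Lq[OF g(1)], of "of_real a"] a by simp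
  also have "\<dots> \<le> a powr q * hls_c powr q" using 1 by (intro mult_left_mono) auto
  finally show ?thesis by (simp add: ap mult.commute)
qed

text \<open>The test function is the indicator of the unit ball. At a point of finite potential, a
  zero integral of a kernel that is positive off one point would make the ball a null set.\<close>

lemma hls_c_pos: "hls_c > 0"
proof -
  let ?B = "{v :: 'n heis. heis_norm v < 1}"
  have [measurable]: "?B \<in> sets borel" by measurable
  define f :: "'n heis \<Rightarrow> complex" where "f v = of_real (indicator ?B v)" for v
  have [measurable]: "f \<in> borel_measurable borel" unfolding f_def by measurable
  have f: "f \<in> Lp_space p"
  proof (rule Lp_spaceI_nn(1))
    have "(\<integral>\<^sup>+ u. ennreal (norm (f u) powr p) \<partial>lborel) = (\<integral>\<^sup>+ u. indicator ?B u \<partial>lborel)"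
      using p_gt1 by (intro nn_integral_cong) (simp add: f_def indicator_def)
    also have "\<dots> = ennreal (heis_vol TYPE('n))" by (simp add: heis_vol)
    finally show "(\<integral>\<^sup>+ u. ennreal (norm (f u) powr p) \<partial>lborel) \<le> ennreal (heis_vol TYPE('n))" by simp
  qed (use heis_vol(1)[where 'n='n] in auto)
  have "Lp_mass q (frac_int lam f) \<noteq> 0"
  proof
    assume "Lp_mass q (frac_int lam f) = 0"
    then have "AE u in lborel. frac_int lam f u = 0" using Lp_mass_eq_0_iff[OF frac_int_Lq[OF f]] by simp
    with heis_pot_finite_AE[OF f] have "AE u in lborel. heis_pot lam f u < \<infinity> \<and> frac_int lam f u = 0"
      by eventually_elim auto
    then obtain u where u: "heis_pot lam f u < \<infinity>" "frac_int lam f u = 0"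
    proof (rule AE_E)
      fix N assume N: "{x \<in> space lborel. \<not> (heis_pot lam f x < \<infinity> \<and> frac_int lam f x = 0)} \<subseteq> N" "emeasure lborel N = 0" "N \<in> sets lborel"
      have "N \<noteq> UNIV" using N(2) by auto
      then show thesis using N(1) that by auto
    qed
    have int: "integrable lborel (\<lambda>v. heis_dist u v powr - lam * indicator ?B v)"
      using integrable_norm[OF integrable_heis_pot[OF _ u(1)]] by (simp add: f_def norm_mult)
    have "frac_int lam f u = of_real (LINT v|lborel. heis_dist u v powr - lam * indicator ?B v)"
      unfolding frac_int_eq f_def of_real_mult[symmetric] by (rule integral_complex_of_real)
    then have "(LINT v|lborel. heis_dist u v powr - lam * indicator ?B v) = 0" using u(2) by simp
    then have "AE v in lborel. heis_dist u v powr - lam * indicator ?B v = 0"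
      using integral_nonneg_eq_0_iff_AE[OF int] by auto
    then have "AE v in lborel. v \<notin> ?B"
      using AE_lborel_singleton[of u] by eventually_elim (auto simp: indicator_def split: if_splits)
    then have "emeasure lborel ?B = 0"
      by (subst (asm) AE_iff_measurable[OF _ refl]) auto
    then show False using heis_vol[where 'n='n] by simp
  qed
  then have "Lp_mass q (frac_int lam f) > 0" by (simp add: less_le)
  then have "hls_c powr q * Lp_mass p f powr (q / p) > 0" using HLS_bound[OF f] by linarith
  then have "hls_c \<noteq> 0" by auto
  then show ?thesis using hls_c_nonneg by simp
qed

text \<open>The duality map of L^s up to normalization: it yields the function with equality in
  Hoelder's inequality. The conjugate is there because the pairing in use is bilinear.\<close>

definition dual_fun :: "real \<Rightarrow> complex \<Rightarrow> complex" where
  "dual_fun s z = cnj z * of_real (norm z powr (s - 2))"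

lemma norm_dual_fun: "norm (dual_fun s z) = norm z powr (s - 1)"
proof (cases "z = 0")
  case False
  then have "norm z * norm z powr (s - 2) = norm z powr (s - 1)"
    by (simp add: powr_diff power2_eq_square powr_numeral)
  then show ?thesis by (simp add: dual_fun_def norm_mult)
qed (simp add: dual_fun_def)

lemma mult_dual_fun: "z * dual_fun s z = of_real (norm z powr s)"
proof (cases "z = 0")
  case False
  then have "norm z ^ 2 * norm z powr (s - 2) = norm z powr s"
    by (simp add: powr_diff powr_numeral)
  then show ?thesis unfolding dual_fun_def mult.assoc[symmetric]
    by (simp add: complex_norm_square[symmetric] flip: of_real_mult of_real_power)
qed (simp add: dual_fun_def)

lemma dual_fun_measurable [measurable]: "dual_fun s \<in> borel_measurable borel"
proof -
  have [measurable]: "cnj \<in> borel_measurable borel"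
    by (intro borel_measurable_continuous_onI continuous_intros)
  show ?thesis unfolding dual_fun_def[abs_def] by measurable
qed

text \<open>An adjoint has the same norm: pairing with the dual function of
  \<open>frac_int lam g\<close> moves the operator to the side where \<open>hls_c\<close> is known.
  This bounds \<open>N\<close> by \<open>hls_c * N powr (1 / p)\<close>; the power can be cancelled
  since the dual instance of the locale already places \<open>frac_int lam g\<close> in
  L^p'.\<close>

lemma dual_HLS_bound:
  fixes g :: "'n heis \<Rightarrow> complex"
  assumes g: "g \<in> Lp_space q'" "Lp_mass q' g \<le> 1"
  shows "Lp_mass p' (frac_int lam g) \<le> hls_c powr p'"
proof -
  interpret dual: hls_exponents lam q' p' Q n by (rule dual_exponents)
  interpret cq: conjugate_exponents q q' by (rule conj_q)
  have G: "frac_int lam g \<in> Lp_space p'" by (rule dual.frac_int_Lq[OF g(1)])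
  then have [measurable]: "frac_int lam g \<in> borel_measurable borel" by (simp add: Lp_space_iff)
  define N where "N = Lp_mass p' (frac_int lam g)"
  show ?thesis
  proof (cases "N = 0")
    case False
    then have N: "N > 0" by (simp add: N_def less_le)
    define \<phi> where "\<phi> u = dual_fun p' (frac_int lam g u)" for u
    have np: "norm (\<phi> u) powr p = norm (frac_int lam g u) powr p'" for u
      unfolding \<phi>_def norm_dual_fun powr_powr using conj.conj_mult(2) by (simp only: mult.commute)
    have \<phi>: "\<phi> \<in> Lp_space p" "Lp_mass p \<phi> = N"
      using Lp_space_integrable[OF G] unfolding Lp_space_iff Lp_mass_def N_def np by (auto simp: \<phi>_def[abs_def])
    have "of_real N = (LINT v|lborel. \<phi> v * frac_int lam g v)"
      unfolding \<phi>_def mult.commute[of "dual_fun _ _"] mult_dual_fun N_def Lp_mass_def by (rule integral_complex_of_real[symmetric])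
    also have "\<dots> = (LINT u|lborel. g u * frac_int lam \<phi> u)" by (rule frac_int_symmetric[OF \<phi>(1) g(1)])
    finally have "N = norm (LINT u|lborel. g u * frac_int lam \<phi> u)" using N by (metis abs_of_pos norm_of_real)
    also have "\<dots> \<le> (LINT u|lborel. norm (g u * frac_int lam \<phi> u))" by (rule integral_norm_bound)
    also have "\<dots> \<le> (hls_c * N powr (1 / p)) * 1"
    proof -
      have "Lp_mass q (frac_int lam \<phi>) \<le> (hls_c * N powr (1 / p)) powr q"
        using HLS_bound[OF \<phi>(1)] by (simp add: powr_mult powr_powr \<phi>)
      from cq.Holder_Lp(2)[OF frac_int_Lq[OF \<phi>(1)] this g(1), of 1] g(2) hls_c_pos N
      show ?thesis by (simp add: mult.commute)
    qed
    finally have le: "N \<le> hls_c * N powr (1 / p)" by simp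
    have "N = N powr (1 / p' + 1 / p)" using N conj.conj by (simp add: add.commute)
    then have "N = N powr (1 / p') * N powr (1 / p)" by (simp add: powr_add)
    then have "N powr (1 / p') * N powr (1 / p) \<le> hls_c * N powr (1 / p)" using le by simp
    then have "N powr (1 / p') \<le> hls_c" using N by simp
    then have "(N powr (1 / p')) powr p' \<le> hls_c powr p'"
      using conj.p'_gt by (intro powr_mono2) auto
    moreover have "1 / p' * p' = 1" by (rule conj.p'_inverse_mult)
    ultimately show ?thesis using N unfolding N_def[symmetric] powr_powr by simp
  qed (simp add: N_def[symmetric])
qed

end

section \<open>Maximizing sequences\<close>

context hls_exponents
begin

abbreviation ball_integral :: "('n heis \<Rightarrow> complex) \<Rightarrow> real" where
  "ball_integral f \<equiv> LINT v|lborel. indicator {v. heis_norm v < 1} v * norm (f v)"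

abbreviation extremal_limit :: "(nat \<Rightarrow> 'n heis \<Rightarrow> complex) \<Rightarrow> (nat \<Rightarrow> nat) \<Rightarrow> ('n heis \<Rightarrow> complex) \<Rightarrow> bool" where
  "extremal_limit h r g \<equiv> strict_mono r \<and> g \<in> Lp_space p \<and> Lp_mass p g = 1 \<and>
    Lp_mass q (frac_int lam g) = hls_c powr q \<and> (\<lambda>j. Lp_mass p (\<lambda>u. h (r j) u - g u)) \<longlonglongrightarrow> 0"

definition "dual_seq h u = of_real (1 / Lp_mass q (frac_int lam h) powr (1 / q')) * dual_fun q (frac_int lam h u)"

text \<open>Mass one follows from \<open>(q - 1) * q' = q\<close>; the pairing is then
  \<open>M / M powr (1 / q') = M powr (1 / q)\<close>, the L^q norm of the potential.\<close>

lemma dual_seq: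
  fixes h :: "'n heis \<Rightarrow> complex"
  assumes h: "h \<in> Lp_space p" and pos: "Lp_mass q (frac_int lam h) > 0"
  shows "dual_seq h \<in> Lp_space q'" "Lp_mass q' (dual_seq h) = 1"
    "(LINT u|lborel. dual_seq h u * frac_int lam h u) = of_real (Lp_mass q (frac_int lam h) powr (1 / q))"
proof -
  interpret cq: conjugate_exponents q q' by (rule conj_q)
  define M where "M = Lp_mass q (frac_int lam h)"
  have M: "M > 0" using pos by (simp add: M_def)
  have T: "frac_int lam h \<in> Lp_space q" by (rule frac_int_Lq[OF h])
  then have [measurable]: "frac_int lam h \<in> borel_measurable borel" by (simp add: Lp_space_iff)
  have e1: "1 / q' * q' = 1" by (rule cq.p'_inverse_mult)
  have e2: "1 - 1 / q' = 1 / q" using cq.conj by simp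
  have np: "norm (dual_seq h u) powr q' = norm (frac_int lam h u) powr q / M" for u
  proof -
    have "norm (dual_seq h u) powr q' = (1 / M powr (1 / q')) powr q' * (norm (frac_int lam h u) powr (q - 1)) powr q'"
      unfolding dual_seq_def norm_mult norm_dual_fun M_def[symmetric] by (simp add: powr_mult powr_divide norm_divide)
    also have "(norm (frac_int lam h u) powr (q - 1)) powr q' = norm (frac_int lam h u) powr q"
      unfolding powr_powr using cq.conj_mult(1) by (simp only: mult.commute)
    also have "(1 / M powr (1 / q')) powr q' = 1 / M"
      unfolding powr_divide powr_powr e1 using M by simp
    finally show ?thesis by simp
  qed
  have [measurable]: "dual_seq h \<in> borel_measurable borel" unfolding dual_seq_def[abs_def] by measurable
  show "dual_seq h \<in> Lp_space q'" "Lp_mass q' (dual_seq h) = 1"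
    using Lp_space_integrable[OF T] M unfolding Lp_space_iff Lp_mass_def np by (auto simp: M_def Lp_mass_def)
  have "(LINT u|lborel. dual_seq h u * frac_int lam h u) = (LINT u|lborel. of_real (norm (frac_int lam h u) powr q / M powr (1 / q')))"
    unfolding dual_seq_def M_def[symmetric]
    by (simp add: mult_ac) (simp add: mult_dual_fun mult.commute[of "dual_fun _ _"])
  also have "\<dots> = of_real (M / M powr (1 / q'))"
    unfolding integral_complex_of_real by (simp add: M_def Lp_mass_def)
  also have "M / M powr (1 / q') = M powr (1 - 1 / q')"
    using M by (simp add: powr_diff)
  finally show "(LINT u|lborel. dual_seq h u * frac_int lam h u) = of_real (Lp_mass q (frac_int lam h) powr (1 / q))"
    unfolding e2 M_def .
qed

text \<open>The Young defect \<open>E j\<close> has integral at most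
  \<open>1 / p + 1 / p' - a j / hls_c\<close>: the dual inequality bounds the mass of
  \<open>G j / hls_c\<close> by one, and the pairing of \<open>h j\<close> with \<open>G j\<close>
  is \<open>a j\<close>, which tends to \<open>hls_c\<close>. Being nonnegative, the defect vanishes
  almost everywhere along a subsequence and ties \<open>h j\<close> to the convergent
  \<open>G j\<close>.\<close>

lemma maximizing_AE_convergent_subseq:
  fixes h :: "nat \<Rightarrow> 'n heis \<Rightarrow> complex"
  assumes h: "\<And>j. h j \<in> Lp_space p" "\<And>j. Lp_mass p (h j) = 1"
    and pos: "\<And>j. Lp_mass q (frac_int lam (h j)) > 0"
    and lim: "(\<lambda>j. Lp_mass q (frac_int lam (h j))) \<longlonglongrightarrow> hls_c powr q"
  shows "\<exists>r. strict_mono r \<and> (AE u in lborel. convergent (\<lambda>j. h (r j) u))"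
proof -
  interpret dual: hls_exponents lam q' p' Q n by (rule dual_exponents)
  have [measurable]: "h j \<in> borel_measurable borel" for j using h by (simp add: Lp_space_iff)
  define a where "a j = Lp_mass q (frac_int lam (h j)) powr (1 / q)" for j
  have a: "a \<longlonglongrightarrow> hls_c"
  proof -
    have "a \<longlonglongrightarrow> (hls_c powr q) powr (1 / q)"
      unfolding a_def using hls_c_pos by (intro tendsto_powr lim tendsto_const) auto
    then show ?thesis using q_gt1 hls_c_pos by (simp add: powr_powr)
  qed
  define G where "G j = frac_int lam (dual_seq (h j))" for j
  have g: "dual_seq (h j) \<in> Lp_space q'" "Lp_mass q' (dual_seq (h j)) \<le> 1" for j
    using dual_seq[OF h(1) pos] by simp_all
  have G: "G j \<in> Lp_space p'" "Lp_mass p' (G j) \<le> hls_c powr p'" for j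
    unfolding G_def using dual.frac_int_Lq[OF g(1)] dual_HLS_bound[OF g] by auto
  then have [measurable]: "G j \<in> borel_measurable borel" for j by (simp add: Lp_space_iff)
  \<comment> \<open>Local compactness is used here for the dual exponents, on functions of unit mass
    in L^q'.\<close>
  obtain r1 where r1: "strict_mono r1" "AE u in lborel. convergent (\<lambda>j. G (r1 j) u)"
    using dual.frac_int_AE_convergent_subseq[of "\<lambda>j. dual_seq (h j)" 1] g unfolding G_def by blast
  define E where "E j u = norm (h j u) powr p / p + norm (G j u / of_real hls_c) powr p' / p' - Re (h j u * (G j u / of_real hls_c))" for j u
  have E0: "E j u \<ge> 0" for j u
  proof -
    have "Re (h j u * (G j u / of_real hls_c)) \<le> norm (h j u * (G j u / of_real hls_c))" by (rule complex_Re_le_cmod)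
    also have "\<dots> \<le> norm (h j u) powr p / p + norm (G j u / of_real hls_c) powr p' / p'"
      unfolding norm_mult by (rule Youngs_inequality[OF conj.p_gt conj.p'_gt conj.conj]) auto
    finally show ?thesis by (simp add: E_def)
  qed
  have Geq: "norm (G j u / of_real hls_c) powr p' = norm (G j u) powr p' / hls_c powr p'" for j u
    using hls_c_pos by (simp add: norm_divide powr_divide)
  have inth: "integrable lborel (\<lambda>u. norm (h j u) powr p / p)" for j
    using Lp_space_integrable[OF h(1)] by (rule integrable_divide)
  have intG: "integrable lborel (\<lambda>u. norm (G j u / of_real hls_c) powr p' / p')" for j
    unfolding Geq using Lp_space_integrable[OF G(1)] by (intro integrable_divide)
  have inthG: "integrable lborel (\<lambda>u. h j u * (G j u / of_real hls_c))" for j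
    using integrable_divide[OF frac_int_symmetric(2)[OF h(1)[of j] g(1)[of j]], of "of_real hls_c"] by (simp add: G_def)
  have inthG': "integrable lborel (\<lambda>u. Re (h j u * (G j u / of_real hls_c)))" for j
    using integrable_Re[OF inthG] .
  have intE: "integrable lborel (E j)" for j
    unfolding E_def using inth intG inthG' by (intro Bochner_Integration.integrable_diff Bochner_Integration.integrable_add)
  have E_le: "(LINT u|lborel. E j u) \<le> 1 - a j / hls_c" for j
  proof -
    have "(LINT u|lborel. E j u) = (LINT u|lborel. norm (h j u) powr p / p) + (LINT u|lborel. norm (G j u / of_real hls_c) powr p' / p')
        - (LINT u|lborel. Re (h j u * (G j u / of_real hls_c)))"
      unfolding E_def
      by (simp only: Bochner_Integration.integral_diff[OF Bochner_Integration.integrable_add[OF inth intG] inthG']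
         Bochner_Integration.integral_add[OF inth intG])
    also have "(LINT u|lborel. norm (h j u) powr p / p) = 1 / p" using h(2)[of j] by (simp add: Lp_mass_def)
    also have "(LINT u|lborel. norm (G j u / of_real hls_c) powr p' / p') = Lp_mass p' (G j) / hls_c powr p' / p'"
      unfolding Geq Lp_mass_def by (simp only: integral_divide_zero)
    also have "(LINT u|lborel. Re (h j u * (G j u / of_real hls_c))) = Re (LINT u|lborel. h j u * (G j u / of_real hls_c))"
      by (rule integral_Re[OF inthG])
    also have "(LINT u|lborel. h j u * (G j u / of_real hls_c)) = (LINT u|lborel. h j u * G j u) / of_real hls_c"
      by simp
    also have "(LINT u|lborel. h j u * G j u) = of_real (a j)"
      unfolding G_def frac_int_symmetric(3)[OF h(1) g(1)] a_def by (rule dual_seq(3)[OF h(1) pos])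
    also have "Re (of_real (a j) / of_real hls_c) = a j / hls_c" by (simp flip: of_real_divide)
    also have "Lp_mass p' (G j) / hls_c powr p' / p' \<le> 1 / p'"
      using G(2)[of j] hls_c_pos conj.p'_gt by (intro divide_right_mono) (auto simp: divide_le_eq)
    finally show ?thesis using conj.conj by simp
  qed
  have "(\<lambda>j. 1 - a j / hls_c) \<longlonglongrightarrow> 1 - hls_c / hls_c"
    using hls_c_pos by (intro tendsto_intros a) auto
  then have up: "(\<lambda>j. 1 - a j / hls_c) \<longlonglongrightarrow> 0" using hls_c_pos by simp
  have "(\<lambda>j. LINT u|lborel. norm (E (r1 j) u)) \<longlonglongrightarrow> 0"
  proof (rule real_tendsto_sandwich[OF _ _ tendsto_const LIMSEQ_subseq_LIMSEQ[OF up r1(1), unfolded o_def]])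
    show "\<forall>\<^sub>F j in sequentially. 0 \<le> (LINT u|lborel. norm (E (r1 j) u))" by simp
    show "\<forall>\<^sub>F j in sequentially. (LINT u|lborel. norm (E (r1 j) u)) \<le> 1 - a (r1 j) / hls_c"
      using E_le E0 by (intro always_eventually allI) simp
  qed
  then obtain r2 where r2: "strict_mono r2" "AE u in lborel. (\<lambda>j. E (r1 (r2 j)) u) \<longlonglongrightarrow> 0"
    using tendsto_L1_AE_subseq[of lborel "\<lambda>j. E (r1 j)"] intE by blast
  have "AE u in lborel. convergent (\<lambda>j. h ((r1 \<circ> r2) j) u)"
    using r1(2) r2(2)
  proof eventually_elim
    case (elim u)
    then obtain l where "(\<lambda>j. G (r1 j) u) \<longlonglongrightarrow> l" by (auto simp: convergent_def)
    from LIMSEQ_subseq_LIMSEQ[OF this r2(1)] have "(\<lambda>j. G (r1 (r2 j)) u / of_real hls_c) \<longlonglongrightarrow> l / of_real hls_c"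
      using hls_c_pos by (intro tendsto_divide tendsto_const) (auto simp: o_def)
    from conj.Young_defect_tendsto[OF this, of "\<lambda>j. h (r1 (r2 j)) u"] elim(2)
    show ?case unfolding E_def convergent_def o_def by blast
  qed
  then show ?thesis using strict_mono_o[OF r1(1) r2(1)] by blast
qed

text \<open>By the Brezis-Lieb lemma the mass splits as \<open>1 = a + (1 - a)\<close> between the limit and the remainder, and
  maximality gives \<open>1 \<le> a powr (q / p) + (1 - a) powr (q / p)\<close>; as \<open>q > p\<close>, this means \<open>a = 0\<close> or \<open>a = 1\<close>.\<close>

lemma maximizing_compact:
  fixes h :: "nat \<Rightarrow> 'n heis \<Rightarrow> complex"
  assumes h: "\<And>j. h j \<in> Lp_space p" "\<And>j. Lp_mass p (h j) = 1"
    and lim: "(\<lambda>j. Lp_mass q (frac_int lam (h j))) \<longlonglongrightarrow> hls_c powr q"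
    and \<eta>: "\<eta> > 0" "eventually (\<lambda>j. \<eta> \<le> ball_integral (h j)) sequentially"
  shows "\<exists>r g. extremal_limit h r g"
proof -
  let ?B = "{v :: 'n heis. heis_norm v < 1}"
  have p: "p > 0" "q > 0" using p_gt1 q_gt1 by simp_all
  have [measurable]: "h j \<in> borel_measurable borel" for j using h by (simp add: Lp_space_iff)
  have "hls_c powr q > 0" using hls_c_pos by simp
  from order_tendstoD(1)[OF lim this] \<eta>(2) have
    "eventually (\<lambda>j. Lp_mass q (frac_int lam (h j)) > 0 \<and> \<eta> \<le> (LINT v|lborel. indicator ?B v * norm (h j v))) sequentially"
    by eventually_elim auto
  \<comment> \<open>Beyond \<open>N\<close> the potentials are nonzero, so that they can be
    normalized to dual functions, and the unit ball carries at least \<open>\<eta>\<close>.\<close>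
  then obtain N where N: "\<And>j. j \<ge> N \<Longrightarrow> Lp_mass q (frac_int lam (h j)) > 0"
      "\<And>j. j \<ge> N \<Longrightarrow> \<eta> \<le> (LINT v|lborel. indicator ?B v * norm (h j v))"
    unfolding eventually_sequentially by blast
  have "\<exists>r. strict_mono r \<and> (AE u in lborel. convergent (\<lambda>j. h (r j + N) u))"
    using maximizing_AE_convergent_subseq[of "\<lambda>j. h (j + N)"] h N(1) LIMSEQ_ignore_initial_segment[OF lim, of N] by simp
  then obtain r1 where r1: "strict_mono r1" "AE u in lborel. convergent (\<lambda>j. h (r1 j + N) u)" by blast
  define g where "g u = lim (\<lambda>j. h (r1 j + N) u)" for u
  have [measurable]: "g \<in> borel_measurable borel"
    unfolding g_def by (rule borel_measurable_lim_metric) measurable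
  have hg: "AE u in lborel. (\<lambda>j. h (r1 j + N) u) \<longlonglongrightarrow> g u"
    using r1(2) by eventually_elim (simp add: g_def convergent_LIMSEQ_iff)
  obtain r2 where r2: "strict_mono r2" "AE u in lborel. (\<lambda>j. frac_int lam (h (r1 (r2 j) + N)) u) \<longlonglongrightarrow> frac_int lam g u"
    using frac_int_AE_subseq[of "\<lambda>j. h (r1 j + N)" 1 g] h hg by auto
  define R where "R j = r1 (r2 j) + N" for j
  have R: "strict_mono R" using r1(1) r2(1) by (auto simp: R_def strict_mono_def)
  have RN: "R j \<ge> N" for j by (simp add: R_def)
  define f where "f j = h (R j)" for j
  have f: "f j \<in> Lp_space p" "Lp_mass p (f j) = 1" for j using h by (simp_all add: f_def)
  have fle: "Lp_mass p (f j) \<le> 1" for j by (simp add: f)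
  have [measurable]: "f j \<in> borel_measurable borel" for j using f by (simp add: Lp_space_iff)
  have fg: "AE u in lborel. (\<lambda>j. f j u) \<longlonglongrightarrow> g u"
    using hg by eventually_elim (use LIMSEQ_subseq_LIMSEQ[OF _ r2(1)] in \<open>force simp: f_def R_def o_def\<close>)
  have Tfg: "AE u in lborel. (\<lambda>j. frac_int lam (f j) u) \<longlonglongrightarrow> frac_int lam g u"
    using r2(2) by (simp add: f_def R_def)
  define a where "a = Lp_mass p g"
  have g: "g \<in> Lp_space p" "a \<le> 1" using Fatou_Lp[OF f(1) fle _ fg p(1)] by (auto simp: a_def)
  have a0: "a \<ge> 0" by (simp add: a_def)
  define x where "x j = Lp_mass p (\<lambda>u. f j u - g u)" for j
  have d: "(\<lambda>u. f j u - g u) \<in> Lp_space p" for j using Lp_space_diff(1)[OF f(1) g(1) p(1)] .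
  have x: "x \<longlonglongrightarrow> 1 - a"
  proof -
    have "(\<lambda>j. 1 - x j) \<longlonglongrightarrow> a"
      using Brezis_Lieb[OF f(1) fle _ fg p(1)] by (simp add: f(2) x_def a_def)
    then have "(\<lambda>j. 1 - (1 - x j)) \<longlonglongrightarrow> 1 - a" by (intro tendsto_diff tendsto_const)
    then show ?thesis by simp
  qed
  define y where "y j = Lp_mass q (\<lambda>u. frac_int lam (f j) u - frac_int lam g u)" for j
  have y_le: "y j \<le> hls_c powr q * x j powr (q / p)" for j
  proof -
    have "y j = Lp_mass q (frac_int lam (\<lambda>u. f j u - g u))"
      unfolding y_def
    proof (rule Lp_mass_cong_AE)
      show "AE u in lborel. frac_int lam (f j) u - frac_int lam g u = frac_int lam (\<lambda>u. f j u - g u) u"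
        using frac_int_diff_AE[OF f(1) g(1), of j] by eventually_elim simp
    qed measurable
    then show ?thesis using HLS_bound[OF d[of j]] by (simp add: x_def)
  qed
  have Tf: "frac_int lam (f j) \<in> Lp_space q" "Lp_mass q (frac_int lam (f j)) \<le> hls_c powr q" for j
    using frac_int_Lq[OF f(1)] HLS_bound[OF f(1), of j] by (simp_all add: f(2))
  have limf: "(\<lambda>j. Lp_mass q (frac_int lam (f j))) \<longlonglongrightarrow> hls_c powr q"
    using LIMSEQ_subseq_LIMSEQ[OF lim R] by (simp add: f_def o_def)
  have y: "y \<longlonglongrightarrow> hls_c powr q - Lp_mass q (frac_int lam g)"
  proof -
    have "(\<lambda>j. Lp_mass q (frac_int lam (f j)) - y j) \<longlonglongrightarrow> Lp_mass q (frac_int lam g)"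
      unfolding y_def by (rule Brezis_Lieb[OF Tf _ Tfg p(2)]) measurable
    from tendsto_diff[OF limf this] show ?thesis by simp
  qed
  have "(\<lambda>j. hls_c powr q * x j powr (q / p)) \<longlonglongrightarrow> hls_c powr q * (1 - a) powr (q / p)"
    using p by (intro tendsto_mult_left tendsto_powr' x tendsto_const) (auto simp: x_def)
  then have ineq: "hls_c powr q - Lp_mass q (frac_int lam g) \<le> hls_c powr q * (1 - a) powr (q / p)"
    by (rule LIMSEQ_le[OF y]) (use y_le in blast)
  have ub: "Lp_mass q (frac_int lam g) \<le> hls_c powr q * a powr (q / p)"
    using HLS_bound[OF g(1)] by (simp add: a_def)
  have "hls_c powr q * 1 \<le> hls_c powr q * (a powr (q / p) + (1 - a) powr (q / p))"
    using ineq ub by (simp add: distrib_left)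
  then have "1 \<le> a powr (q / p) + (1 - a) powr (q / p)"
    using \<open>hls_c powr q > 0\<close> by (simp only: mult_le_cancel_left_pos)
  moreover have "q / p > 1" using p_less_q p by simp
  ultimately have "a = 0 \<or> a = 1" using powr_sum_ge_1[OF a0 g(2)] by blast
  \<comment> \<open>A zero limit is excluded by testing with the indicator of the unit ball: the
    integrals of \<open>norm (f j v)\<close> over it would tend to zero, against the lower bound
    \<open>\<eta>\<close>.\<close>
  moreover have "a \<noteq> 0"
  proof
    assume "a = 0"
    then have g0: "AE u in lborel. g u = 0" using Lp_mass_eq_0_iff[OF g(1)] by (simp add: a_def)
    have [measurable]: "?B \<in> sets borel" by measurable
    have "(\<lambda>j. LINT v|lborel. \<bar>indicator ?B v\<bar> * norm (f j v - g v)) \<longlonglongrightarrow> 0"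
    proof (rule conj.weak_convergence_of_AE[OF f(1) fle _ fg])
      have "integrable lborel (indicator ?B :: _ \<Rightarrow> real)"
        using heis_vol(2)[where 'n='n] by (intro integrable_real_indicator) auto
      moreover have "\<bar>indicator ?B v :: real\<bar> powr p' = indicator ?B v" for v
        using conj.p'_gt by (simp add: indicator_def)
      ultimately show "integrable lborel (\<lambda>v. \<bar>indicator ?B v :: real\<bar> powr p')" by simp
    qed measurable
    moreover have "(LINT v|lborel. \<bar>indicator ?B v\<bar> * norm (f j v - g v)) = (LINT v|lborel. indicator ?B v * norm (f j v))" for j
    proof (rule integral_cong_AE)
      show "AE v in lborel. \<bar>indicator ?B v\<bar> * norm (f j v - g v) = indicator ?B v * norm (f j v)"
        using g0 by eventually_elim simp
    qed measurable
    ultimately have "(\<lambda>j. LINT v|lborel. indicator ?B v * norm (f j v)) \<longlonglongrightarrow> 0" by simp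
    then have "\<eta> \<le> 0"
      by (rule LIMSEQ_le_const) (use N(2) RN in \<open>auto simp: f_def\<close>)
    then show False using \<eta>(1) by simp
  qed
  \<comment> \<open>With \<open>a = 1\<close> the remainders \<open>x j\<close> tend to zero, so
    convergence almost everywhere has become convergence in norm; \<open>ineq\<close> and
    \<open>ub\<close> now squeeze the mass of the potential of \<open>g\<close> to the maximal
    value.\<close>
  ultimately have a1: "a = 1" by blast
  have "Lp_mass q (frac_int lam g) = hls_c powr q"
    using ineq ub by (simp add: a1)
  then show ?thesis
    using R g(1) x a1 unfolding a_def x_def f_def by (intro exI[of _ R] exI[of _ g]) simp
qed

end

section \<open>Action of the translations and dilations\<close>

definition heis_sym :: "real \<Rightarrow> 'n::finite heis \<Rightarrow> real \<Rightarrow> ('n heis \<Rightarrow> complex) \<Rightarrow> 'n heis \<Rightarrow> complex" where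
  "heis_sym s w d f u = (1 / d powr (hom_dim TYPE('n) / s)) *\<^sub>R f (heis_dil (1 / d) (w \<cdot>\<^sub>H u))"

lemma nn_integral_heis_sym:
  fixes F :: "'n::finite heis \<Rightarrow> ennreal"
  assumes [measurable]: "F \<in> borel_measurable borel" and d: "d > 0"
  shows "(\<integral>\<^sup>+u. F (heis_dil (1 / d) (w \<cdot>\<^sub>H u)) \<partial>lborel) = ennreal (d powr hom_dim TYPE('n)) * (\<integral>\<^sup>+u. F u \<partial>lborel)"
proof -
  have "(\<integral>\<^sup>+u. F (heis_dil (1 / d) (w \<cdot>\<^sub>H u)) \<partial>lborel) = (\<integral>\<^sup>+u. F (heis_dil (1 / d) u) \<partial>lborel)"
    by (rule nn_integral_heis_translate[of "\<lambda>u. F (heis_dil (1 / d) u)"]) measurable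
  also have "\<dots> = ennreal ((1 / d) powr - hom_dim TYPE('n)) * (\<integral>\<^sup>+u. F u \<partial>lborel)"
    using d by (intro nn_integral_heis_dil) auto
  also have "(1 / d) powr - hom_dim TYPE('n) = d powr hom_dim TYPE('n)"
    using d by (simp add: powr_minus_divide powr_divide)
  finally show ?thesis .
qed

text \<open>The formula for nonnegative integrals is recast as an image measure, so that Bochner
  integrals can be transformed as well.\<close>

lemma distr_heis_sym:
  fixes w :: "'n::finite heis"
  assumes d: "d > 0"
  shows "distr lborel borel (\<lambda>u. heis_dil (1 / d) (w \<cdot>\<^sub>H u)) =
    density lborel (\<lambda>_. ennreal (d powr hom_dim TYPE('n)))" (is "?L = ?R")
proof (rule measure_eqI)
  fix A assume "A \<in> sets ?L"
  then have [measurable]: "A \<in> sets borel" by simp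
  have "emeasure ?L A = (\<integral>\<^sup>+u. indicator A u \<partial>?L)" by simp
  also have "\<dots> = (\<integral>\<^sup>+u. indicator A (heis_dil (1 / d) (w \<cdot>\<^sub>H u)) \<partial>lborel)"
    by (rule nn_integral_distr) measurable
  also have "\<dots> = ennreal (d powr hom_dim TYPE('n)) * (\<integral>\<^sup>+u. indicator A u \<partial>lborel)"
    by (rule nn_integral_heis_sym[OF _ d]) measurable
  also have "\<dots> = emeasure ?R A"
    by (simp add: emeasure_density_const)
  finally show "emeasure ?L A = emeasure ?R A" .
qed simp

lemma integral_heis_sym:
  fixes F :: "'n::finite heis \<Rightarrow> 'b::{banach, second_countable_topology}"
  assumes [measurable]: "F \<in> borel_measurable borel" and d: "d > 0"
  shows "(LINT u|lborel. F (heis_dil (1 / d) (w \<cdot>\<^sub>H u))) = (d powr hom_dim TYPE('n)) *\<^sub>R (LINT u|lborel. F u)"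
proof -
  have "(LINT u|lborel. F (heis_dil (1 / d) (w \<cdot>\<^sub>H u))) =
      (LINT u|distr lborel borel (\<lambda>u. heis_dil (1 / d) (w \<cdot>\<^sub>H u)). F u)"
    by (rule integral_distr[symmetric]) measurable
  also have "\<dots> = (LINT u|lborel. (d powr hom_dim TYPE('n)) *\<^sub>R F u)"
    unfolding distr_heis_sym[OF d] by (rule integral_density) auto
  finally show ?thesis by simp
qed

lemma borel_measurable_heis_sym [measurable]:
  fixes f :: "'n::finite heis \<Rightarrow> complex"
  assumes [measurable]: "f \<in> borel_measurable borel"
  shows "heis_sym s w d f \<in> borel_measurable borel"
  unfolding heis_sym_def[abs_def] by measurable

lemma Lp_heis_sym:
  fixes f :: "'n::finite heis \<Rightarrow> complex"
  assumes f: "f \<in> Lp_space s" and d: "d > 0" and s: "s > 0"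
  shows "heis_sym s w d f \<in> Lp_space s" "Lp_mass s (heis_sym s w d f) = Lp_mass s f"
proof -
  note [measurable] = Lp_space_measurable[OF f(1)]
  have eq: "norm (heis_sym s w d f u) powr s = d powr - hom_dim TYPE('n) * norm (f (heis_dil (1 / d) (w \<cdot>\<^sub>H u))) powr s" for u
    unfolding heis_sym_def using d s by (simp add: powr_mult powr_divide powr_powr powr_minus_divide)
  have "(\<integral>\<^sup>+u. ennreal (norm (heis_sym s w d f u) powr s) \<partial>lborel) =
    ennreal (d powr - hom_dim TYPE('n)) * (\<integral>\<^sup>+u. ennreal (norm (f (heis_dil (1 / d) (w \<cdot>\<^sub>H u))) powr s) \<partial>lborel)"
    unfolding eq by (simp add: ennreal_mult nn_integral_cmult)
  also have "\<dots> = ennreal (d powr - hom_dim TYPE('n)) * (ennreal (d powr hom_dim TYPE('n)) * (\<integral>\<^sup>+u. ennreal (norm (f u) powr s) \<partial>lborel))"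
    by (subst nn_integral_heis_sym[OF _ d, of "\<lambda>u. ennreal (norm (f u) powr s)"]) auto
  also have "\<dots> = (ennreal (d powr - hom_dim TYPE('n)) * ennreal (d powr hom_dim TYPE('n))) * ennreal (Lp_mass s f)"
    unfolding nn_integral_Lp_mass[OF f] by (simp add: mult.assoc)
  also have "ennreal (d powr - hom_dim TYPE('n)) * ennreal (d powr hom_dim TYPE('n)) = 1"
    using d by (simp add: ennreal_mult[symmetric] powr_minus)
  finally have nn: "(\<integral>\<^sup>+u. ennreal (norm (heis_sym s w d f u) powr s) \<partial>lborel) = ennreal (Lp_mass s f)" by simp
  show L: "heis_sym s w d f \<in> Lp_space s"
    by (rule Lp_spaceI_nn(1)[where c="Lp_mass s f"]) (auto simp: nn)
  show "Lp_mass s (heis_sym s w d f) = Lp_mass s f"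
    using nn unfolding nn_integral_Lp_mass[OF L] by simp
qed

context hls_exponents
begin

text \<open>The change of variables gives \<open>d powr - lam\<close> from the kernel and
  \<open>d powr Q\<close> from the measure. Together with the normalization for \<open>p\<close>
  this is \<open>d powr (- Q / q)\<close> by \<open>lam_eq\<close>, which is the normalization for
  \<open>q\<close>.\<close>

lemma frac_int_heis_sym:
  fixes f :: "'n heis \<Rightarrow> complex"
  assumes [measurable]: "f \<in> borel_measurable borel" and d: "d > 0"
  shows "frac_int lam (heis_sym p w d f) = heis_sym q w d (frac_int lam f)"
proof
  fix u
  define \<phi> where "\<phi> u = heis_dil (1 / d) (w \<cdot>\<^sub>H u)" for u
  have dist: "heis_dist u v = d * heis_dist (\<phi> u) (\<phi> v)" for v
    using d by (simp add: \<phi>_def heis_dist_dil)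
  have "frac_int lam (heis_sym p w d f) u =
    (LINT v|lborel. (\<lambda>x. (d powr - lam / d powr (Q / p)) *\<^sub>R (of_real (heis_dist (\<phi> u) x powr - lam) * f x)) (\<phi> v))"
    unfolding frac_int_eq dist heis_sym_def Q_eq[symmetric] using d
    by (intro Bochner_Integration.integral_cong) (auto simp: \<phi>_def powr_mult scaleR_conv_of_real)
  also have "\<dots> = (d powr Q) *\<^sub>R (LINT x|lborel. (d powr - lam / d powr (Q / p)) *\<^sub>R (of_real (heis_dist (\<phi> u) x powr - lam) * f x))"
    unfolding \<phi>_def Q_eq by (rule integral_heis_sym[OF _ d]) measurable
  also have "\<dots> = (d powr Q * (d powr - lam / d powr (Q / p))) *\<^sub>R frac_int lam f (\<phi> u)"
    by (simp add: frac_int_eq)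
  also have "d powr Q * (d powr - lam / d powr (Q / p)) = d powr (Q * (1 - 1 / p) - lam)"
    using d by (simp add: powr_diff powr_minus powr_add field_simps)
  also have "\<dots> = 1 / d powr (Q / q)"
    unfolding lam_eq by (simp add: powr_minus_divide)
  finally show "frac_int lam (heis_sym p w d f) u = heis_sym q w d (frac_int lam f) u"
    by (simp only: heis_sym_def[of q] \<phi>_def Q_eq[symmetric])
qed

lemma integrable_ball_Lp:
  fixes f :: "'n heis \<Rightarrow> complex"
  assumes f: "f \<in> Lp_space p"
  shows "integrable lborel (\<lambda>v. indicator {v. heis_norm v < 1} v * norm (f v))"
proof -
  let ?B = "{v :: 'n heis. heis_norm v < 1}"
  have [measurable]: "?B \<in> sets borel" by measurable
  have "integrable lborel (indicator ?B :: _ \<Rightarrow> real)"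
    using heis_vol(2)[where 'n='n] by (intro integrable_real_indicator) auto
  moreover have "norm (of_real (indicator ?B v) :: complex) powr p' = indicator ?B v" for v
    using conj.p'_gt by (simp add: indicator_def)
  ultimately have "integrable lborel (\<lambda>v. norm (of_real (indicator ?B v) :: complex) powr p')" by simp
  from integrable_norm[OF conj.integrable_mult_Lp[OF f _ this]] show ?thesis by (simp add: norm_mult)
qed

text \<open>If the Morrey bound held with the constant \<open>A\<close> below,
  \<open>HLS_morrey\<close> would limit the mass of the potential to half of the maximal one. So it
  fails on some ball, and by invariance the map that takes the unit ball to this ball turns the
  failure into a lower bound by the same \<open>A\<close>.\<close>

lemma heis_sym_nonvanishing:
  obtains \<eta> where "\<eta> > 0"
    "\<And>f :: 'n heis \<Rightarrow> complex. f \<in> Lp_space p \<Longrightarrow> Lp_mass p f = 1 \<Longrightarrow> Lp_mass q (frac_int lam f) > hls_c powr q / 2 \<Longrightarrow>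
      \<exists>w d. d > 0 \<and> \<eta> \<le> ball_integral (heis_sym p w d f)"
proof -
  define K where "K = hedberg_const"
  have K: "K > 0" using hedberg_const_pos by (simp add: K_def)
  define A where "A = (hls_c powr q / (2 * K)) powr (1 / (q - p))"
  have A: "A > 0" using K hls_c_pos by (simp add: A_def)
  have KA: "K * A powr (q - p) = hls_c powr q / 2"
    using K hls_c_pos p_less_q by (simp add: A_def powr_powr)
  show thesis
  proof (rule that[OF A])
    fix f :: "'n heis \<Rightarrow> complex"
    assume f: "f \<in> Lp_space p" "Lp_mass p f = 1" "Lp_mass q (frac_int lam f) > hls_c powr q / 2"
    note [measurable] = Lp_space_measurable[OF f(1)]
    have "\<not> heis_morrey (Q * (1 - 1 / p)) A f"
    proof
      assume m: "heis_morrey (Q * (1 - 1 / p)) A f"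
      have "(\<integral>\<^sup>+u. ennreal (norm (frac_int lam f u) powr q) \<partial>lborel) \<le> ennreal (K * A powr (q - p))"
        unfolding K_def using f(2) by (intro HLS_morrey[OF A f(1) _ m]) (auto intro: norm_frac_int_le)
      then show False using f(3) K Lp_spaceI_nn(2)[of "frac_int lam f" q "K * A powr (q - p)"] by (simp add: KA)
    qed
    then obtain u0 r where r: "r > 0" and big: "ennreal (A * r powr (Q * (1 - 1 / p))) <
        (\<integral>\<^sup>+v. (if heis_dist u0 v < r then ennreal (norm (f v)) else 0) \<partial>lborel)"
      unfolding heis_morrey_def by (auto simp: not_le simp del: split_paired_All split_paired_Ex)
    \<comment> \<open>\<open>heis_sym\<close> multiplies by \<open>w\<close> before it dilates by
      \<open>1 / d = r\<close>, so the center \<open>u0\<close> has to be scaled back.\<close>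
    define w where "w = heis_dil (1 / r) u0"
    define d where "d = 1 / r"
    have d: "d > 0" using r by (simp add: d_def)
    have \<phi>: "heis_dil (1 / d) (w \<cdot>\<^sub>H v) = u0 \<cdot>\<^sub>H heis_dil r v" for v
      using r by (simp add: w_def d_def heis_dil_mult heis_dil_dil)
    have dist: "heis_dist u0 (u0 \<cdot>\<^sub>H heis_dil r v) = r * heis_norm v" for v
      using r heis_dist_left[of u0 0 "heis_dil r v"] by (simp add: heis_dist_0_left heis_norm_dil)
    let ?h = "heis_sym p w d f"
    have "ennreal (ball_integral ?h) =
      (\<integral>\<^sup>+v. ennreal (indicator {v. heis_norm v < 1} v * norm (?h v)) \<partial>lborel)"
      by (rule nn_integral_eq_integral[symmetric])
        (use integrable_ball_Lp[OF Lp_heis_sym(1)[OF f(1) d]] p_gt1 in auto)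
    also have "\<dots> = (\<integral>\<^sup>+v. ennreal (1 / d powr (Q / p)) *
        (\<lambda>x. if heis_dist u0 x < r then ennreal (norm (f x)) else 0) (heis_dil (1 / d) (w \<cdot>\<^sub>H v)) \<partial>lborel)"
      unfolding \<phi> dist heis_sym_def Q_eq[symmetric] using r
      by (intro nn_integral_cong) (auto simp: indicator_def ennreal_mult[symmetric])
    also have "\<dots> = ennreal (1 / d powr (Q / p)) *
        (\<integral>\<^sup>+v. (\<lambda>x. if heis_dist u0 x < r then ennreal (norm (f x)) else 0) (heis_dil (1 / d) (w \<cdot>\<^sub>H v)) \<partial>lborel)"
      by (rule nn_integral_cmult) measurable
    also have "\<dots> = ennreal (1 / d powr (Q / p)) * (ennreal (d powr Q) *
        (\<integral>\<^sup>+x. (if heis_dist u0 x < r then ennreal (norm (f x)) else 0) \<partial>lborel))"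
      unfolding Q_eq by (subst nn_integral_heis_sym[OF _ d]) auto
    also have "\<dots> \<ge> ennreal (1 / d powr (Q / p)) * (ennreal (d powr Q) * ennreal (A * r powr (Q * (1 - 1 / p))))"
      using big by (intro mult_left_mono) auto
    also have "ennreal (1 / d powr (Q / p)) * (ennreal (d powr Q) * ennreal (A * r powr (Q * (1 - 1 / p)))) =
      ennreal (1 / d powr (Q / p) * (d powr Q * (A * r powr (Q * (1 - 1 / p)))))"
      using A by (simp add: ennreal_mult[symmetric])
    also have "1 / d powr (Q / p) * (d powr Q * (A * r powr (Q * (1 - 1 / p)))) = A"
    proof -
      have "1 / d powr (Q / p) = r powr (Q / p)" "d powr Q = r powr - Q"
        using r by (simp_all add: d_def powr_divide powr_minus_divide)
      moreover have "r powr (Q / p) * (r powr - Q * r powr (Q * (1 - 1 / p))) = r powr (Q / p + (- Q + Q * (1 - 1 / p)))"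
        by (simp only: powr_add)
      moreover have "Q / p + (- Q + Q * (1 - 1 / p)) = 0" by (simp add: algebra_simps)
      ultimately show ?thesis using r by (simp add: mult_ac)
    qed
    finally have "A \<le> ball_integral ?h"
      using A by (simp add: ennreal_le_iff2)
    then show "\<exists>w d. d > 0 \<and> A \<le> ball_integral (heis_sym p w d f)"
      using d by blast
  qed
qed

lemma maximizing_seq_iff:
  fixes f :: "nat \<Rightarrow> 'n heis \<Rightarrow> complex"
  shows "maximizing_seq p q lam f \<longleftrightarrow> (\<forall>j. f j \<in> Lp_space p \<and> Lp_mass p (f j) = 1) \<and>
    (\<lambda>j. Lp_mass q (frac_int lam (f j))) \<longlonglongrightarrow> hls_c powr q"
proof -
  have pq0: "p > 0" "q > 0" using p_gt1 q_gt1 by auto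
  have 1: "(\<forall>j. f j \<in> Lp_space p \<and> Lp_norm p (f j) = 1) \<longleftrightarrow> (\<forall>j. f j \<in> Lp_space p \<and> Lp_mass p (f j) = 1)"
    using Lp_norm_eq_1_iff pq0 by metis
  have "(\<lambda>j. Lp_norm q (frac_int lam (f j))) \<longlonglongrightarrow> HLS_const TYPE('n) p q lam \<longleftrightarrow>
    (\<lambda>j. Lp_mass q (frac_int lam (f j))) \<longlonglongrightarrow> hls_c powr q" if f: "\<forall>j. f j \<in> Lp_space p"
  proof -
    have "(\<lambda>j. Lp_norm q (frac_int lam (f j))) \<longlonglongrightarrow> HLS_const TYPE('n) p q lam \<longleftrightarrow>
      (\<lambda>j. Lp_mass q (frac_int lam (f j)) powr (1 / q)) \<longlonglongrightarrow> hls_c"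
      unfolding HLS_const_eq using f frac_int_Lq by (simp add: Lp_norm_eq tendsto_ennreal_iff hls_c_nonneg)
    also have "\<dots> \<longleftrightarrow> (\<lambda>j. Lp_mass q (frac_int lam (f j))) \<longlonglongrightarrow> hls_c powr q"
    proof
      assume "(\<lambda>j. Lp_mass q (frac_int lam (f j)) powr (1 / q)) \<longlonglongrightarrow> hls_c"
      then have "(\<lambda>j. (Lp_mass q (frac_int lam (f j)) powr (1 / q)) powr q) \<longlonglongrightarrow> hls_c powr q"
        using hls_c_pos by (intro tendsto_powr tendsto_const) auto
      then show "(\<lambda>j. Lp_mass q (frac_int lam (f j))) \<longlonglongrightarrow> hls_c powr q"
        using pq0 by (simp add: powr_powr)
    next
      assume "(\<lambda>j. Lp_mass q (frac_int lam (f j))) \<longlonglongrightarrow> hls_c powr q"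
      then have "(\<lambda>j. Lp_mass q (frac_int lam (f j)) powr (1 / q)) \<longlonglongrightarrow> (hls_c powr q) powr (1 / q)"
        using hls_c_pos by (intro tendsto_powr tendsto_const) auto
      then show "(\<lambda>j. Lp_mass q (frac_int lam (f j)) powr (1 / q)) \<longlonglongrightarrow> hls_c"
        using pq0 hls_c_pos by (simp add: powr_powr)
    qed
    finally show ?thesis .
  qed
  with 1 show ?thesis unfolding maximizing_seq_def by blast
qed

lemma maximizing_seq_heis_sym:
  fixes f :: "nat \<Rightarrow> 'n heis \<Rightarrow> complex"
  assumes f: "maximizing_seq p q lam f" and d: "\<And>j. d j > 0"
  shows "maximizing_seq p q lam (\<lambda>j. heis_sym p (w j) (d j) (f j))"
proof -
  have pq0: "p > 0" "q > 0" using p_gt1 q_gt1 by auto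
  have fj: "f j \<in> Lp_space p" "Lp_mass p (f j) = 1" for j using f by (auto simp: maximizing_seq_iff)
  have "Lp_mass q (frac_int lam (heis_sym p (w j) (d j) (f j))) = Lp_mass q (frac_int lam (f j))" for j
    using frac_int_heis_sym[OF Lp_space_measurable[OF fj(1)] d] Lp_heis_sym(2)[OF frac_int_Lq[OF fj(1)] d pq0(2)] by simp
  then show ?thesis using f Lp_heis_sym[OF fj(1) d pq0(1)] unfolding maximizing_seq_iff by (simp add: fj)
qed

text \<open>Needed because attainment is claimed without a given sequence. The supremum is over a
  nonempty set: an empty one would give 0, against \<open>hls_c_pos\<close>.\<close>

lemma maximizing_seq_exists: "\<exists>f :: nat \<Rightarrow> 'n heis \<Rightarrow> complex. maximizing_seq p q lam f"
proof -
  define S where "S = {Lp_norm q (frac_int lam f) | f :: 'n heis \<Rightarrow> complex. f \<in> Lp_space p \<and> Lp_norm p f = 1}"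
  have S: "HLS_const TYPE('n) p q lam = Sup S" by (simp add: HLS_const_def S_def)
  have "S \<noteq> {}"
  proof
    assume "S = {}"
    then have "ennreal hls_c = 0" using S HLS_const_eq by (simp add: bot_ennreal)
    then show False using hls_c_pos by simp
  qed
  then obtain y :: "nat \<Rightarrow> ennreal" where y: "incseq y" "range y \<subseteq> S" "Sup S = (SUP i. y i)"
    using ennreal_Sup_countable_SUP by metis
  have "\<forall>i. \<exists>f :: 'n heis \<Rightarrow> complex. f \<in> Lp_space p \<and> Lp_norm p f = 1 \<and> y i = Lp_norm q (frac_int lam f)"
    using y(2) unfolding S_def by blast
  then obtain f :: "nat \<Rightarrow> 'n heis \<Rightarrow> complex" where f: "\<And>i. f i \<in> Lp_space p" "\<And>i. Lp_norm p (f i) = 1" "\<And>i. y i = Lp_norm q (frac_int lam (f i))"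
    by metis
  have "y \<longlonglongrightarrow> HLS_const TYPE('n) p q lam" unfolding S y(3) by (rule LIMSEQ_SUP[OF y(1)])
  moreover have "y = (\<lambda>i. Lp_norm q (frac_int lam (f i)))" using f(3) by blast
  ultimately show ?thesis unfolding maximizing_seq_def using f by (intro exI[of _ f]) simp
qed

lemma maximizing_seq_symmetrize:
  fixes f :: "nat \<Rightarrow> 'n heis \<Rightarrow> complex"
  assumes f: "maximizing_seq p q lam f"
  shows "\<exists>w d. (\<forall>j. d j > 0) \<and> (\<forall>e :: nat \<Rightarrow> nat. strict_mono e \<longrightarrow> (\<exists>r g. extremal_limit (\<lambda>j. heis_sym p (w (e j)) (d (e j)) (f (e j))) r g))"
proof (rule heis_sym_nonvanishing)
  fix \<eta> :: real assume \<eta>: "\<eta> > 0" and *: "\<And>f :: 'n heis \<Rightarrow> complex. f \<in> Lp_space p \<Longrightarrow> Lp_mass p f = 1 \<Longrightarrow> Lp_mass q (frac_int lam f) > hls_c powr q / 2 \<Longrightarrow>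
      \<exists>w d. d > 0 \<and> \<eta> \<le> ball_integral (heis_sym p w d f)"
  have fj: "f j \<in> Lp_space p" "Lp_mass p (f j) = 1" for j using f by (auto simp: maximizing_seq_iff)
  define P where "P j w d \<longleftrightarrow> d > 0 \<and> (Lp_mass q (frac_int lam (f j)) > hls_c powr q / 2 \<longrightarrow>
      \<eta> \<le> ball_integral (heis_sym p w d (f j)))" for j w d
  have "\<exists>w d. P j w d" for j
    unfolding P_def using *[OF fj, of j] zero_less_one by blast
  then obtain w d where "\<And>j. P j (w j) (d j)" by metis
  then have wd: "\<And>j. d j > 0" "\<And>j. Lp_mass q (frac_int lam (f j)) > hls_c powr q / 2 \<Longrightarrow>
      \<eta> \<le> ball_integral (heis_sym p (w j) (d j) (f j))"
    unfolding P_def by blast+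
  define h where "h j = heis_sym p (w j) (d j) (f j)" for j
  have hm: "maximizing_seq p q lam h" unfolding h_def by (rule maximizing_seq_heis_sym[OF f wd(1)])
  then have h: "h j \<in> Lp_space p" "Lp_mass p (h j) = 1" and hlim: "(\<lambda>j. Lp_mass q (frac_int lam (h j))) \<longlonglongrightarrow> hls_c powr q" for j
    unfolding maximizing_seq_iff by auto
  have flim: "(\<lambda>j. Lp_mass q (frac_int lam (f j))) \<longlonglongrightarrow> hls_c powr q" using f unfolding maximizing_seq_iff by auto
  have "hls_c powr q / 2 < hls_c powr q" using hls_c_pos by simp
  from order_tendstoD(1)[OF flim this] have ev: "eventually (\<lambda>j. \<eta> \<le> ball_integral (h j)) sequentially"
    by eventually_elim (simp add: wd(2) h_def)
  have "\<exists>r g. extremal_limit (\<lambda>j. h (e j)) r g" if e: "strict_mono e" for e :: "nat \<Rightarrow> nat"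
  proof (rule maximizing_compact[of "\<lambda>j. h (e j)", OF h(1) h(2) _ \<eta>])
    show "(\<lambda>j. Lp_mass q (frac_int lam (h (e j)))) \<longlonglongrightarrow> hls_c powr q"
      using LIMSEQ_subseq_LIMSEQ[OF hlim e] by (simp add: o_def)
    show "eventually (\<lambda>j. \<eta> \<le> ball_integral (h (e j))) sequentially"
      using ev filterlim_subseq[OF e] by (rule eventually_compose_filterlim)
  qed
  then show ?thesis unfolding h_def using wd(1) by blast
qed

end

section \<open>Compactness in the topology of Lebesgue spaces\<close>

text \<open>If one argument is zero, the claim reduces to \<open>s powr p \<le> s\<close> on the
  unit interval; otherwise it is convexity on the positive half-line.\<close>

lemma powr_convex_combination:
  fixes x y t p :: real
  assumes "p \<ge> 1" "0 \<le> x" "0 \<le> y" "0 < t" "t < 1"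
  shows "(t * x + (1 - t) * y) powr p \<le> t * x powr p + (1 - t) * y powr p"
proof -
  have le: "s powr p \<le> s" if "0 < s" "s < 1" for s :: real
    using powr_mono'[of 1 p s] that assms by simp
  consider "x = 0" | "y = 0" | "x > 0" "y > 0" using assms by linarith
  then show ?thesis
  proof cases
    case 1
    then show ?thesis using le[of "1 - t"] assms by (simp add: powr_mult mult_right_mono)
  next
    case 2
    then show ?thesis using le[of t] assms by (simp add: powr_mult mult_right_mono)
  next
    case 3
    then show ?thesis using convex_onD[OF powr_convex[OF assms(1)], of "1 - t" x y] assms by (simp add: algebra_simps)
  qed
qed

text \<open>Convexity of the power with weights \<open>a / (a + b)\<close> and
  \<open>b / (a + b)\<close>, applied to the functions divided by \<open>a\<close> and
  \<open>b\<close>. Positive upper bounds replace the norms, which may be zero.\<close>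

lemma Minkowski_Lp_aux:
  assumes f: "f \<in> Lp_space p" and g: "g \<in> Lp_space p" and p: "p \<ge> 1"
    and a: "a > 0" "Lp_mass p f \<le> a powr p" and b: "b > 0" "Lp_mass p g \<le> b powr p"
  shows "Lp_mass p (\<lambda>u. f u + g u) \<le> (a + b) powr p"
proof -
  have p0: "p > 0" using p by simp
  define t where "t = a / (a + b)"
  have t: "0 < t" "t < 1" "1 - t = b / (a + b)" using a b by (auto simp: t_def field_simps)
  define W where "W u = (a + b) powr p * (t * (norm (f u) powr p / a powr p) + (1 - t) * (norm (g u) powr p / b powr p))" for u
  have "Lp_mass p (\<lambda>u. f u + g u) \<le> (LINT u|lborel. W u)"
    unfolding Lp_mass_def
  proof (rule integral_mono)
    show "integrable lborel (\<lambda>u. norm (f u + g u) powr p)"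
      using Lp_space_integrable[OF Lp_space_add(1)[OF f g p0]] .
    show "integrable lborel W"
      unfolding W_def using Lp_space_integrable[OF f] Lp_space_integrable[OF g]
      by (intro integrable_mult_right Bochner_Integration.integrable_add integrable_divide)
    fix u
    have "norm (f u + g u) powr p \<le> (norm (f u) + norm (g u)) powr p"
      using p by (intro powr_mono2 norm_triangle_ineq) auto
    also have "norm (f u) + norm (g u) = (a + b) * (t * (norm (f u) / a) + (1 - t) * (norm (g u) / b))"
    proof -
      have "(a + b) * t = a" "(a + b) * (1 - t) = b" unfolding t(3) using a b by (simp_all add: t_def)
      then show ?thesis using a b by (simp add: distrib_left mult.assoc[symmetric])
    qed
    also have "\<dots> powr p = (a + b) powr p * (t * (norm (f u) / a) + (1 - t) * (norm (g u) / b)) powr p"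
      by (rule powr_mult)
    also have "\<dots> \<le> (a + b) powr p * (t * (norm (f u) / a) powr p + (1 - t) * (norm (g u) / b) powr p)"
      using a b t p by (intro mult_left_mono powr_convex_combination) auto
    also have "\<dots> = W u" using a b by (simp add: W_def powr_divide)
    finally show "norm (f u + g u) powr p \<le> W u" .
  qed
  also have "\<dots> = (a + b) powr p * (t * (Lp_mass p f / a powr p) + (1 - t) * (Lp_mass p g / b powr p))"
    unfolding W_def Lp_mass_def using Lp_space_integrable[OF f] Lp_space_integrable[OF g] by simp
  also have "\<dots> \<le> (a + b) powr p * (t * 1 + (1 - t) * 1)"
    using a b t by (intro mult_left_mono add_mono) (auto simp: divide_le_eq)
  finally show ?thesis by simp
qed

lemma Minkowski_Lp:
  assumes f: "f \<in> Lp_space p" and g: "g \<in> Lp_space p" and p: "p \<ge> 1"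
  shows "Lp_mass p (\<lambda>u. f u + g u) powr (1 / p) \<le> Lp_mass p f powr (1 / p) + Lp_mass p g powr (1 / p)"
proof (rule field_le_epsilon)
  fix e :: real assume e: "e > 0"
  \<comment> \<open>The added \<open>e / 2\<close> keeps both bounds positive if a mass is
    zero.\<close>
  define a b where "a = Lp_mass p f powr (1 / p) + e / 2" and "b = Lp_mass p g powr (1 / p) + e / 2"
  have ab: "a > 0" "b > 0" using e by (auto simp: a_def b_def add_nonneg_pos)
  have "Lp_mass p f \<le> a powr p" "Lp_mass p g \<le> b powr p"
  proof -
    have "(Lp_mass p h powr (1 / p)) powr p \<le> (Lp_mass p h powr (1 / p) + e / 2) powr p" for h :: "'a \<Rightarrow> complex"
      using e p by (intro powr_mono2) auto
    then show "Lp_mass p f \<le> a powr p" "Lp_mass p g \<le> b powr p"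
      using p by (simp_all add: powr_powr a_def b_def)
  qed
  then have "Lp_mass p (\<lambda>u. f u + g u) \<le> (a + b) powr p"
    using ab by (intro Minkowski_Lp_aux[OF f g p]) auto
  then have "Lp_mass p (\<lambda>u. f u + g u) powr (1 / p) \<le> ((a + b) powr p) powr (1 / p)"
    using p by (intro powr_mono2) auto
  also have "\<dots> = a + b" using ab p by (simp add: powr_powr)
  finally show "Lp_mass p (\<lambda>u. f u + g u) powr (1 / p) \<le> Lp_mass p f powr (1 / p) + Lp_mass p g powr (1 / p) + e"
    by (simp add: a_def b_def)
qed

section \<open>From the pseudometric to a metric space\<close>

definition Lp_dist :: "real \<Rightarrow> ('a::euclidean_space \<Rightarrow> complex) \<Rightarrow> ('a \<Rightarrow> complex) \<Rightarrow> real" where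
  "Lp_dist p f g = Lp_mass p (\<lambda>u. f u - g u) powr (1 / p)"

lemma Lp_norm_diff: "f \<in> Lp_space p \<Longrightarrow> g \<in> Lp_space p \<Longrightarrow> p > 0 \<Longrightarrow> Lp_norm p (\<lambda>u. f u - g u) = ennreal (Lp_dist p f g)"
  by (simp add: Lp_norm_eq Lp_space_diff Lp_dist_def)

lemma Lp_dist_nonneg [simp]: "Lp_dist p f g \<ge> 0"
  by (simp add: Lp_dist_def)

lemma Lp_dist_commute: "Lp_dist p f g = Lp_dist p g f"
  by (simp add: Lp_dist_def Lp_mass_def norm_minus_commute)

lemma Lp_dist_triangle:
  assumes "f \<in> Lp_space p" "g \<in> Lp_space p" "h \<in> Lp_space p" "p \<ge> 1"
  shows "Lp_dist p f h \<le> Lp_dist p f g + Lp_dist p g h"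
  using Minkowski_Lp[OF Lp_space_diff(1)[OF assms(1,2)] Lp_space_diff(1)[OF assms(2,3)] assms(4)] assms(4)
  by (simp add: Lp_dist_def)

lemma Lp_dist_eq_0_iff:
  assumes "f \<in> Lp_space p" "g \<in> Lp_space p" "p > 0"
  shows "Lp_dist p f g = 0 \<longleftrightarrow> (AE u in lborel. f u = g u)"
  using Lp_mass_eq_0_iff[OF Lp_space_diff(1)[OF assms]] by (simp add: Lp_dist_def)

lemma Lp_dist_cong_AE:
  assumes "f \<in> Lp_space p" "f' \<in> Lp_space p" "g \<in> Lp_space p" "g' \<in> Lp_space p"
    and "AE u in lborel. f u = f' u" "AE u in lborel. g u = g' u"
  shows "Lp_dist p f g = Lp_dist p f' g'"
proof -
  have [measurable]: "f \<in> borel_measurable borel" "f' \<in> borel_measurable borel" "g \<in> borel_measurable borel" "g' \<in> borel_measurable borel"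
    using assms by (simp_all add: Lp_space_iff)
  have "AE u in lborel. f u - g u = f' u - g' u" using assms(5,6) by eventually_elim simp
  then have "Lp_mass p (\<lambda>u. f u - g u) = Lp_mass p (\<lambda>u. f' u - g' u)"
    by (intro Lp_mass_cong_AE) auto
  then show ?thesis by (simp add: Lp_dist_def)
qed

text \<open>One representative is chosen from each class of almost everywhere equality, so that \<open>Lp_dist\<close>
  becomes a metric on the set of representatives.\<close>

definition Lp_rep :: "real \<Rightarrow> ('a::euclidean_space \<Rightarrow> complex) \<Rightarrow> 'a \<Rightarrow> complex" where
  "Lp_rep p f = (SOME g. g \<in> Lp_space p \<and> (AE u in lborel. f u = g u))"

lemma Lp_rep:
  assumes "f \<in> Lp_space p"
  shows "Lp_rep p f \<in> Lp_space p" "AE u in lborel. f u = Lp_rep p f u"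
proof -
  have "Lp_rep p f \<in> Lp_space p \<and> (AE u in lborel. f u = Lp_rep p f u)"
    unfolding Lp_rep_def by (rule someI[of _ f]) (use assms in auto)
  then show "Lp_rep p f \<in> Lp_space p" "AE u in lborel. f u = Lp_rep p f u" by auto
qed

lemma Lp_rep_eq:
  assumes "AE u in lborel. f u = g u"
  shows "Lp_rep p f = Lp_rep p g"
proof -
  have "(AE u in lborel. f u = k u) \<longleftrightarrow> (AE u in lborel. g u = k u)" for k
  proof
    assume "AE u in lborel. f u = k u"
    with assms show "AE u in lborel. g u = k u" by eventually_elim simp
  next
    assume "AE u in lborel. g u = k u"
    with assms show "AE u in lborel. f u = k u" by eventually_elim simp
  qed
  then show ?thesis by (simp add: Lp_rep_def)
qed

lemma Lp_rep_rep: "f \<in> Lp_space p \<Longrightarrow> Lp_rep p (Lp_rep p f) = Lp_rep p f"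
  using Lp_rep_eq[OF Lp_rep(2)] by metis

lemma Lp_dist_rep:
  assumes "f \<in> Lp_space p" "g \<in> Lp_space p"
  shows "Lp_dist p (Lp_rep p f) (Lp_rep p g) = Lp_dist p f g" "Lp_dist p f (Lp_rep p g) = Lp_dist p f g"
    "Lp_dist p (Lp_rep p f) g = Lp_dist p f g"
  by (intro Lp_dist_cong_AE[symmetric]; use assms Lp_rep in \<open>auto\<close>)+

lemma Metric_space_Lp_rep:
  assumes p: "p \<ge> 1"
  shows "Metric_space (Lp_rep p ` Lp_space p) (Lp_dist p :: ('a::euclidean_space \<Rightarrow> complex) \<Rightarrow> _)"
proof
  fix f g :: "'a \<Rightarrow> complex"
  assume fg: "f \<in> Lp_rep p ` Lp_space p" "g \<in> Lp_rep p ` Lp_space p"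
  then have L: "f \<in> Lp_space p" "g \<in> Lp_space p" using Lp_rep(1) by auto
  have "Lp_rep p f = f" "Lp_rep p g = g" using fg Lp_rep_rep by auto
  note rep = this
  have "(AE u in lborel. f u = g u) \<longleftrightarrow> f = g"
  proof
    assume "AE u in lborel. f u = g u"
    then have "Lp_rep p f = Lp_rep p g" by (rule Lp_rep_eq)
    from trans[OF rep(1)[symmetric] trans[OF this rep(2)]] show "f = g" .
  next
    assume "f = g"
    then show "AE u in lborel. f u = g u" by simp
  qed
  then show "Lp_dist p f g = 0 \<longleftrightarrow> f = g" using Lp_dist_eq_0_iff[OF L] p by simp
  fix h :: "'a \<Rightarrow> complex" assume "h \<in> Lp_rep p ` Lp_space p"
  then have "h \<in> Lp_space p" using Lp_rep(1) by auto
  then show "Lp_dist p f h \<le> Lp_dist p f g + Lp_dist p g h" using Lp_dist_triangle[OF L] p by auto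
qed (auto simp: Lp_dist_commute)

lemma Lp_openD:
  assumes "openin (Lp_topology p) V" "f \<in> V" "p > 0"
  obtains e where "e > 0" "\<And>g. g \<in> Lp_space p \<Longrightarrow> Lp_dist p f g < e \<Longrightarrow> g \<in> V"
proof -
  have V: "Lp_open p V" using assms(1) by (simp add: openin_Lp_topology)
  then obtain e where e: "e > 0" "\<forall>g\<in>Lp_space p. Lp_norm p (\<lambda>u. g u - f u) < ennreal e \<longrightarrow> g \<in> V"
    using assms(2) unfolding Lp_open_def by blast
  have "f \<in> Lp_space p" using V assms(2) unfolding Lp_open_def by blast
  then show ?thesis using e assms(3)
    by (intro that[of e]) (auto simp: Lp_norm_diff Lp_dist_commute[of p f] ennreal_less_iff)
qed

lemma openin_Lp_ball:
  fixes f :: "'a::euclidean_space \<Rightarrow> complex"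
  assumes f: "f \<in> Lp_space p" and p: "p \<ge> 1"
  shows "openin (Lp_topology p) {g \<in> Lp_space p. Lp_dist p f g < e}"
  unfolding openin_Lp_topology Lp_open_def
proof (intro conjI ballI)
  fix g assume "g \<in> {g \<in> Lp_space p. Lp_dist p f g < e}"
  then have g: "g \<in> Lp_space p" "Lp_dist p f g < e" by auto
  show "\<exists>e'>0. \<forall>k\<in>Lp_space p. Lp_norm p (\<lambda>u. k u - g u) < ennreal e' \<longrightarrow> k \<in> {g \<in> Lp_space p. Lp_dist p f g < e}"
  proof (intro exI[of _ "e - Lp_dist p f g"] conjI ballI impI)
    fix k :: "'a \<Rightarrow> complex" assume k: "k \<in> Lp_space p" "Lp_norm p (\<lambda>u. k u - g u) < ennreal (e - Lp_dist p f g)"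
    then have "Lp_dist p g k < e - Lp_dist p f g"
      using g p by (simp add: Lp_norm_diff ennreal_less_iff Lp_dist_commute)
    then show "k \<in> {g \<in> Lp_space p. Lp_dist p f g < e}"
      using Lp_dist_triangle[OF f g(1) k(1) p] k(1) by simp
  qed (use g in simp)
qed auto

text \<open>Compactness is proved by Bolzano-Weierstrass in the metric space of representatives and
  carried back to \<open>Lp_topology\<close>, whose open sets do not distinguish functions that
  agree almost everywhere.\<close>

lemma relatively_compactin_Lp_range:
  fixes h :: "nat \<Rightarrow> 'a::euclidean_space \<Rightarrow> complex"
  assumes p: "p \<ge> 1" and h: "\<And>j. h j \<in> Lp_space p"
    and sub: "\<And>e :: nat \<Rightarrow> nat. strict_mono e \<Longrightarrow>
      \<exists>r l. strict_mono r \<and> l \<in> Lp_space p \<and> (\<lambda>j. Lp_mass p (\<lambda>u. h (e (r j)) u - l u)) \<longlonglongrightarrow> 0"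
  shows "relatively_compactin (Lp_topology p) (range h)"
proof -
  have p0: "p > 0" using p by simp
  define X where "X = Lp_rep p ` (Lp_space p :: ('a \<Rightarrow> complex) set)"
  interpret M: Metric_space X "Lp_dist p" unfolding X_def by (rule Metric_space_Lp_rep[OF p])
  have XL: "X \<subseteq> Lp_space p" unfolding X_def using Lp_rep(1) by auto
  define S where "S = Lp_rep p ` range h"
  have SX: "S \<subseteq> X" unfolding S_def X_def using h by auto
  have "compactin M.mtopology (M.mtopology closure_of S)"
    unfolding M.compact_closure_of_eq_Bolzano_Weierstrass
  proof (intro allI impI, elim conjE)
    fix T assume T: "infinite T" "T \<subseteq> S"
    \<comment> \<open>One index for each member of \<open>T\<close>. Listed in increasing order,
      these indices form a subsequence to which \<open>sub\<close> applies and whose representatives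
      are pairwise distinct.\<close>
    define I where "I = (\<lambda>t. SOME j. Lp_rep p (h j) = t) ` T"
    have some: "Lp_rep p (h (SOME j. Lp_rep p (h j) = t)) = t" if "t \<in> T" for t
      by (rule someI_ex) (use that T(2) in \<open>auto simp: S_def\<close>)
    have "inj_on (\<lambda>t. SOME j. Lp_rep p (h j) = t) T"
      by (rule inj_on_inverseI[where g="\<lambda>j. Lp_rep p (h j)"]) (rule some)
    then have "infinite I" unfolding I_def using T(1) finite_imageD by blast
    then obtain e :: "nat \<Rightarrow> nat" where e: "strict_mono e" "\<And>k. e k \<in> I"
      using infinite_enumerate by blast
    have inj: "inj_on (\<lambda>j. Lp_rep p (h j)) I"
      unfolding I_def using some by (auto simp: inj_on_def)
    have inT: "Lp_rep p (h j) \<in> T" if "j \<in> I" for j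
      using that some unfolding I_def by auto
    obtain r l where r: "strict_mono r" "l \<in> Lp_space p" "(\<lambda>j. Lp_mass p (\<lambda>u. h (e (r j)) u - l u)) \<longlonglongrightarrow> 0"
      using sub[OF e(1)] by blast
    define y where "y j = Lp_rep p (h (e (r j)))" for j
    have yT: "y j \<in> T" for j using inT e(2) by (simp add: y_def)
    have yinj: "y i \<noteq> y j" if "i \<noteq> j" for i j
    proof
      assume "y i = y j"
      then have "e (r i) = e (r j)" using inj e(2) unfolding y_def inj_on_def by blast
      then show False using that e(1) r(1) by (simp add: strict_mono_eq)
    qed
    have "(\<lambda>j. Lp_mass p (\<lambda>u. h (e (r j)) u - l u) powr (1 / p)) \<longlonglongrightarrow> 0 powr (1 / p)"
      using p0 r(3) by (intro tendsto_powr' tendsto_const) auto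
    then have yl: "(\<lambda>j. Lp_dist p (Lp_rep p l) (y j)) \<longlonglongrightarrow> 0"
      using h r(2) by (simp add: y_def Lp_dist_rep Lp_dist_commute[of p l]) (simp add: Lp_dist_def)
    have "Lp_rep p l \<in> M.mtopology derived_set_of T"
      unfolding M.metric_derived_set_of
    proof (intro CollectI conjI allI impI)
      show "Lp_rep p l \<in> X" using r(2) by (simp add: X_def)
      fix \<epsilon> :: real assume "\<epsilon> > 0"
      then have "eventually (\<lambda>j. Lp_dist p (Lp_rep p l) (y j) < \<epsilon>) sequentially"
        by (rule order_tendstoD(2)[OF yl])
      then obtain N where N: "\<And>j. j \<ge> N \<Longrightarrow> Lp_dist p (Lp_rep p l) (y j) < \<epsilon>"
        by (auto simp: eventually_sequentially)
      \<comment> \<open>A derived point must be approached by points other than itself; since the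
        \<open>y j\<close> are distinct, at least one of two consecutive ones differs from the
        limit.\<close>
      obtain j where j: "j \<ge> N" "y j \<noteq> Lp_rep p l"
        using yinj[of N "Suc N"] by (metis le_SucI n_not_Suc_n order_refl)
      have "y j \<in> M.mball (Lp_rep p l) \<epsilon>"
        using N[OF j(1)] yT[of j] T(2) SX \<open>Lp_rep p l \<in> X\<close> by (auto simp: M.in_mball)
      then show "\<exists>y\<in>T. y \<noteq> Lp_rep p l \<and> y \<in> M.mball (Lp_rep p l) \<epsilon>" using j(2) yT by blast
    qed
    then show "M.mtopology derived_set_of T \<noteq> {}" by blast
  qed
  note comp = this
  define K where "K = Lp_topology p closure_of range h"
  have KL: "K \<subseteq> Lp_space p" unfolding K_def using closure_of_subset_topspace topspace_Lp_topology by metis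
  have to_K: "x \<in> K" if x: "x \<in> M.mtopology closure_of S" for x
    unfolding K_def in_closure_of
  proof (intro conjI allI impI)
    have xX: "x \<in> X" using x by (simp add: M.metric_closure_of)
    then show "x \<in> topspace (Lp_topology p)" using XL by (auto simp: topspace_Lp_topology)
    fix V assume "x \<in> V \<and> openin (Lp_topology p) V"
    then have V: "x \<in> V" "openin (Lp_topology p) V" by auto
    obtain e where e: "e > 0" "\<And>g. g \<in> Lp_space p \<Longrightarrow> Lp_dist p x g < e \<Longrightarrow> g \<in> V"
      using Lp_openD[OF V(2,1) p0] by blast
    then obtain j where "Lp_rep p (h j) \<in> M.mball x e"
      using x unfolding M.metric_closure_of S_def by blast
    then have "Lp_dist p x (h j) < e"
      using xX XL h by (auto simp: M.in_mball Lp_dist_rep)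
    then show "\<exists>y. y \<in> range h \<and> y \<in> V" using e(2) h by blast
  qed
  have from_K: "Lp_rep p k \<in> M.mtopology closure_of S" if k: "k \<in> K" for k
    unfolding M.metric_closure_of
  proof (intro CollectI conjI allI impI)
    have kL: "k \<in> Lp_space p" using k KL by blast
    then show kX: "Lp_rep p k \<in> X" by (simp add: X_def)
    fix e :: real assume e: "e > 0"
    have "Lp_dist p k k = 0" using Lp_dist_eq_0_iff[OF kL kL p0] by simp
    then have "k \<in> {g \<in> Lp_space p. Lp_dist p k g < e}" using kL e by simp
    moreover have "\<forall>V. k \<in> V \<and> openin (Lp_topology p) V \<longrightarrow> (\<exists>y. y \<in> range h \<and> y \<in> V)"
      using conjunct2[OF k[unfolded K_def in_closure_of]] .
    ultimately obtain y where "y \<in> range h" "y \<in> {g \<in> Lp_space p. Lp_dist p k g < e}"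
      using openin_Lp_ball[OF kL p, of e] by meson
    then obtain j where j: "Lp_dist p k (h j) < e" by auto
    have "Lp_rep p (h j) \<in> S" by (simp add: S_def)
    moreover have "Lp_rep p (h j) \<in> M.mball (Lp_rep p k) e"
      using j kL h kX calculation SX by (auto simp: M.in_mball Lp_dist_rep)
    ultimately show "\<exists>y\<in>S. y \<in> M.mball (Lp_rep p k) e" by blast
  qed
  have "compactin (Lp_topology p) K"
    unfolding compactin_def
  proof (intro conjI allI impI)
    show "K \<subseteq> topspace (Lp_topology p)" unfolding K_def by (rule closure_of_subset_topspace)
    fix \<U> assume "(\<forall>U\<in>\<U>. openin (Lp_topology p) U) \<and> K \<subseteq> \<Union>\<U>"
    then have \<U>: "\<forall>U\<in>\<U>. openin (Lp_topology p) U" "K \<subseteq> \<Union>\<U>" by auto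
    \<comment> \<open>The traces of the cover on the representatives are open for the metric. A
      finite subcover there lifts back, because each \<open>k\<close> in \<open>K\<close> is at
      distance zero from \<open>Lp_rep p k\<close> and so lies in the same open sets.\<close>
    define \<U>' where "\<U>' = (\<lambda>U. U \<inter> X) ` \<U>"
    have "openin M.mtopology (U \<inter> X)" if U: "U \<in> \<U>" for U
      unfolding M.openin_mtopology
    proof (intro conjI allI impI)
      fix x assume x: "x \<in> U \<inter> X"
      obtain e where e: "e > 0" "\<And>g. g \<in> Lp_space p \<Longrightarrow> Lp_dist p x g < e \<Longrightarrow> g \<in> U"
        using Lp_openD[of p U x] U \<U>(1) x p0 by blast
      have "M.mball x e \<subseteq> U \<inter> X" using e(2) XL by (auto simp: M.in_mball)
      then show "\<exists>r>0. M.mball x r \<subseteq> U \<inter> X" using e(1) by blast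
    qed simp
    then have op: "openin M.mtopology U" if "U \<in> \<U>'" for U using that by (auto simp: \<U>'_def)
    have cov: "M.mtopology closure_of S \<subseteq> \<Union>\<U>'"
    proof
      fix x assume x: "x \<in> M.mtopology closure_of S"
      then have "x \<in> X" by (simp add: M.metric_closure_of)
      then show "x \<in> \<Union>\<U>'" using to_K[OF x] \<U>(2) by (auto simp: \<U>'_def)
    qed
    obtain \<F>' where "finite \<F>'" "\<F>' \<subseteq> \<U>'" "M.mtopology closure_of S \<subseteq> \<Union>\<F>'"
      using compactinD[OF comp op cov] by blast
    then obtain \<F> where \<F>: "finite \<F>" "\<F> \<subseteq> \<U>" "\<F>' = (\<lambda>U. U \<inter> X) ` \<F>"
      unfolding \<U>'_def by (meson finite_subset_image)
    have "K \<subseteq> \<Union>\<F>"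
    proof
      fix k assume k: "k \<in> K"
      then have kL: "k \<in> Lp_space p" using KL by blast
      from from_K[OF k] \<open>M.mtopology closure_of S \<subseteq> \<Union>\<F>'\<close> obtain U where U: "U \<in> \<F>" "Lp_rep p k \<in> U"
        unfolding \<F>(3) by blast
      obtain e where e: "e > 0" "\<And>g. g \<in> Lp_space p \<Longrightarrow> Lp_dist p (Lp_rep p k) g < e \<Longrightarrow> g \<in> U"
        using Lp_openD[of p U "Lp_rep p k"] U \<F>(2) \<U>(1) p0 by blast
      have "Lp_dist p (Lp_rep p k) k = 0" using Lp_dist_eq_0_iff[OF kL kL p0] kL by (simp add: Lp_dist_rep)
      then show "k \<in> \<Union>\<F>" using e(1) e(2)[OF kL] U(1) by auto
    qed
    then show "\<exists>\<F>. finite \<F> \<and> \<F> \<subseteq> \<U> \<and> K \<subseteq> \<Union>\<F>" using \<F> by blast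
  qed
  then show ?thesis unfolding relatively_compactin_def K_def using h by (auto simp: topspace_Lp_topology)
qed

theorem theorem1:
  fixes lam p q Q :: real
  assumes "Q = hom_dim TYPE('n::finite)"
    and "0 < lam" and "lam < Q"
    and "1 < p" and "1 < q"
    and "1 / q = 1 / p - (Q - lam) / Q"
  shows "HLS_const TYPE('n) p q lam < \<infinity> \<and>
    (\<forall>f :: nat \<Rightarrow> 'n heis \<Rightarrow> complex. maximizing_seq p q lam f \<longrightarrow>
      (\<exists>(w :: nat \<Rightarrow> 'n heis) (d :: nat \<Rightarrow> real). (\<forall>j. 0 < d j) \<and>
        (let h = (\<lambda>j u. (1 / d j powr (Q / p)) *\<^sub>R f j (heis_dil (1 / d j) (w j \<cdot>\<^sub>H u)))
         in maximizing_seq p q lam h \<and>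
            relatively_compactin (Lp_topology p) (range h)))) \<and>
    (\<exists>f :: 'n heis \<Rightarrow> complex. f \<in> Lp_space p \<and> Lp_norm p f = 1 \<and>
        Lp_norm q (frac_int lam f) = HLS_const TYPE('n) p q lam)"
proof -
  interpret hls_exponents lam p q Q "TYPE('n)"
    using assms by unfold_locales
  have p: "p \<ge> 1" "p > 0" "q > 0" using assms by simp_all
  show ?thesis
  proof (intro conjI allI impI)
    show "HLS_const TYPE('n) p q lam < \<infinity>" by (rule HLS_const_finite)
  next
    fix f :: "nat \<Rightarrow> 'n heis \<Rightarrow> complex" assume f: "maximizing_seq p q lam f"
    from maximizing_seq_symmetrize[OF f] obtain w d where d: "\<forall>j. d j > 0" and
      sub: "\<And>e :: nat \<Rightarrow> nat. strict_mono e \<Longrightarrow> (\<exists>r g. extremal_limit (\<lambda>j. heis_sym p (w (e j)) (d (e j)) (f (e j))) r g)"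
      by blast
    define h where "h = (\<lambda>j u. (1 / d j powr (Q / p)) *\<^sub>R f j (heis_dil (1 / d j) (w j \<cdot>\<^sub>H u)))"
    have h_eq: "h = (\<lambda>j. heis_sym p (w j) (d j) (f j))"
      by (simp add: h_def heis_sym_def[abs_def] assms(1))
    have hm: "maximizing_seq p q lam h"
      unfolding h_eq using d by (intro maximizing_seq_heis_sym[OF f]) simp
    moreover have "relatively_compactin (Lp_topology p) (range h)"
    proof (rule relatively_compactin_Lp_range[OF p(1)])
      show "h j \<in> Lp_space p" for j using hm by (simp add: maximizing_seq_iff)
      show "\<exists>r l. strict_mono r \<and> l \<in> Lp_space p \<and> (\<lambda>j. Lp_mass p (\<lambda>u. h (e (r j)) u - l u)) \<longlonglongrightarrow> 0"
        if "strict_mono e" for e :: "nat \<Rightarrow> nat"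
        unfolding h_eq using sub[OF that] by blast
    qed
    ultimately show "\<exists>w d. (\<forall>j. 0 < d j) \<and>
        (let h = (\<lambda>j u. (1 / d j powr (Q / p)) *\<^sub>R f j (heis_dil (1 / d j) (w j \<cdot>\<^sub>H u)))
         in maximizing_seq p q lam h \<and> relatively_compactin (Lp_topology p) (range h))"
      using d unfolding h_def Let_def by blast
  next
    obtain f :: "nat \<Rightarrow> 'n heis \<Rightarrow> complex" where "maximizing_seq p q lam f"
      using maximizing_seq_exists by blast
    \<comment> \<open>With the identity in place of \<open>e\<close>, the symmetrized sequence has a
      subsequence whose limit is extremal.\<close>
    then obtain g :: "'n heis \<Rightarrow> complex" where g: "g \<in> Lp_space p" "Lp_mass p g = 1" "Lp_mass q (frac_int lam g) = hls_c powr q"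
      using maximizing_seq_symmetrize[of f] strict_mono_id by blast
    then have "Lp_norm p g = 1" "Lp_norm q (frac_int lam g) = HLS_const TYPE('n) p q lam"
      using Lp_norm_eq_1_iff[OF g(1) p(2)] Lp_norm_eq[OF frac_int_Lq[OF g(1)]] p(3) hls_c_pos
      by (simp_all add: HLS_const_eq powr_powr)
    then show "\<exists>f :: 'n heis \<Rightarrow> complex. f \<in> Lp_space p \<and> Lp_norm p f = 1 \<and>
        Lp_norm q (frac_int lam f) = HLS_const TYPE('n) p q lam" using g(1) by blast
  qed
qed

end
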